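(* Let $B$ be a Hopf algebra with bijective antipode $S$, let $B^*$ be the dual Hopf algebra, $\mathcal H(B^* )=B^*\# B$ the Heisenberg double and $\mathcal D(B)$ the Drinfeld double of $B$. Define $$(\mu\otimes m)\triangleright(\beta\# b)=\mu'''(m'\rightharpoonup\beta)\,{S^*}^{-1}(\mu'')\ \#\ \bigl((m''\,b\,S(m'''))\leftharpoonup {S^*}^{-1}(\mu')\bigr)$$ for $\mu\otimes m\in\mathcal D(B)$, $\beta\# b\in\mathcal H(B^* )$, and $$\delta:\mathcal H(B^* )\to\mathcal D(B)\otimes\mathcal H(B^* ),\qquad \delta(\beta\# b)=(\beta''\otimes b')\otimes(\beta'\# b'').$$ Then $\mathcal H(B^* )$, with the action $\triangleright$ and the coaction $\delta$, is a left--left Yetter--Drinfeld $\mathcal D(B)$-module algebra.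
   Context: Notation. Primes denote Sweedler components of the coproduct: $\Delta(b)=b'\otimes b''$, iterated $b'\otimes b''\otimes b'''$, etc. $\langle\ ,\ \rangle$ is evaluation; $B^*$ has product $\langle\alpha\beta,b\rangle=\langle\alpha,b'\rangle\langle\beta,b''\rangle$, coproduct $\beta\mapsto\beta'\otimes\beta''$ with $\langle\beta',a\rangle\langle\beta'',b\rangle=\langle\beta,ab\rangle$, unit $\varepsilon$ (the counit of $B$), and antipode $S^*$. Regular actions, for $b,m\in B$, $\beta,\mu\in B^*$: $b\rightharpoonup\beta=\langle\beta'',b\rangle\beta'$, $\ \beta\leftharpoonup m=\langle\beta',m\rangle\beta''$, $\ b\leftharpoonup\mu=\langle\mu,b'\rangle b''$. Heisenberg double: $\mathcal H(B^* )=B^*\# B$ is the vector space $B^*\otimes B$ with product $(\alpha\# a)(\beta\# b)=\alpha(a'\rightharpoonup\beta)\# a''b$. Drinfeld double: $\mathcal D(B)$ is the vector space $B^*\otimes B$ with product $(\mu\otimes m)(\nu\otimes n)=\mu(m'\rightharpoonup\nu\leftharpoonup S^{-1}(m'''))\otimes m''n$ and the coalgebra structure of $B^{*\mathrm{cop}}\otimes B$ ($B^{*\mathrm{cop}}$ being $B^*$ with opposite coproduct), i.e. $\Delta(\mu\otimes m)=(\mu''\otimes m')\otimes(\mu'\otimes m'')$. A left--left Yetter--Drinfeld $H$-module algebra (for a Hopf algebra $H$) is an algebra $X$ that is a left $H$-module algebra (action $\triangleright$) and a left $H$-comodule algebra (coaction $\delta:X\to H\otimes X$, $\delta(x)=x_{(-1)}\otimes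 x_{(0)}$, an algebra homomorphism) such that for all $h\in H$, $x\in X$ $$(h'\triangleright x)_{(-1)}h''\otimes(h'\triangleright x)_{(0)}=h'x_{(-1)}\otimes(h''\triangleright x_{(0)}).$$ *)

theory Defs
  imports Complex_Main "HOL-Library.Function_Algebras"
begin

section \<open>Vector spaces with carrier\<close>

text \<open>
  A vector space over the field given by the type \<open>'k\<close> is a subspace \<open>carr\<close> of an ambient
  vector space living on a type \<open>'a\<close>.  Carriers are needed because the dual and the tensor product
  are subsets of function types; all structure maps are only meaningful on the carriers.
\<close>

record ('k, 'a) space_data =
  carr :: "'a set"
  scl :: "'k \<Rightarrow> 'a \<Rightarrow> 'a"

locale lin_space =
  fixes V :: "('k::field, 'a::ab_group_add, 'z) space_data_scheme"
  assumes ambient: "vector_space (scl V)"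
    and subspace_carr: "module.subspace (scl V) (carr V)"

definition ground :: "('k::field, 'k) space_data"
  where "ground = \<lparr>carr = UNIV, scl = (*)\<rparr>"

definition fscale :: "'k::field \<Rightarrow> ('x \<Rightarrow> 'k) \<Rightarrow> 'x \<Rightarrow> 'k"
  where "fscale c f = (\<lambda>x. c * f x)"

definition linear_on ::
    "('k::field, 'a::ab_group_add, 'z) space_data_scheme \<Rightarrow>
     ('k, 'c::ab_group_add, 'y) space_data_scheme \<Rightarrow> ('a \<Rightarrow> 'c) \<Rightarrow> bool"
  where "linear_on V W f \<longleftrightarrow>
    (\<forall>x\<in>carr V. f x \<in> carr W) \<and>
    (\<forall>x\<in>carr V. \<forall>y\<in>carr V. f (x + y) = f x + f y) \<and>
    (\<forall>c. \<forall>x\<in>carr V. f (scl V c x) = scl W c (f x))"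

definition bilinear_on ::
    "('k::field, 'a::ab_group_add, 'z) space_data_scheme \<Rightarrow>
     ('k, 'b::ab_group_add, 'y) space_data_scheme \<Rightarrow>
     ('k, 'c::ab_group_add, 'x) space_data_scheme \<Rightarrow> ('a \<Rightarrow> 'b \<Rightarrow> 'c) \<Rightarrow> bool"
  where "bilinear_on V W U f \<longleftrightarrow>
    (\<forall>a\<in>carr V. linear_on W U (f a)) \<and> (\<forall>b\<in>carr W. linear_on V U (\<lambda>a. f a b))"


section \<open>Tensor products\<close>

text \<open>
  The pure tensor \<open>a \<otimes> b\<close> is realised as the evaluation functional \<open>\<phi> \<mapsto> \<phi> a b\<close> on bilinear
  forms, and \<open>V \<otimes> W\<close> is the span of the pure tensors.  Over a field this satisfies the universal
  property of the tensor product, see \<open>tensor_lift_linear\<close>, \<open>tensor_lift_tens\<close> and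
  \<open>tensor_linear_ext\<close> below.
\<close>

type_synonym ('k, 'a, 'b) tensor = "('a \<Rightarrow> 'b \<Rightarrow> 'k) \<Rightarrow> 'k"

definition tens ::
    "('k::field, 'a::ab_group_add, 'z) space_data_scheme \<Rightarrow>
     ('k, 'b::ab_group_add, 'y) space_data_scheme \<Rightarrow> 'a \<Rightarrow> 'b \<Rightarrow> ('k, 'a, 'b) tensor"
  where "tens V W a b = (\<lambda>\<phi>. if bilinear_on V W ground \<phi> then \<phi> a b else 0)"

definition tensor ::
    "('k::field, 'a::ab_group_add, 'z) space_data_scheme \<Rightarrow>
     ('k, 'b::ab_group_add, 'y) space_data_scheme \<Rightarrow> ('k, ('k, 'a, 'b) tensor) space_data"
  where "tensor V W =
    \<lparr>carr = module.span fscale {tens V W a b | a b. a \<in> carr V \<and> b \<in> carr W}, scl = fscale\<rparr>"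

definition tens_sum ::
    "('k::field, 'a::ab_group_add, 'z) space_data_scheme \<Rightarrow>
     ('k, 'b::ab_group_add, 'y) space_data_scheme \<Rightarrow> ('a \<times> 'b) list \<Rightarrow> ('k, 'a, 'b) tensor"
  where "tens_sum V W xs = (\<Sum>(a, b)\<leftarrow>xs. tens V W a b)"

text \<open>The linear map on \<open>V \<otimes> W\<close> with \<open>a \<otimes> b \<mapsto> f a b\<close>, for \<open>f\<close> bilinear on the carriers.\<close>

definition tensor_lift ::
    "('k::field, 'a::ab_group_add, 'z) space_data_scheme \<Rightarrow>
     ('k, 'b::ab_group_add, 'y) space_data_scheme \<Rightarrow>
     ('a \<Rightarrow> 'b \<Rightarrow> 'c::ab_group_add) \<Rightarrow> ('k, 'a, 'b) tensor \<Rightarrow> 'c"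
  where "tensor_lift V W f t =
    (THE y. \<exists>xs. set xs \<subseteq> carr V \<times> carr W \<and> t = tens_sum V W xs \<and> y = (\<Sum>(a, b)\<leftarrow>xs. f a b))"

lemma vector_space_ground: "vector_space ((*) :: 'k::field \<Rightarrow> 'k \<Rightarrow> 'k)"
  by unfold_locales (simp_all add: algebra_simps)

lemma lin_space_ground: "lin_space (ground :: ('k::field, 'k) space_data)"
proof -
  interpret vector_space "(*) :: 'k \<Rightarrow> 'k \<Rightarrow> 'k" by (rule vector_space_ground)
  show ?thesis by (simp add: lin_space_def ground_def vector_space_ground)
qed

lemma vector_space_fscale: "vector_space (fscale :: 'k::field \<Rightarrow> ('x \<Rightarrow> 'k) \<Rightarrow> 'x \<Rightarrow> 'k)"
  by unfold_locales (auto simp: fscale_def fun_eq_iff algebra_simps)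

interpretation fsc: vector_space "fscale :: 'k::field \<Rightarrow> ('x \<Rightarrow> 'k) \<Rightarrow> 'x \<Rightarrow> 'k"
  by (rule vector_space_fscale)

lemma lin_space_tensor: "lin_space (tensor V W)"
  by (simp add: lin_space_def tensor_def vector_space_fscale)

lemma tens_in_tensor: "a \<in> carr V \<Longrightarrow> b \<in> carr W \<Longrightarrow> tens V W a b \<in> carr (tensor V W)"
  by (auto simp: tensor_def intro!: fsc.span_base)

lemma tens_bilinear: "bilinear_on V W (tensor V W) (tens V W)"
  unfolding bilinear_on_def
proof (intro conjI ballI)
  fix a assume "a \<in> carr V"
  then show "linear_on W (tensor V W) (tens V W a)"
    unfolding linear_on_def
    by (auto simp: tens_in_tensor) (auto simp: tens_def fun_eq_iff tensor_def fscale_def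
        bilinear_on_def linear_on_def ground_def)
next
  fix b assume "b \<in> carr W"
  then show "linear_on V (tensor V W) (\<lambda>a. tens V W a b)"
    unfolding linear_on_def
    by (auto simp: tens_in_tensor) (auto simp: tens_def fun_eq_iff tensor_def fscale_def
        bilinear_on_def linear_on_def ground_def)
qed

lemma tens_sum_append: "tens_sum V W (xs @ ys) = tens_sum V W xs + tens_sum V W ys"
  by (simp add: tens_sum_def)

lemma tens_sum_simps:
  "tens_sum V W [] = 0" "tens_sum V W ((a, b) # xs) = tens V W a b + tens_sum V W xs"
  by (simp_all add: tens_sum_def)

lemma tens_sum_in_tensor:
  "set xs \<subseteq> carr V \<times> carr W \<Longrightarrow> tens_sum V W xs \<in> carr (tensor V W)"
proof (induction xs)
  case Nil
  show ?case by (simp only: tens_sum_simps tensor_def space_data.simps fsc.span_zero)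
next
  case (Cons z zs)
  obtain a b where z: "z = (a, b)" by fastforce
  have "tens V W a b \<in> carr (tensor V W)" using Cons z by (simp add: tens_in_tensor)
  moreover have "tens_sum V W zs \<in> carr (tensor V W)" using Cons by simp
  ultimately show ?case
    by (simp only: z tens_sum_simps tensor_def space_data.simps fsc.span_add)
qed

lemma tensor_rep:
  assumes "lin_space V" "t \<in> carr (tensor V W)"
  shows "\<exists>xs. set xs \<subseteq> carr V \<times> carr W \<and> t = tens_sum V W xs"
proof -
  interpret V: lin_space V by fact
  interpret v: vector_space "scl V" by (rule V.ambient)
  have "t \<in> module.span fscale {tens V W a b | a b. a \<in> carr V \<and> b \<in> carr W}"
    using assms(2) by (simp add: tensor_def)
  then show ?thesis
  proof (induction rule: fsc.span_induct_alt)
    case base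
    show ?case by (rule exI[of _ "[]"]) (simp add: tens_sum_def)
  next
    case (step c x y)
    obtain a b where ab: "x = tens V W a b" "a \<in> carr V" "b \<in> carr W"
      using step by auto
    obtain xs where xs: "set xs \<subseteq> carr V \<times> carr W" "y = tens_sum V W xs"
      using step by auto
    have "fscale c x = tens V W (scl V c a) b"
      using tens_bilinear[of V W] ab
      by (simp add: bilinear_on_def linear_on_def tensor_def)
    moreover have "scl V c a \<in> carr V"
      using V.subspace_carr ab by (simp add: v.subspace_scale)
    ultimately show ?case
      using ab xs by (intro exI[of _ "(scl V c a, b) # xs"]) (simp add: tens_sum_def)
  qed
qed

lemma linear_on_sum_list:
  assumes "lin_space V" "lin_space W" "linear_on V W f" "\<And>x. x \<in> set xs \<Longrightarrow> h x \<in> carr V"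
  shows "f (\<Sum>x\<leftarrow>xs. h x) = (\<Sum>x\<leftarrow>xs. f (h x)) \<and> (\<Sum>x\<leftarrow>xs. h x) \<in> carr V"
proof -
  interpret V: lin_space V by fact
  interpret W: lin_space W by fact
  interpret v: vector_space "scl V" by (rule V.ambient)
  interpret w: vector_space "scl W" by (rule W.ambient)
  have z: "0 \<in> carr V" using V.subspace_carr by (rule v.subspace_0)
  have "f (scl V 0 0) = scl W 0 (f 0)" using assms(3) z by (simp only: linear_on_def)
  then have f0: "f 0 = 0" by simp
  show ?thesis using assms(4)
    by (induction xs)
      (use assms(3) z f0 in \<open>auto simp: linear_on_def v.subspace_add[OF V.subspace_carr]\<close>)
qed

lemma tens_sum_eq_imp:
  fixes V :: "('k::field, 'a::ab_group_add, 'z) space_data_scheme"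
    and W :: "('k, 'b::ab_group_add, 'y) space_data_scheme"
    and U :: "('k, 'c::ab_group_add, 'x) space_data_scheme"
  assumes "lin_space U" "bilinear_on V W U f"
    and xs: "set xs \<subseteq> carr V \<times> carr W" and ys: "set ys \<subseteq> carr V \<times> carr W"
    and eq: "tens_sum V W xs = tens_sum V W ys"
  shows "(\<Sum>(a, b)\<leftarrow>xs. f a b) = (\<Sum>(a, b)\<leftarrow>ys. f a b)"
proof (rule ccontr)
  interpret U: lin_space U by fact
  interpret vector_space_pair "scl U" "(*) :: 'k \<Rightarrow> 'k \<Rightarrow> 'k"
    by (intro vector_space_pair.intro U.ambient vector_space_ground)
  let ?d = "(\<Sum>(a, b)\<leftarrow>xs. f a b) - (\<Sum>(a, b)\<leftarrow>ys. f a b)"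
  assume "(\<Sum>(a, b)\<leftarrow>xs. f a b) \<noteq> (\<Sum>(a, b)\<leftarrow>ys. f a b)"
  then have "vs1.independent {?d}" by simp
  then obtain g where g: "Vector_Spaces.linear (scl U) (*) g" "g ?d = 1"
    using linear_independent_extend[of "{?d}" "\<lambda>_. 1"] by auto
  interpret g: Vector_Spaces.linear "scl U" "(*)" g by (rule g(1))
  have bil: "bilinear_on V W ground (\<lambda>a b. g (f a b))"
    using assms(2) by (simp add: bilinear_on_def linear_on_def ground_def g.add g.scale)
  have ev: "tens_sum V W zs (\<lambda>a b. g (f a b)) = g (\<Sum>(a, b)\<leftarrow>zs. f a b)" for zs
    by (induction zs) (auto simp: tens_sum_def tens_def bil g.add g.zero)
  have "g (\<Sum>(a, b)\<leftarrow>xs. f a b) = g (\<Sum>(a, b)\<leftarrow>ys. f a b)"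
    unfolding ev[symmetric] eq ..
  then show False using g(2) by (simp add: g.diff)
qed

lemma tensor_lift_tens_sum:
  assumes "lin_space U" "bilinear_on V W U f" "set xs \<subseteq> carr V \<times> carr W"
  shows "tensor_lift V W f (tens_sum V W xs) = (\<Sum>(a, b)\<leftarrow>xs. f a b)"
  unfolding tensor_lift_def
proof (rule the_equality)
  show "\<exists>ys. set ys \<subseteq> carr V \<times> carr W \<and> tens_sum V W xs = tens_sum V W ys \<and>
      (\<Sum>(a, b)\<leftarrow>xs. f a b) = (\<Sum>(a, b)\<leftarrow>ys. f a b)"
    using assms(3) by blast
next
  fix y
  assume "\<exists>ys. set ys \<subseteq> carr V \<times> carr W \<and> tens_sum V W xs = tens_sum V W ys \<and>
      y = (\<Sum>(a, b)\<leftarrow>ys. f a b)"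
  then show "y = (\<Sum>(a, b)\<leftarrow>xs. f a b)"
    using tens_sum_eq_imp[OF assms(1,2,3)] by metis
qed

lemma tensor_lift_tens:
  assumes "lin_space U" "bilinear_on V W U f" "a \<in> carr V" "b \<in> carr W"
  shows "tensor_lift V W f (tens V W a b) = f a b"
  using tensor_lift_tens_sum[OF assms(1,2), of "[(a, b)]"] assms(3,4) by (simp add: tens_sum_def)

lemma tensor_lift_linear:
  fixes V :: "('k::field, 'a::ab_group_add, 'z) space_data_scheme"
    and W :: "('k, 'b::ab_group_add, 'y) space_data_scheme"
    and U :: "('k, 'c::ab_group_add, 'x) space_data_scheme"
  assumes V: "lin_space V" and U: "lin_space U" and f: "bilinear_on V W U f"
  shows "linear_on (tensor V W) U (tensor_lift V W f)"
proof -
  interpret V: lin_space V by fact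
  interpret U: lin_space U by fact
  interpret v: vector_space "scl V" by (rule V.ambient)
  interpret u: vector_space "scl U" by (rule U.ambient)
  have 1: "tensor_lift V W f x \<in> carr U" if x: "x \<in> carr (tensor V W)" for x
  proof -
    obtain xs where xs: "set xs \<subseteq> carr V \<times> carr W" "x = tens_sum V W xs"
      using tensor_rep[OF V x] by blast
    have "(\<Sum>(a, b)\<leftarrow>xs. f a b) \<in> carr U"
      using xs(1) f
      by (induction xs) (auto simp: bilinear_on_def linear_on_def
          u.subspace_0[OF U.subspace_carr] u.subspace_add[OF U.subspace_carr])
    then show ?thesis using xs by (simp add: tensor_lift_tens_sum[OF U f])
  qed
  have 2: "tensor_lift V W f (x + y) = tensor_lift V W f x + tensor_lift V W f y"
    if x: "x \<in> carr (tensor V W)" and y: "y \<in> carr (tensor V W)" for x y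
  proof -
    obtain xs where xs: "set xs \<subseteq> carr V \<times> carr W" "x = tens_sum V W xs"
      using tensor_rep[OF V x] by blast
    obtain ys where ys: "set ys \<subseteq> carr V \<times> carr W" "y = tens_sum V W ys"
      using tensor_rep[OF V y] by blast
    have "tensor_lift V W f (tens_sum V W (xs @ ys)) = (\<Sum>(a, b)\<leftarrow>xs @ ys. f a b)"
      using xs ys by (intro tensor_lift_tens_sum[OF U f]) auto
    then show ?thesis
      using xs ys by (simp add: tens_sum_append tensor_lift_tens_sum[OF U f])
  qed
  have 3: "tensor_lift V W f (scl (tensor V W) c x) = scl U c (tensor_lift V W f x)"
    if x: "x \<in> carr (tensor V W)" for c x
  proof -
    obtain xs where xs: "set xs \<subseteq> carr V \<times> carr W" "x = tens_sum V W xs"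
      using tensor_rep[OF V x] by blast
    let ?ys = "map (\<lambda>(a, b). (scl V c a, b)) xs"
    have sub: "set ?ys \<subseteq> carr V \<times> carr W"
      using xs by (auto simp: v.subspace_scale[OF V.subspace_carr])
    have "scl (tensor V W) c (tens_sum V W xs) = tens_sum V W ?ys"
      using xs(1)
    proof (induction xs)
      case Nil
      then show ?case by (simp add: tens_sum_def tensor_def fscale_def fun_eq_iff)
    next
      case (Cons z zs)
      obtain a b where z: "z = (a, b)" by fastforce
      have "fscale c (tens V W a b) = tens V W (scl V c a) b"
        using Cons.prems z tens_bilinear[of V W]
        by (auto simp: bilinear_on_def linear_on_def tensor_def)
      moreover have "fscale c (tens_sum V W zs) = tens_sum V W (map (\<lambda>(a, b). (scl V c a, b)) zs)"
        using Cons by (simp add: tensor_def)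
      ultimately show ?case
        by (simp only: z list.map prod.case tens_sum_simps tensor_def space_data.simps
            fsc.scale_right_distrib)
    qed
    moreover have "(\<Sum>(a, b)\<leftarrow>?ys. f a b) = scl U c (\<Sum>(a, b)\<leftarrow>xs. f a b)"
      using xs(1)
      by (induction xs) (use f in \<open>auto simp: bilinear_on_def linear_on_def u.scale_right_distrib\<close>)
    ultimately show ?thesis
      using xs by (simp only: tensor_lift_tens_sum[OF U f sub] tensor_lift_tens_sum[OF U f xs(1)])
  qed
  show ?thesis unfolding linear_on_def using 1 2 3 by blast
qed

lemma tensor_linear_ext:
  assumes V: "lin_space V" and U: "lin_space U"
    and f: "linear_on (tensor V W) U f" and g: "linear_on (tensor V W) U g"
    and eq: "\<And>a b. a \<in> carr V \<Longrightarrow> b \<in> carr W \<Longrightarrow> f (tens V W a b) = g (tens V W a b)"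
    and t: "t \<in> carr (tensor V W)"
  shows "f t = g t"
proof -
  obtain xs where xs: "set xs \<subseteq> carr V \<times> carr W" "t = tens_sum V W xs"
    using tensor_rep[OF V t] by blast
  have lin0: "h (tens_sum V W xs) = (\<Sum>(a, b)\<leftarrow>xs. h (tens V W a b))"
    if h: "linear_on (tensor V W) U h" for h
    using linear_on_sum_list[OF lin_space_tensor U h, of xs "\<lambda>z. tens V W (fst z) (snd z)"] xs(1)
    by (auto simp: tens_sum_def tens_in_tensor case_prod_unfold subset_iff)
  have "(\<Sum>(a, b)\<leftarrow>xs. f (tens V W a b)) = (\<Sum>(a, b)\<leftarrow>xs. g (tens V W a b))"
    using xs(1) eq by (intro arg_cong[of _ _ sum_list] map_cong) auto
  then show ?thesis using lin0[OF f] lin0[OF g] xs(2) by simp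
qed


section \<open>Algebras, bialgebras, Hopf algebras\<close>

record ('k, 'a) algebra_data = "('k, 'a) space_data" +
  mul :: "'a \<Rightarrow> 'a \<Rightarrow> 'a"
  unt :: 'a

record ('k, 'a) bialgebra_data = "('k, 'a) algebra_data" +
  comul :: "'a \<Rightarrow> ('k, 'a, 'a) tensor"
  counit :: "'a \<Rightarrow> 'k"

locale k_algebra = lin_space A
  for A :: "('k::field, 'a::ab_group_add, 'z) algebra_data_scheme" +
  assumes mul_bilinear: "bilinear_on A A A (mul A)"
    and unt_closed: "unt A \<in> carr A"
    and mul_assoc: "\<lbrakk>x \<in> carr A; y \<in> carr A; z \<in> carr A\<rbrakk> \<Longrightarrow>
      mul A (mul A x y) z = mul A x (mul A y z)"
    and unt_left: "x \<in> carr A \<Longrightarrow> mul A (unt A) x = x"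
    and unt_right: "x \<in> carr A \<Longrightarrow> mul A x (unt A) = x"

definition tensor_algebra ::
    "('k::field, 'a::ab_group_add, 'z) algebra_data_scheme \<Rightarrow>
     ('k, 'b::ab_group_add, 'y) algebra_data_scheme \<Rightarrow> ('k, ('k, 'a, 'b) tensor) algebra_data"
  where "tensor_algebra A C =
    \<lparr>carr = carr (tensor A C), scl = scl (tensor A C),
     mul = (\<lambda>s t. tensor_lift A C (\<lambda>a c. tensor_lift A C
              (\<lambda>a' c'. tens A C (mul A a a') (mul C c c')) t) s),
     unt = tens A C (unt A) (unt C)\<rparr>"

text \<open>
  Sweedler notation: \<open>sw2 H f x\<close> is \<open>f x' x''\<close> and \<open>sw3 H f x\<close> is \<open>f x' x'' x'''\<close> (summation
  understood), for \<open>f\<close> multilinear.  The latter is computed from \<open>(\<Delta> \<otimes> id) \<circ> \<Delta>\<close>.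
\<close>

definition sw2 ::
    "('k::field, 'a::ab_group_add, 'z) bialgebra_data_scheme \<Rightarrow>
     ('a \<Rightarrow> 'a \<Rightarrow> 'c::ab_group_add) \<Rightarrow> 'a \<Rightarrow> 'c"
  where "sw2 H f x = tensor_lift H H f (comul H x)"

definition sw3 ::
    "('k::field, 'a::ab_group_add, 'z) bialgebra_data_scheme \<Rightarrow>
     ('a \<Rightarrow> 'a \<Rightarrow> 'a \<Rightarrow> 'c::ab_group_add) \<Rightarrow> 'a \<Rightarrow> 'c"
  where "sw3 H f x = sw2 H (\<lambda>y z. sw2 H (\<lambda>y1 y2. f y1 y2 z) y) x"

locale bialgebra = k_algebra H
  for H :: "('k::field, 'a::ab_group_add, 'z) bialgebra_data_scheme" +
  assumes comul_linear: "linear_on H (tensor H H) (comul H)"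
    and counit_linear: "linear_on H ground (counit H)"
    and coassoc: "x \<in> carr H \<Longrightarrow>
      sw2 H (\<lambda>y z. sw2 H (\<lambda>y1 y2. tens H (tensor H H) y1 (tens H H y2 z)) y) x =
      sw2 H (\<lambda>y z. tens H (tensor H H) y (comul H z)) x"
    and counit_left: "x \<in> carr H \<Longrightarrow> sw2 H (\<lambda>y z. scl H (counit H y) z) x = x"
    and counit_right: "x \<in> carr H \<Longrightarrow> sw2 H (\<lambda>y z. scl H (counit H z) y) x = x"
    and comul_mul: "\<lbrakk>x \<in> carr H; y \<in> carr H\<rbrakk> \<Longrightarrow>
      comul H (mul H x y) = mul (tensor_algebra H H) (comul H x) (comul H y)"
    and comul_unt: "comul H (unt H) = unt (tensor_algebra H H)"
    and counit_mul: "\<lbrakk>x \<in> carr H; y \<in> carr H\<rbrakk> \<Longrightarrow>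
      counit H (mul H x y) = counit H x * counit H y"
    and counit_unt: "counit H (unt H) = 1"

locale hopf_algebra = bialgebra H
  for H :: "('k::field, 'a::ab_group_add, 'z) bialgebra_data_scheme" and S :: "'a \<Rightarrow> 'a" +
  assumes antipode_linear: "linear_on H H S"
    and antipode_left: "x \<in> carr H \<Longrightarrow>
      sw2 H (\<lambda>y z. mul H (S y) z) x = scl H (counit H x) (unt H)"
    and antipode_right: "x \<in> carr H \<Longrightarrow>
      sw2 H (\<lambda>y z. mul H y (S z)) x = scl H (counit H x) (unt H)"


section \<open>Left-left Yetter-Drinfeld module algebras\<close>

locale yd_module_algebra = X: k_algebra X
  for H :: "('k::field, 'h::ab_group_add, 'z) bialgebra_data_scheme"
    and X :: "('k, 'x::ab_group_add, 'y) algebra_data_scheme"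
    and act :: "'h \<Rightarrow> 'x \<Rightarrow> 'x"
    and coact :: "'x \<Rightarrow> ('k, 'h, 'x) tensor" +
  assumes hopf: "\<exists>T. hopf_algebra H T"
    and act_bilinear: "bilinear_on H X X act"
    and act_mul: "\<lbrakk>g \<in> carr H; h \<in> carr H; x \<in> carr X\<rbrakk> \<Longrightarrow> act (mul H g h) x = act g (act h x)"
    and act_unt: "x \<in> carr X \<Longrightarrow> act (unt H) x = x"
    and act_prod: "\<lbrakk>h \<in> carr H; x \<in> carr X; y \<in> carr X\<rbrakk> \<Longrightarrow>
      act h (mul X x y) = sw2 H (\<lambda>h1 h2. mul X (act h1 x) (act h2 y)) h"
    and act_one: "h \<in> carr H \<Longrightarrow> act h (unt X) = scl X (counit H h) (unt X)"
    and coact_linear: "linear_on X (tensor H X) coact"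
    and coact_coassoc: "x \<in> carr X \<Longrightarrow>
      tensor_lift H X (\<lambda>h y. sw2 H (\<lambda>h1 h2. tens H (tensor H X) h1 (tens H X h2 y)) h) (coact x) =
      tensor_lift H X (\<lambda>h y. tens H (tensor H X) h (coact y)) (coact x)"
    and coact_counit: "x \<in> carr X \<Longrightarrow>
      tensor_lift H X (\<lambda>h y. scl X (counit H h) y) (coact x) = x"
    and coact_prod: "\<lbrakk>x \<in> carr X; y \<in> carr X\<rbrakk> \<Longrightarrow>
      coact (mul X x y) = mul (tensor_algebra H X) (coact x) (coact y)"
    and coact_one: "coact (unt X) = unt (tensor_algebra H X)"
    and yetter_drinfeld: "\<lbrakk>h \<in> carr H; x \<in> carr X\<rbrakk> \<Longrightarrow>
      sw2 H (\<lambda>h1 h2. tensor_lift H X (\<lambda>u y. tens H X (mul H u h2) y) (coact (act h1 x))) h =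
      sw2 H (\<lambda>h1 h2. tensor_lift H X (\<lambda>u y. tens H X (mul H h1 u) (act h2 y)) (coact x)) h"


section \<open>The dual Hopf algebra\<close>

text \<open>
  Functionals on the carrier are made unique as functions by letting them vanish outside of it.
\<close>

definition extend0 :: "('k::field, 'b::ab_group_add, 'z) space_data_scheme \<Rightarrow> ('b \<Rightarrow> 'k) \<Rightarrow> 'b \<Rightarrow> 'k"
  where "extend0 V f = (\<lambda>x. if x \<in> carr V then f x else 0)"

definition linear_dual ::
    "('k::field, 'b::ab_group_add, 'z) space_data_scheme \<Rightarrow> ('k, 'b \<Rightarrow> 'k) space_data"
  where "linear_dual V =
    \<lparr>carr = {f. linear_on V ground f \<and> (\<forall>x. x \<notin> carr V \<longrightarrow> f x = 0)}, scl = fscale\<rparr>"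

text \<open>\<open>eval2 V t a b\<close> is \<open>\<langle>t, a \<otimes> b\<rangle>\<close> for \<open>t\<close> in the tensor square of a space \<open>V\<close> of functionals.\<close>

definition eval2 ::
    "('k::field, 'b::ab_group_add \<Rightarrow> 'k, 'z) space_data_scheme \<Rightarrow>
     ('k, 'b \<Rightarrow> 'k, 'b \<Rightarrow> 'k) tensor \<Rightarrow> 'b \<Rightarrow> 'b \<Rightarrow> 'k"
  where "eval2 V t a b = tensor_lift V V (\<lambda>\<alpha> \<gamma>. \<alpha> a * \<gamma> b) t"

text \<open>
  The dual Hopf algebra lives on those functionals for which \<open>\<langle>\<beta>', a\<rangle> \<langle>\<beta>'', b\<rangle> = \<langle>\<beta>, ab\<rangle>\<close> has a
  solution \<open>\<beta>' \<otimes> \<beta>''\<close> in the algebraic tensor square of the linear dual (the finite dual).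
  If \<open>B\<close> is finite-dimensional these are all linear functionals, see \<open>dual_space_finite_dim\<close>; in
  general the full linear dual carries no such coproduct.
\<close>

definition dual_space ::
    "('k::field, 'b::ab_group_add, 'z) algebra_data_scheme \<Rightarrow> ('k, 'b \<Rightarrow> 'k) space_data"
  where "dual_space B =
    \<lparr>carr = {\<beta> \<in> carr (linear_dual B).
        \<exists>t \<in> carr (tensor (linear_dual B) (linear_dual B)).
          \<forall>a\<in>carr B. \<forall>b\<in>carr B. eval2 (linear_dual B) t a b = \<beta> (mul B a b)},
     scl = fscale\<rparr>"

definition dual ::
    "('k::field, 'b::ab_group_add) bialgebra_data \<Rightarrow> ('k, 'b \<Rightarrow> 'k) bialgebra_data"
  where "dual B =
    \<lparr>carr = carr (dual_space B), scl = fscale,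
     mul = (\<lambda>\<alpha> \<beta>. extend0 B (\<lambda>b. sw2 B (\<lambda>b1 b2. \<alpha> b1 * \<beta> b2) b)),
     unt = extend0 B (counit B),
     comul = (\<lambda>\<beta>. THE t. t \<in> carr (tensor (dual_space B) (dual_space B)) \<and>
        (\<forall>a\<in>carr B. \<forall>b\<in>carr B. eval2 (dual_space B) t a b = \<beta> (mul B a b))),
     counit = (\<lambda>\<beta>. \<beta> (unt B))\<rparr>"

definition dual_antipode ::
    "('k::field, 'b::ab_group_add) bialgebra_data \<Rightarrow> ('b \<Rightarrow> 'b) \<Rightarrow> ('b \<Rightarrow> 'k) \<Rightarrow> 'b \<Rightarrow> 'k"
  where "dual_antipode B S \<beta> = extend0 B (\<lambda>b. \<beta> (S b))"

lemma lin_space_linear_dual: "lin_space (linear_dual V)"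
  by (auto simp: lin_space_def linear_dual_def vector_space_fscale fsc.subspace_def linear_on_def
      ground_def fscale_def algebra_simps)

lemma dual_space_finite_dim:
  fixes B :: "('k::field, 'b::ab_group_add, 'z) algebra_data_scheme"
  assumes "k_algebra B" and fin: "finite F" and span: "carr B = module.span (scl B) F"
  shows "carr (dual_space B) = carr (linear_dual B)"
proof -
  interpret k_algebra B by fact
  interpret v: vector_space "scl B" by (rule ambient)
  obtain E where E: "E \<subseteq> F" "v.independent E" "F \<subseteq> v.span E"
    using v.maximal_independent_subset[of F] by metis
  have finE: "finite E" using E(1) fin by (rule finite_subset)
  have carrE: "carr B = v.span E"
    using E(1,3) span by (metis v.span_mono v.span_span subset_antisym)
  have "\<beta> \<in> carr (dual_space B)" if \<beta>: "\<beta> \<in> carr (linear_dual B)" for \<beta>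
  proof -
    obtain xs where xs: "set xs = E" "distinct xs" using finite_distinct_list[OF finE] by blast
    define p where "p e = extend0 B (\<lambda>a. v.representation E a e)" for e
    define q where "q e = extend0 B (\<lambda>b. \<beta> (mul B e b))" for e
    have Ecarr: "e \<in> carr B" if "e \<in> E" for e using that carrE v.span_base by blast
    have lin: "linear_on B ground \<beta>" using \<beta> by (simp add: linear_dual_def)
    have p: "p e \<in> carr (linear_dual B)" for e
      by (auto simp: p_def linear_dual_def linear_on_def ground_def extend0_def carrE v.span_add
          v.span_scale v.representation_add[OF E(2)] v.representation_scale[OF E(2)])
    have q: "q e \<in> carr (linear_dual B)" if "e \<in> E" for e
      using mul_bilinear Ecarr[OF that] lin subspace_carr
      by (auto simp: q_def linear_dual_def linear_on_def ground_def extend0_def bilinear_on_def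
          v.subspace_add v.subspace_scale)
    let ?ys = "map (\<lambda>e. (p e, q e)) xs"
    let ?t = "tens_sum (linear_dual B) (linear_dual B) ?ys"
    have sub: "set ?ys \<subseteq> carr (linear_dual B) \<times> carr (linear_dual B)"
      using p q xs(1) by auto
    have t: "?t \<in> carr (tensor (linear_dual B) (linear_dual B))"
      using sub by (rule tens_sum_in_tensor)
    have "eval2 (linear_dual B) ?t a b = \<beta> (mul B a b)" if a: "a \<in> carr B" and b: "b \<in> carr B" for a b
    proof -
      have "bilinear_on (linear_dual B) (linear_dual B) ground (\<lambda>\<alpha> \<gamma>. \<alpha> a * \<gamma> b)"
        by (auto simp: bilinear_on_def linear_on_def ground_def linear_dual_def fscale_def
            algebra_simps)
      then have "eval2 (linear_dual B) ?t a b = (\<Sum>(\<alpha>, \<gamma>)\<leftarrow>?ys. \<alpha> a * \<gamma> b)"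
        unfolding eval2_def
        by (intro tensor_lift_tens_sum[OF lin_space_ground _ sub])
      also have "\<dots> = (\<Sum>e\<in>E. v.representation E a e * \<beta> (mul B e b))"
        using a b xs by (simp add: p_def q_def extend0_def o_def sum_list_distinct_conv_sum_set)
      also have "\<dots> = \<beta> (mul B a b)"
      proof -
        have l: "linear_on B ground (\<lambda>x. \<beta> (mul B x b))"
          using mul_bilinear lin b by (auto simp: bilinear_on_def linear_on_def)
        have "\<beta> (mul B (\<Sum>e\<in>G. scl B (c e) e) b) = (\<Sum>e\<in>G. c e * \<beta> (mul B e b)) \<and>
              (\<Sum>e\<in>G. scl B (c e) e) \<in> carr B"
          if "finite G" "G \<subseteq> E" for G c
          using that
        proof (induction G)
          case empty
          have z: "0 \<in> carr B" using subspace_carr by (rule v.subspace_0)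
          then have "\<beta> (mul B (scl B 0 0) b) = 0"
            using l by (simp only: linear_on_def ground_def) simp
          then show ?case using z by simp
        next
          case (insert e G)
          then show ?case
            using l Ecarr[of e] subspace_carr
            by (auto simp: linear_on_def ground_def v.subspace_add v.subspace_scale)
        qed
        from this[OF finE subset_refl, of "v.representation E a"] show ?thesis
          using v.sum_representation_eq[OF E(2) _ finE subset_refl, of a] a carrE by simp
      qed
      finally show ?thesis .
    qed
    then show ?thesis using \<beta> t unfolding dual_space_def by auto
  qed
  then show ?thesis by (auto simp: dual_space_def)
qed


section \<open>Regular actions, Heisenberg and Drinfeld doubles\<close>

context
  fixes B :: "('k::field, 'b::ab_group_add) bialgebra_data" and S :: "'b \<Rightarrow> 'b"
begin

text \<open>The three regular actions \<open>b \<rightharpoonup> \<beta>\<close>, \<open>\<beta> \<leftharpoonup> m\<close> and \<open>b \<leftharpoonup> \<mu>\<close>.\<close>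

definition lreg :: "'b \<Rightarrow> ('b \<Rightarrow> 'k) \<Rightarrow> 'b \<Rightarrow> 'k"
  where "lreg b \<beta> = sw2 (dual B) (\<lambda>\<beta>1 \<beta>2. fscale (\<beta>2 b) \<beta>1) \<beta>"

definition rreg :: "('b \<Rightarrow> 'k) \<Rightarrow> 'b \<Rightarrow> 'b \<Rightarrow> 'k"
  where "rreg \<beta> m = sw2 (dual B) (\<lambda>\<beta>1 \<beta>2. fscale (\<beta>1 m) \<beta>2) \<beta>"

definition coreg :: "'b \<Rightarrow> ('b \<Rightarrow> 'k) \<Rightarrow> 'b"
  where "coreg b \<mu> = sw2 B (\<lambda>b1 b2. scl B (\<mu> b1) b2) b"

definition heisenberg :: "('k, ('k, 'b \<Rightarrow> 'k, 'b) tensor) algebra_data"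
  where "heisenberg =
    \<lparr>carr = carr (tensor (dual B) B), scl = fscale,
     mul = (\<lambda>x y. tensor_lift (dual B) B (\<lambda>\<alpha> a. tensor_lift (dual B) B (\<lambda>\<beta> b.
        sw2 B (\<lambda>a1 a2. tens (dual B) B (mul (dual B) \<alpha> (lreg a1 \<beta>)) (mul B a2 b)) a) y) x),
     unt = tens (dual B) B (unt (dual B)) (unt B)\<rparr>"

definition drinfeld :: "('k, ('k, 'b \<Rightarrow> 'k, 'b) tensor) bialgebra_data"
  where "drinfeld =
    \<lparr>carr = carr (tensor (dual B) B), scl = fscale,
     mul = (\<lambda>x y. tensor_lift (dual B) B (\<lambda>\<mu> m. tensor_lift (dual B) B (\<lambda>\<nu> n.
        sw3 B (\<lambda>m1 m2 m3. tens (dual B) B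
          (mul (dual B) \<mu> (rreg (lreg m1 \<nu>) (inv_into (carr B) S m3))) (mul B m2 n)) m) y) x),
     unt = tens (dual B) B (unt (dual B)) (unt B),
     comul = tensor_lift (dual B) B (\<lambda>\<mu> m. sw2 (dual B) (\<lambda>\<mu>1 \<mu>2. sw2 B (\<lambda>m1 m2.
        tens (tensor (dual B) B) (tensor (dual B) B)
          (tens (dual B) B \<mu>2 m1) (tens (dual B) B \<mu>1 m2)) m) \<mu>),
     counit = tensor_lift (dual B) B (\<lambda>\<mu> m. counit (dual B) \<mu> * counit B m)\<rparr>"

definition dual_antipode_inv :: "('b \<Rightarrow> 'k) \<Rightarrow> 'b \<Rightarrow> 'k"
  where "dual_antipode_inv = inv_into (carr (dual B)) (dual_antipode B S)"

definition heis_act ::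
    "('k, 'b \<Rightarrow> 'k, 'b) tensor \<Rightarrow> ('k, 'b \<Rightarrow> 'k, 'b) tensor \<Rightarrow> ('k, 'b \<Rightarrow> 'k, 'b) tensor"
  where "heis_act h x =
    tensor_lift (dual B) B (\<lambda>\<mu> m. tensor_lift (dual B) B (\<lambda>\<beta> b.
      sw3 (dual B) (\<lambda>\<mu>1 \<mu>2 \<mu>3. sw3 B (\<lambda>m1 m2 m3.
        tens (dual B) B
          (mul (dual B) (mul (dual B) \<mu>3 (lreg m1 \<beta>)) (dual_antipode_inv \<mu>2))
          (coreg (mul B (mul B m2 b) (S m3)) (dual_antipode_inv \<mu>1))) m) \<mu>) x) h"

definition heis_coact ::
    "('k, 'b \<Rightarrow> 'k, 'b) tensor \<Rightarrow>
     ('k, ('k, 'b \<Rightarrow> 'k, 'b) tensor, ('k, 'b \<Rightarrow> 'k, 'b) tensor) tensor"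
  where "heis_coact =
    tensor_lift (dual B) B (\<lambda>\<beta> b. sw2 (dual B) (\<lambda>\<beta>1 \<beta>2. sw2 B (\<lambda>b1 b2.
      tens drinfeld heisenberg (tens (dual B) B \<beta>2 b1) (tens (dual B) B \<beta>1 b2)) b) \<beta>)"

end

end

theory Submission
  imports Defs
begin

text \<open>
  All identities are tested by scalars.  An element \<open>t\<close> of \<open>B\<^sup>* \<otimes> B\<close> is determined by the values
  \<open>\<langle>t, x \<otimes> f\<rangle>\<close> for \<open>x \<in> B\<close> and linear forms \<open>f\<close> on \<open>B\<close>, and on \<open>\<beta> \<otimes> b\<close> this value is
  \<open>\<beta>(x) f(b)\<close>.  Pairing with \<open>x\<close> turns the product, the coproduct and the regular actions of \<open>B\<^sup>*\<close>
  into the coproduct and the product of \<open>B\<close>; for instance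
  \<open>\<langle>(\<mu> \<otimes> m) \<triangleright> (\<beta> # b), x \<otimes> f\<rangle> =
    \<mu>(S\<inverse>(c') S\<inverse>(x''') x') \<beta>(x'' m') f(c'')\<close> with \<open>c = m'' b S(m''')\<close>.
  Every axiom becomes an equation between Sweedler sums in \<open>B\<close> alone, which holds after
  cancelling neighbouring factors such as \<open>S(y') y''\<close> or \<open>y'' S\<inverse>(y')\<close>.
  Since \<open>\<mu> \<otimes> m = (\<mu> \<otimes> 1)(\<epsilon> \<otimes> m)\<close> in the Drinfeld double, the action can be treated separately for \<open>B\<^sup>*\<close>
  and for \<open>B\<close>.
\<close>

section \<open>Linear maps on carriers\<close>

text \<open>Sweedler notation is meaningful only under multilinear expressions, and proving
  multilinearity at every rewrite would swamp the calculation. The sums \<open>swn\<close> avoid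
  this by expanding components in a fixed basis: coassociativity, exchange of sums and congruence
  then hold for every scalar function of the components. Linearity comes back where a coproduct
  meets a product, \<open>\<one>\<close> or an antipode, because these values leave the basis, and
  where a counit law ends at the element itself. Elsewhere it is replaced by the weaker demand that
  an expression read only the components it is entitled to.

  All sums are kept outside, and products, in \<open>H\<close> as well as of scalars, associate to
  the right. Coassociativity then gives one sum per element on each side of an axiom, and the two
  sides differ only by cancellable neighbours.

  The coaction and the coproduct of the Drinfeld double are the same linear map. The comodule laws
  are therefore coalgebra laws of the double, and only multiplicativity is treated afresh, for the
  Heisenberg product.\<close>

context lin_space
begin

interpretation v: vector_space "scl V" by (rule ambient)

lemma zero_closed [simp]: "0 \<in> carr V"
  using subspace_carr by (rule v.subspace_0)

lemma add_closed [simp]: "x \<in> carr V \<Longrightarrow> y \<in> carr V \<Longrightarrow> x + y \<in> carr V"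
  using subspace_carr by (rule v.subspace_add)

lemma diff_closed [simp]: "x \<in> carr V \<Longrightarrow> y \<in> carr V \<Longrightarrow> x - y \<in> carr V"
  using subspace_carr by (rule v.subspace_diff)

lemma scl_closed [simp]: "x \<in> carr V \<Longrightarrow> scl V c x \<in> carr V"
  using subspace_carr by (rule v.subspace_scale)

lemma linear_on_scl: "linear_on V V (scl V c)"
  by (auto simp: linear_on_def v.scale_right_distrib mult.commute)

text \<open>A nonzero vector is independent by itself, so some linear map sends it to
  \<open>1\<close>. Hence all linear forms together serve as a test for equality of vectors.\<close>

lemma linear_form_separates:
  assumes "x \<in> carr V" and "\<And>f. linear_on V ground f \<Longrightarrow> f x = 0"
  shows "x = 0"
proof (rule ccontr)
  interpret vector_space_pair "scl V" "(*) :: 'k \<Rightarrow> 'k \<Rightarrow> 'k"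
    by (intro vector_space_pair.intro ambient vector_space_ground)
  assume "x \<noteq> 0"
  then have "v.independent {x}" by simp
  then obtain g where g: "Vector_Spaces.linear (scl V) (*) g" "g x = 1"
    using linear_independent_extend[of "{x}" "\<lambda>_. 1"] by auto
  interpret g: Vector_Spaces.linear "scl V" "(*)" g by (rule g(1))
  have "linear_on V ground g" by (simp add: linear_on_def ground_def g.add g.scale)
  then show False using assms(2) g(2) by fastforce
qed

definition basis :: "'a set"
  where "basis = (SOME E. E \<subseteq> carr V \<and> v.independent E \<and> v.span E = carr V)"

definition crd :: "'a \<Rightarrow> 'a \<Rightarrow> 'k"
  where "crd = v.representation basis"

lemma basis: "basis \<subseteq> carr V" "v.independent basis" "v.span basis = carr V"
proof -
  obtain E where E: "E \<subseteq> carr V" "v.independent E" "carr V \<subseteq> v.span E"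
    by (rule v.maximal_independent_subset)
  have "v.span E = carr V"
    by (intro subset_antisym v.span_minimal E subspace_carr)
  then have "\<exists>E. E \<subseteq> carr V \<and> v.independent E \<and> v.span E = carr V"
    using E(1,2) by (intro exI[of _ E] conjI)
  then have *: "basis \<subseteq> carr V \<and> v.independent basis \<and> v.span basis = carr V"
    unfolding basis_def by (rule someI_ex)
  show "basis \<subseteq> carr V" "v.independent basis" "v.span basis = carr V"
    by (fact *[THEN conjunct1] *[THEN conjunct2, THEN conjunct1] *[THEN conjunct2, THEN conjunct2])+
qed

lemma basis_carr: "e \<in> basis \<Longrightarrow> e \<in> carr V"
  using basis(1) by blast

lemma crd_linear: "linear_on V ground (\<lambda>x. crd x e)"
  using basis by (auto simp: linear_on_def ground_def crd_def v.representation_add v.representation_scale)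

lemma crd_finite: "finite {e. crd x e \<noteq> 0}"
  unfolding crd_def by (rule v.finite_representation)

lemma crd_support: "{e. crd x e \<noteq> 0} \<subseteq> basis"
  unfolding crd_def using v.representation_ne_zero by blast

lemma crd_carr: "crd x e \<noteq> 0 \<Longrightarrow> e \<in> carr V"
  using crd_support basis_carr by blast

lemma crd_basis: "e \<in> basis \<Longrightarrow> crd e e' = (if e = e' then 1 else 0)"
  unfolding crd_def using basis by (auto simp: v.representation_basis)

lemma crd_sum:
  assumes "x \<in> carr V" "finite A" "{e. crd x e \<noteq> 0} \<subseteq> A"
  shows "(\<Sum>e\<in>A. scl V (crd x e) e) = x"
proof -
  have "(\<Sum>e\<in>A. scl V (crd x e) e) = (\<Sum>e | crd x e \<noteq> 0. scl V (crd x e) e)"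
    using assms(2,3) by (intro sum.mono_neutral_right) auto
  also have "\<dots> = x"
    using v.sum_nonzero_representation_eq[OF basis(2)] assms(1) basis(3) by (simp add: crd_def)
  finally show ?thesis .
qed

text \<open>Values of \<open>f\<close> off \<open>basis\<close> are ignored, so the result is linear
  for any \<open>f\<close> whatever. Replacing a function by it is what admits non-multilinear
  expressions under a coproduct.\<close>

definition linear_ext :: "('a \<Rightarrow> 'k) \<Rightarrow> 'a \<Rightarrow> 'k"
  where "linear_ext f x = (\<Sum>e | crd x e \<noteq> 0. crd x e * f e)"

lemma linear_ext_superset:
  assumes "finite A" "{e. crd x e \<noteq> 0} \<subseteq> A"
  shows "linear_ext f x = (\<Sum>e\<in>A. crd x e * f e)"
  unfolding linear_ext_def using assms by (intro sum.mono_neutral_left) auto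

lemma linear_ext_linear: "linear_on V ground (linear_ext f)"
proof -
  have "linear_ext f (x + y) = linear_ext f x + linear_ext f y"
    if "x \<in> carr V" "y \<in> carr V" for x y
  proof -
    let ?A = "{e. crd x e \<noteq> 0} \<union> {e. crd y e \<noteq> 0}"
    have add: "crd (x + y) e = crd x e + crd y e" for e
      using crd_linear that by (simp add: linear_on_def)
    show ?thesis
      by (subst (1 2 3) linear_ext_superset[of ?A])
        (auto simp: crd_finite add distrib_right sum.distrib)
  qed
  moreover have "linear_ext f (scl V c x) = c * linear_ext f x" if "x \<in> carr V" for c x
  proof -
    have "crd (scl V c x) e = c * crd x e" for e
      using crd_linear that by (simp add: linear_on_def ground_def)
    then show ?thesis
      by (subst (1 2) linear_ext_superset[of "{e. crd x e \<noteq> 0}"])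
        (auto simp: crd_finite sum_distrib_left mult.assoc)
  qed
  ultimately show ?thesis by (simp add: linear_on_def ground_def)
qed

lemma linear_ext_basis: "e \<in> basis \<Longrightarrow> linear_ext f e = f e"
  by (subst linear_ext_superset[of "{e}"]) (auto simp: crd_basis)

lemma linear_on_sum:
  assumes "lin_space U" "linear_on V U f" "finite A" "\<And>i. i \<in> A \<Longrightarrow> g i \<in> carr V"
  shows "f (\<Sum>i\<in>A. g i) = (\<Sum>i\<in>A. f (g i)) \<and> (\<Sum>i\<in>A. g i) \<in> carr V"
proof -
  interpret U: lin_space U by fact
  interpret u: vector_space "scl U" by (rule U.ambient)
  have "f (scl V 0 0) = scl U 0 (f 0)" using assms(2) by (simp only: linear_on_def zero_closed)
  then have "f 0 = 0" by simp
  from assms(3,4) this show ?thesis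
    by (induction A) (use assms(2) in \<open>auto simp: linear_on_def\<close>)
qed

lemma linear_ext_eq:
  assumes "linear_on V ground f" "x \<in> carr V"
  shows "linear_ext f x = f x"
proof -
  have "f x = f (\<Sum>e | crd x e \<noteq> 0. scl V (crd x e) e)"
    using crd_sum[OF assms(2) crd_finite] by simp
  also have "\<dots> = (\<Sum>e | crd x e \<noteq> 0. f (scl V (crd x e) e))"
    using crd_carr crd_finite
    by (intro linear_on_sum[OF lin_space_ground assms(1), THEN conjunct1]) auto
  also have "\<dots> = linear_ext f x"
    unfolding linear_ext_def using crd_carr assms(1)
    by (intro sum.cong) (auto simp: linear_on_def ground_def)
  finally show ?thesis ..
qed

end

lemma linear_on_closed: "linear_on V U f \<Longrightarrow> x \<in> carr V \<Longrightarrow> f x \<in> carr U"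
  by (simp add: linear_on_def)

lemma linear_on_cong:
  assumes "\<And>x. x \<in> carr V \<Longrightarrow> f x = g x" "lin_space V"
  shows "linear_on V U f \<longleftrightarrow> linear_on V U g"
proof -
  interpret lin_space V by fact
  show ?thesis using assms(1) by (simp add: linear_on_def)
qed

lemma linear_on_id: "linear_on V V (\<lambda>x. x)"
  by (simp add: linear_on_def)

lemma linear_on_comp:
  "linear_on V U f \<Longrightarrow> linear_on P V g \<Longrightarrow> linear_on P U (\<lambda>p. f (g p))"
  by (auto simp: linear_on_def)

lemma bilinear_onI:
  "(\<And>b. b \<in> carr W \<Longrightarrow> linear_on V U (\<lambda>a. f a b)) \<Longrightarrow> (\<And>a. a \<in> carr V \<Longrightarrow> linear_on W U (f a))
    \<Longrightarrow> bilinear_on V W U f"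
  by (simp add: bilinear_on_def)

lemma bilinear_on_left:
  "bilinear_on V W U f \<Longrightarrow> linear_on P V g \<Longrightarrow> b \<in> carr W \<Longrightarrow> linear_on P U (\<lambda>p. f (g p) b)"
  by (rule linear_on_comp[of V U "\<lambda>a. f a b"]) (simp add: bilinear_on_def)

lemma bilinear_on_right:
  "bilinear_on V W U f \<Longrightarrow> linear_on P W g \<Longrightarrow> a \<in> carr V \<Longrightarrow> linear_on P U (\<lambda>p. f a (g p))"
  by (rule linear_on_comp[of W U "f a"]) (simp add: bilinear_on_def)

lemma linear_form_mult_left: "linear_on V ground f \<Longrightarrow> linear_on V ground (\<lambda>x. c * f x)"
  by (auto simp: linear_on_def ground_def algebra_simps)

lemma linear_form_mult_right: "linear_on V ground f \<Longrightarrow> linear_on V ground (\<lambda>x. f x * c)"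
  by (auto simp: linear_on_def ground_def algebra_simps)

lemma linear_form_sum_list:
  "(\<And>i. i \<in> set xs \<Longrightarrow> linear_on V ground (f i)) \<Longrightarrow> linear_on V ground (\<lambda>x. \<Sum>i\<leftarrow>xs. f i x)"
  by (induction xs) (auto simp: linear_on_def ground_def algebra_simps)

lemma linear_on_scl_form:
  "lin_space U \<Longrightarrow> linear_on V ground f \<Longrightarrow> y \<in> carr U \<Longrightarrow> linear_on V U (\<lambda>x. scl U (f x) y)"
proof -
  assume U: "lin_space U" and f: "linear_on V ground f" and y: "y \<in> carr U"
  interpret U: lin_space U by fact
  interpret u: vector_space "scl U" by (rule U.ambient)
  show ?thesis using f y by (auto simp: linear_on_def ground_def u.scale_left_distrib)
qed

section \<open>Tensor products\<close>

lemma linear_on_tens_left: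
  "linear_on P V f \<Longrightarrow> b \<in> carr W \<Longrightarrow> linear_on P (tensor V W) (\<lambda>p. tens V W (f p) b)"
  by (rule bilinear_on_left[OF tens_bilinear])

lemma linear_on_tens_right:
  "linear_on P W f \<Longrightarrow> a \<in> carr V \<Longrightarrow> linear_on P (tensor V W) (\<lambda>p. tens V W a (f p))"
  by (rule bilinear_on_right[OF tens_bilinear])

lemma linear_on_tensor_lift_arg:
  "lin_space V \<Longrightarrow> lin_space U \<Longrightarrow> bilinear_on V W U f \<Longrightarrow> linear_on P (tensor V W) g \<Longrightarrow>
    linear_on P U (\<lambda>p. tensor_lift V W f (g p))"
  by (rule linear_on_comp[OF tensor_lift_linear])

lemma sum_list_closed:
  "lin_space U \<Longrightarrow> (\<And>x. x \<in> set xs \<Longrightarrow> f x \<in> carr U) \<Longrightarrow> (\<Sum>x\<leftarrow>xs. f x) \<in> carr U"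
  by (induction xs) (auto simp: lin_space.zero_closed lin_space.add_closed)

lemma linear_on_sum_list_param:
  assumes "lin_space U" "\<And>z. z \<in> set xs \<Longrightarrow> linear_on P U (\<lambda>p. f p z)"
  shows "linear_on P U (\<lambda>p. \<Sum>z\<leftarrow>xs. f p z)"
proof -
  interpret U: lin_space U by fact
  interpret u: vector_space "scl U" by (rule U.ambient)
  show ?thesis using assms(2)
    by (induction xs) (auto simp: linear_on_def algebra_simps u.scale_right_distrib)
qed

text \<open>One list representing \<open>t\<close> serves for all \<open>p\<close>, so the lift is a
  fixed finite sum of functions that are linear in the parameter.\<close>

lemma linear_on_tensor_lift_param:
  assumes "lin_space P" "lin_space V" "lin_space U" "t \<in> carr (tensor V W)"
    and bil: "\<And>p. p \<in> carr P \<Longrightarrow> bilinear_on V W U (f p)"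
    and lin: "\<And>a b. a \<in> carr V \<Longrightarrow> b \<in> carr W \<Longrightarrow> linear_on P U (\<lambda>p. f p a b)"
  shows "linear_on P U (\<lambda>p. tensor_lift V W (f p) t)"
proof -
  obtain xs where xs: "set xs \<subseteq> carr V \<times> carr W" "t = tens_sum V W xs"
    using tensor_rep[OF assms(2,4)] by blast
  have "linear_on P U (\<lambda>p. \<Sum>z\<leftarrow>xs. f p (fst z) (snd z))"
    using xs(1) by (intro linear_on_sum_list_param assms(3) lin) auto
  then have "linear_on P U (\<lambda>p. \<Sum>(a, b)\<leftarrow>xs. f p a b)"
    by (simp add: case_prod_unfold)
  then show ?thesis
    by (subst linear_on_cong[OF _ assms(1)])
      (simp_all add: xs(2) tensor_lift_tens_sum[OF assms(3) bil xs(1)])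
qed

lemma tensor_lift_closed:
  assumes "lin_space V" "lin_space U" "bilinear_on V W U f" "t \<in> carr (tensor V W)"
  shows "tensor_lift V W f t \<in> carr U"
  using tensor_lift_linear[OF assms(1-3)] assms(4) by (rule linear_on_closed)

lemma linear_on_tensor_lift:
  assumes "lin_space V" "lin_space U" "lin_space U'" "bilinear_on V W U f" "linear_on U U' g"
    and "t \<in> carr (tensor V W)"
  shows "g (tensor_lift V W f t) = tensor_lift V W (\<lambda>a b. g (f a b)) t"
proof -
  have bil: "bilinear_on V W U' (\<lambda>a b. g (f a b))"
    by (intro bilinear_onI linear_on_comp[OF assms(5)])
      (use assms(4) in \<open>simp_all add: bilinear_on_def\<close>)
  have lift: "linear_on (tensor V W) U (tensor_lift V W f)"
    by (intro tensor_lift_linear assms)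
  show ?thesis
  proof (rule tensor_linear_ext[OF assms(1,3) linear_on_comp[OF assms(5) lift] _ _ assms(6)])
    show "linear_on (tensor V W) U' (tensor_lift V W (\<lambda>a b. g (f a b)))"
      by (intro tensor_lift_linear assms bil)
  qed (simp add: tensor_lift_tens[OF assms(2,4)] tensor_lift_tens[OF assms(3) bil])
qed

lemma tensor_lift_cong:
  assumes "lin_space V" "lin_space U" "bilinear_on V W U f" "t \<in> carr (tensor V W)"
    and "\<And>a b. a \<in> carr V \<Longrightarrow> b \<in> carr W \<Longrightarrow> f a b = g a b" "lin_space W"
  shows "tensor_lift V W f t = tensor_lift V W g t"
proof -
  obtain xs where xs: "set xs \<subseteq> carr V \<times> carr W" "t = tens_sum V W xs"
    using tensor_rep[OF assms(1,4)] by blast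
  have g: "bilinear_on V W U g"
  proof (rule bilinear_onI)
    fix b assume "b \<in> carr W"
    then show "linear_on V U (\<lambda>a. g a b)"
      using assms(3) by (subst linear_on_cong[OF assms(5)[symmetric] assms(1)]) (auto simp: bilinear_on_def)
  next
    fix a assume "a \<in> carr V"
    then show "linear_on W U (g a)"
      using assms(3) by (subst linear_on_cong[OF assms(5)[symmetric] assms(6)]) (auto simp: bilinear_on_def)
  qed
  show ?thesis
    unfolding xs(2) tensor_lift_tens_sum[OF assms(2,3) xs(1)] tensor_lift_tens_sum[OF assms(2) g xs(1)]
    using xs(1) assms(5) by (intro arg_cong[of _ _ sum_list] map_cong) auto
qed

text \<open>The family is left open because the natural tests differ: points of \<open>H\<close> for
  functionals, linear forms for \<open>H\<close> itself. Such families multiply under tensor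
  products, which handles iterated tensor products as well.\<close>

definition separating ::
    "('k::field, 'a::ab_group_add, 'z) space_data_scheme \<Rightarrow> ('a \<Rightarrow> 'k) set \<Rightarrow> bool"
  where "separating V \<Phi> \<longleftrightarrow> (\<forall>\<phi>\<in>\<Phi>. linear_on V ground \<phi>) \<and>
    (\<forall>x\<in>carr V. (\<forall>\<phi>\<in>\<Phi>. \<phi> x = 0) \<longrightarrow> x = 0)"

definition tens_form ::
    "('k::field, 'a::ab_group_add, 'z) space_data_scheme \<Rightarrow>
     ('k, 'b::ab_group_add, 'y) space_data_scheme \<Rightarrow> ('a \<Rightarrow> 'k) \<Rightarrow> ('b \<Rightarrow> 'k) \<Rightarrow>
     ('k, 'a, 'b) tensor \<Rightarrow> 'k"
  where "tens_form V W \<phi> \<psi> = tensor_lift V W (\<lambda>a b. \<phi> a * \<psi> b)"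

lemma separating_eqI:
  assumes "lin_space V" "separating V \<Phi>" "x \<in> carr V" "y \<in> carr V" "\<And>\<phi>. \<phi> \<in> \<Phi> \<Longrightarrow> \<phi> x = \<phi> y"
  shows "x = y"
proof -
  interpret lin_space V by fact
  interpret v: vector_space "scl V" by (rule ambient)
  have "\<phi> (x - y) = 0" if \<phi>: "\<phi> \<in> \<Phi>" for \<phi>
  proof -
    have "linear_on V ground \<phi>" using assms(2) \<phi> by (simp add: separating_def)
    then have "\<phi> (x - y) + \<phi> y = \<phi> (x - y + y)"
      using assms(3,4) by (simp only: linear_on_def diff_closed)
    then show ?thesis using assms(5)[OF \<phi>] by simp
  qed
  then have "x - y = 0"
    using assms(2) diff_closed[OF assms(3,4)] unfolding separating_def by blast
  then show ?thesis by simp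
qed

lemma separating_forms: "lin_space V \<Longrightarrow> separating V {f. linear_on V ground f}"
  by (auto simp: separating_def intro: lin_space.linear_form_separates)

lemma bilinear_on_mult:
  "linear_on V ground \<phi> \<Longrightarrow> linear_on W ground \<psi> \<Longrightarrow> bilinear_on V W ground (\<lambda>a b. \<phi> a * \<psi> b)"
  by (intro bilinear_onI linear_form_mult_left linear_form_mult_right)

lemma tens_form_linear:
  "lin_space V \<Longrightarrow> linear_on V ground \<phi> \<Longrightarrow> linear_on W ground \<psi> \<Longrightarrow>
    linear_on (tensor V W) ground (tens_form V W \<phi> \<psi>)"
  unfolding tens_form_def by (intro tensor_lift_linear lin_space_ground bilinear_on_mult)

lemma tens_form_tens:
  "linear_on V ground \<phi> \<Longrightarrow> linear_on W ground \<psi> \<Longrightarrow> a \<in> carr V \<Longrightarrow> b \<in> carr W \<Longrightarrow>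
    tens_form V W \<phi> \<psi> (tens V W a b) = \<phi> a * \<psi> b"
  unfolding tens_form_def by (rule tensor_lift_tens[OF lin_space_ground bilinear_on_mult])

text \<open>Write t as a sum of a \<otimes> b. If all products \<phi> \<otimes> \<psi> vanish on t,
  then the sum of \<phi>(a) b is zero because \<open>\<Psi>\<close> separates; applying a linear
  form g on \<open>W\<close>, the sum of g(b) a is zero because \<open>\<Phi>\<close> separates.
  With g running through coordinate functionals this kills every coefficient of t with respect to a
  basis of \<open>W\<close>.\<close>

lemma separating_tensor:
  assumes V: "lin_space V" and W: "lin_space W" and \<Phi>: "separating V \<Phi>" and \<Psi>: "separating W \<Psi>"
  shows "separating (tensor V W) {tens_form V W \<phi> \<psi> | \<phi> \<psi>. \<phi> \<in> \<Phi> \<and> \<psi> \<in> \<Psi>}"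
  unfolding separating_def
proof (intro conjI ballI impI)
  fix \<chi> assume "\<chi> \<in> {tens_form V W \<phi> \<psi> | \<phi> \<psi>. \<phi> \<in> \<Phi> \<and> \<psi> \<in> \<Psi>}"
  then show "linear_on (tensor V W) ground \<chi>"
    using \<Phi> \<Psi> V by (auto simp: separating_def intro!: tens_form_linear)
next
  interpret V: lin_space V by fact
  interpret W: lin_space W by fact
  interpret v: vector_space "scl V" by (rule V.ambient)
  interpret w: vector_space "scl W" by (rule W.ambient)
  fix t assume t: "t \<in> carr (tensor V W)"
    and zero: "\<forall>\<chi>\<in>{tens_form V W \<phi> \<psi> | \<phi> \<psi>. \<phi> \<in> \<Phi> \<and> \<psi> \<in> \<Psi>}. \<chi> t = 0"
  obtain xs where xs: "set xs \<subseteq> carr V \<times> carr W" "t = tens_sum V W xs"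
    using tensor_rep[OF V t] by blast
  have 1: "(\<Sum>(a, b)\<leftarrow>xs. scl W (\<phi> a) b) = 0" if \<phi>: "\<phi> \<in> \<Phi>" for \<phi>
  proof -
    have lin: "linear_on V ground \<phi>" using \<phi> \<Phi> by (simp add: separating_def)
    have "\<psi> (\<Sum>z\<leftarrow>xs. scl W (\<phi> (fst z)) (snd z)) = 0" if \<psi>: "\<psi> \<in> \<Psi>" for \<psi>
    proof -
      have lin': "linear_on W ground \<psi>" using \<psi> \<Psi> by (simp add: separating_def)
      have "\<psi> (\<Sum>z\<leftarrow>xs. scl W (\<phi> (fst z)) (snd z)) = (\<Sum>z\<leftarrow>xs. \<psi> (scl W (\<phi> (fst z)) (snd z)))"
        using xs(1)
        by (intro linear_on_sum_list[OF W lin_space_ground lin', THEN conjunct1]) auto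
      also have "\<dots> = (\<Sum>(a, b)\<leftarrow>xs. \<phi> a * \<psi> b)"
        using xs(1) lin' by (intro arg_cong[of _ _ sum_list] map_cong)
          (auto simp: linear_on_def ground_def)
      also have "\<dots> = tens_form V W \<phi> \<psi> t"
        unfolding tens_form_def xs(2)
        by (rule tensor_lift_tens_sum[symmetric, OF lin_space_ground bilinear_on_mult[OF lin lin'] xs(1)])
      finally show ?thesis using zero \<phi> \<psi> by auto
    qed
    moreover have "(\<Sum>z\<leftarrow>xs. scl W (\<phi> (fst z)) (snd z)) \<in> carr W"
      using xs(1) by (intro sum_list_closed W) auto
    ultimately show ?thesis using \<Psi> by (simp add: separating_def case_prod_unfold)
  qed
  have 2: "(\<Sum>z\<leftarrow>xs. scl V (g (snd z)) (fst z)) = 0" if g: "linear_on W ground g" for g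
  proof -
    have "\<phi> (\<Sum>z\<leftarrow>xs. scl V (g (snd z)) (fst z)) = 0" if \<phi>: "\<phi> \<in> \<Phi>" for \<phi>
    proof -
      have lin: "linear_on V ground \<phi>" using \<phi> \<Phi> by (simp add: separating_def)
      have "\<phi> (\<Sum>z\<leftarrow>xs. scl V (g (snd z)) (fst z)) = (\<Sum>z\<leftarrow>xs. \<phi> (scl V (g (snd z)) (fst z)))"
        using xs(1)
        by (intro linear_on_sum_list[OF V lin_space_ground lin, THEN conjunct1]) auto
      also have "\<dots> = (\<Sum>z\<leftarrow>xs. g (scl W (\<phi> (fst z)) (snd z)))"
        using xs(1) lin g by (intro arg_cong[of _ _ sum_list] map_cong)
          (auto simp: linear_on_def ground_def mult.commute subset_iff)
      also have "\<dots> = g (\<Sum>z\<leftarrow>xs. scl W (\<phi> (fst z)) (snd z))"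
        using xs(1)
        by (intro linear_on_sum_list[OF W lin_space_ground g, THEN conjunct1, symmetric]) auto
      also have "\<dots> = g (scl W 0 0)" using 1[OF \<phi>] by (simp add: case_prod_unfold)
      also have "\<dots> = 0" using g by (simp only: linear_on_def W.zero_closed ground_def) simp
      finally show ?thesis .
    qed
    moreover have "(\<Sum>z\<leftarrow>xs. scl V (g (snd z)) (fst z)) \<in> carr V"
      using xs(1) by (intro sum_list_closed V) auto
    ultimately show ?thesis using \<Phi> by (simp add: separating_def)
  qed
  \<comment> \<open>Only the finitely many basis vectors occurring in right-hand entries matter;
    sorting t by them leaves coefficients in \<open>V\<close> that vanish by fact
    \<open>2\<close>.\<close>
  define A where "A = (\<Union>z\<in>set xs. {e. W.crd (snd z) e \<noteq> 0})"
  have A: "finite A" "A \<subseteq> carr W"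
    using W.crd_finite W.crd_support W.basis(1) by (fastforce simp: A_def)+
  \<comment> \<open>A tensor is a function on forms, so it is zero when it vanishes on each of them;
    on forms that are not bilinear pure tensors are zero by definition.\<close>
  have "t \<phi> = 0" for \<phi>
  proof (cases "bilinear_on V W ground \<phi>")
    case True
    have "t \<phi> = (\<Sum>z\<leftarrow>xs. \<phi> (fst z) (snd z))"
      unfolding xs(2) by (induction xs) (auto simp: tens_sum_def tens_def True)
    also have "\<dots> = (\<Sum>z\<leftarrow>xs. \<Sum>e\<in>A. \<phi> (scl V (W.crd (snd z) e) (fst z)) e)"
    proof (intro arg_cong[of _ _ sum_list] map_cong refl)
      fix z assume z: "z \<in> set xs"
      then have zc: "fst z \<in> carr V" "snd z \<in> carr W" using xs(1) by auto
      have lin: "linear_on W ground (\<phi> (fst z))" using True zc by (simp add: bilinear_on_def)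
      have "\<phi> (fst z) (snd z) = \<phi> (fst z) (\<Sum>e\<in>A. scl W (W.crd (snd z) e) e)"
        using z zc A by (subst W.crd_sum) (auto simp: A_def)
      also have "\<dots> = (\<Sum>e\<in>A. \<phi> (fst z) (scl W (W.crd (snd z) e) e))"
        using A by (intro W.linear_on_sum[OF lin_space_ground lin, THEN conjunct1]) auto
      also have "\<dots> = (\<Sum>e\<in>A. \<phi> (scl V (W.crd (snd z) e) (fst z)) e)"
        using True A zc by (intro sum.cong) (auto simp: bilinear_on_def linear_on_def ground_def subset_iff)
      finally show "\<phi> (fst z) (snd z) = (\<Sum>e\<in>A. \<phi> (scl V (W.crd (snd z) e) (fst z)) e)" .
    qed
    also have "\<dots> = (\<Sum>e\<in>A. \<Sum>z\<leftarrow>xs. \<phi> (scl V (W.crd (snd z) e) (fst z)) e)"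
      by (induction xs) (auto simp: sum.distrib)
    also have "\<dots> = (\<Sum>e\<in>A. 0)"
    proof (intro sum.cong refl)
      fix e assume "e \<in> A"
      then have lin: "linear_on V ground (\<lambda>a. \<phi> a e)"
        using A True by (auto simp: bilinear_on_def)
      have "(\<Sum>z\<leftarrow>xs. \<phi> (scl V (W.crd (snd z) e) (fst z)) e) =
          \<phi> (\<Sum>z\<leftarrow>xs. scl V (W.crd (snd z) e) (fst z)) e"
        using xs(1)
        by (intro linear_on_sum_list[OF V lin_space_ground lin, THEN conjunct1, symmetric]) auto
      also have "\<dots> = \<phi> (scl V 0 0) e"
        using 2[OF W.crd_linear, of e] by simp
      also have "\<dots> = 0" using lin by (simp only: linear_on_def V.zero_closed ground_def) simp
      finally show "(\<Sum>z\<leftarrow>xs. \<phi> (scl V (W.crd (snd z) e) (fst z)) e) = 0" .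
    qed
    finally show ?thesis by simp
  next
    case False
    then show ?thesis unfolding xs(2) by (induction xs) (auto simp: tens_sum_def tens_def)
  qed
  then show "t = 0" by (simp add: fun_eq_iff)
qed

text \<open>Tensor constructions see a structure only through its carrier and scaling. Both doubles
  share these with the bare tensor product, so tensors over the three may be identified.\<close>

lemma bilinear_on_space_cong:
  assumes "carr V = carr V'" "scl V = scl V'" "carr W = carr W'" "scl W = scl W'"
  shows "bilinear_on V W U = bilinear_on V' W' U"
  unfolding fun_eq_iff bilinear_on_def linear_on_def using assms by simp

lemma tens_space_cong:
  assumes "carr V = carr V'" "scl V = scl V'" "carr W = carr W'" "scl W = scl W'"
  shows "tens V W = tens V' W'"
  unfolding fun_eq_iff tens_def bilinear_on_space_cong[OF assms] by simp

lemma tensor_space_cong: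
  assumes "carr V = carr V'" "scl V = scl V'" "carr W = carr W'" "scl W = scl W'"
  shows "tensor V W = tensor V' W'"
  unfolding tensor_def tens_space_cong[OF assms] using assms by simp

lemma tensor_lift_space_cong:
  assumes "carr V = carr V'" "scl V = scl V'" "carr W = carr W'" "scl W = scl W'"
  shows "tensor_lift V W f t = tensor_lift V' W' f t"
  unfolding tensor_lift_def tens_sum_def tens_space_cong[OF assms] using assms by simp

section \<open>Finite linear combinations of evaluations\<close>

text \<open>Every Sweedler sum is such a functional of its summand, and this alone yields
  congruence, exchange of two sums and linearity in a parameter. The set \<open>Q\<close> records
  which tuples can occur, which supplies membership facts below a sum.\<close>

definition finite_comb :: "'p set \<Rightarrow> (('p \<Rightarrow> 'k::field) \<Rightarrow> 'k) \<Rightarrow> bool"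
  where "finite_comb Q L \<longleftrightarrow>
    (\<exists>xs. snd ` set xs \<subseteq> Q \<and> (\<forall>F. L F = (\<Sum>(c, p)\<leftarrow>xs. c * F p)))"

lemma finite_combE:
  assumes "finite_comb Q L"
  obtains xs where "snd ` set xs \<subseteq> Q" "\<And>F. L F = (\<Sum>(c, p)\<leftarrow>xs. c * F p)"
  using assms by (auto simp: finite_comb_def)

lemma finite_comb_point: "p \<in> Q \<Longrightarrow> finite_comb Q (\<lambda>F. F p)"
  unfolding finite_comb_def by (rule exI[of _ "[(1, p)]"]) simp

lemma finite_comb_map:
  "finite_comb Q L \<Longrightarrow> (\<And>p. p \<in> Q \<Longrightarrow> g p \<in> R) \<Longrightarrow> finite_comb R (\<lambda>F. L (\<lambda>p. F (g p)))"
  unfolding finite_comb_def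
  by (elim exE, rule_tac x = "map (\<lambda>(c, p). (c, g p)) xs" in exI)
    (auto simp: o_def case_prod_unfold subset_iff)

lemma sum_list_mult_prod:
  "(\<Sum>(d, p)\<leftarrow>map (\<lambda>(d, p). (c * d, p)) xs. d * F p) = (c::'k::field) * (\<Sum>(d, p)\<leftarrow>xs. d * F p)"
  by (induction xs) (auto simp: algebra_simps)

text \<open>The inner sum may depend on the outer variable, as it does when a component is split
  again; concatenating the inner lists with multiplied coefficients gives a single list.\<close>

lemma finite_comb_bind:
  assumes "finite_comb Q L" and M: "\<And>p. p \<in> Q \<Longrightarrow> finite_comb R (M p)"
  shows "finite_comb R (\<lambda>F. L (\<lambda>p. M p F))"
proof -
  obtain xs where xs: "snd ` set xs \<subseteq> Q" "\<And>F. L F = (\<Sum>(c, p)\<leftarrow>xs. c * F p)"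
    using assms(1) by (rule finite_combE) blast
  obtain ys where ys: "\<And>p. p \<in> Q \<Longrightarrow> snd ` set (ys p) \<subseteq> R"
    "\<And>p F. p \<in> Q \<Longrightarrow> M p F = (\<Sum>(c, r)\<leftarrow>ys p. c * F r)"
    using M unfolding finite_comb_def by metis
  let ?zs = "concat (map (\<lambda>(c, p). map (\<lambda>(d, r). (c * d, r)) (ys p)) xs)"
  have "snd ` set ?zs \<subseteq> R" using xs(1) ys(1) by (fastforce simp: image_iff)
  moreover have "L (\<lambda>p. M p F) = (\<Sum>(c, r)\<leftarrow>?zs. c * F r)" for F
    unfolding xs(2) using xs(1)
  proof (induction xs)
    case (Cons z zs)
    obtain c p where z: "z = (c, p)" by fastforce
    have "p \<in> Q" using Cons.prems z by auto
    then show ?case using Cons by (simp add: z ys(2) sum_list_mult_prod del: map_map)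
  qed simp
  ultimately show ?thesis unfolding finite_comb_def by blast
qed

lemma finite_comb_sum:
  assumes "finite A" "A \<subseteq> Q"
  shows "finite_comb Q (\<lambda>F. \<Sum>p\<in>A. c p * F p)"
proof -
  obtain xs where "set xs = A" "distinct xs" using finite_distinct_list[OF assms(1)] by blast
  then show ?thesis
    using assms(2) unfolding finite_comb_def
    by (intro exI[of _ "map (\<lambda>p. (c p, p)) xs"])
      (auto simp: o_def sum_list_distinct_conv_sum_set)
qed

lemma finite_comb_cong:
  assumes "finite_comb Q L" "\<And>p. p \<in> Q \<Longrightarrow> F p = G p"
  shows "L F = L G"
proof -
  obtain xs where xs: "snd ` set xs \<subseteq> Q" "\<And>F. L F = (\<Sum>(c, p)\<leftarrow>xs. c * F p)"
    using assms(1) by (rule finite_combE) blast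
  show ?thesis
    unfolding xs(2) using xs(1) assms(2) by (intro arg_cong[of _ _ sum_list] map_cong) auto
qed

lemma finite_comb_mult_left: "finite_comb Q L \<Longrightarrow> L (\<lambda>p. c * F p) = c * L F"
proof -
  have "(\<Sum>(d, p)\<leftarrow>xs. d * (c * F p)) = c * (\<Sum>(d, p)\<leftarrow>xs. d * F p)" for xs
    by (induction xs) (auto simp: algebra_simps)
  then show "finite_comb Q L \<Longrightarrow> L (\<lambda>p. c * F p) = c * L F"
    by (auto elim!: finite_combE)
qed

lemma finite_comb_mult_right: "finite_comb Q L \<Longrightarrow> L (\<lambda>p. F p * c) = L F * c"
  using finite_comb_mult_left[of Q L c F] by (simp add: mult.commute)

lemma finite_comb_swap:
  assumes "finite_comb Q L" "finite_comb R M"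
  shows "L (\<lambda>p. M (\<lambda>r. F p r)) = M (\<lambda>r. L (\<lambda>p. F p r))"
proof -
  obtain xs where xs: "\<And>F. L F = (\<Sum>(c, p)\<leftarrow>xs. c * F p)"
    using assms(1) by (rule finite_combE) blast
  obtain ys where ys: "\<And>F. M F = (\<Sum>(c, p)\<leftarrow>ys. c * F p)"
    using assms(2) by (rule finite_combE) blast
  have add: "(\<Sum>(d, r)\<leftarrow>ys. d * (f r + g r)) = (\<Sum>(d, r)\<leftarrow>ys. d * f r) + (\<Sum>(d, r)\<leftarrow>ys. d * g r)"
    for f g by (induction ys) (auto simp: algebra_simps)
  have mul: "(\<Sum>(d, r)\<leftarrow>ys. d * (c * f r)) = c * (\<Sum>(d, r)\<leftarrow>ys. d * f r)" for c f
    by (induction ys) (auto simp: algebra_simps)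
  have zero: "(\<Sum>(d, r)\<leftarrow>ys. d * 0) = (0::'b)"
    by (induction ys) auto
  show ?thesis
    unfolding xs ys by (induction xs) (auto simp: add mul zero)
qed

lemma finite_comb_linear:
  assumes "finite_comb Q L" "\<And>p. p \<in> Q \<Longrightarrow> linear_on V ground (\<lambda>v. F v p)"
  shows "linear_on V ground (\<lambda>v. L (\<lambda>p. F v p))"
proof -
  obtain xs where xs: "snd ` set xs \<subseteq> Q" "\<And>F. L F = (\<Sum>(c, p)\<leftarrow>xs. c * F p)"
    using assms(1) by (rule finite_combE) blast
  have "linear_on V ground (\<lambda>v. \<Sum>z\<leftarrow>xs. fst z * F v (snd z))"
    using xs(1) by (intro linear_form_sum_list linear_form_mult_left assms(2)) auto
  then show ?thesis by (simp add: xs(2) case_prod_unfold)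
qed

lemma (in lin_space) finite_comb_linear_ext: "finite_comb basis (\<lambda>f. linear_ext f x)"
  unfolding linear_ext_def by (intro finite_comb_sum crd_finite crd_support)

section \<open>Sweedler calculus for scalar-valued expressions\<close>

text \<open>
  The components of a coproduct are expanded in a fixed basis.  This makes coassociativity and the
  counit laws valid below an arbitrary, not necessarily multilinear, function.
\<close>

context bialgebra
begin

abbreviation times (infixr "\<cdot>" 70)
  where "x \<cdot> y \<equiv> mul H x y"

abbreviation one ("\<one>")
  where "\<one> \<equiv> unt H"

abbreviation eps ("\<epsilon>")
  where "\<epsilon> \<equiv> counit H"

lemma lin_space_H: "lin_space H"
  by (rule lin_space_axioms)

lemma mul_closed [simp]: "x \<in> carr H \<Longrightarrow> y \<in> carr H \<Longrightarrow> x \<cdot> y \<in> carr H"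
  using mul_bilinear by (simp add: bilinear_on_def linear_on_def)

lemma one_closed [simp]: "\<one> \<in> carr H"
  by (rule unt_closed)

lemma comul_closed [simp]: "x \<in> carr H \<Longrightarrow> comul H x \<in> carr (tensor H H)"
  using comul_linear by (simp add: linear_on_def)

lemmas linear_on_mul_left = bilinear_on_left[OF mul_bilinear]
lemmas linear_on_mul_right = bilinear_on_right[OF mul_bilinear]
lemmas linear_form_eps = linear_on_comp[OF counit_linear]

definition sw :: "'a \<Rightarrow> ('a \<Rightarrow> 'a \<Rightarrow> 'k) \<Rightarrow> 'k"
  where "sw x f = sw2 H (\<lambda>a b. linear_ext (\<lambda>i. linear_ext (f i) b) a) x"

lemma bilinear_ext_bilinear:
  "bilinear_on H H ground (\<lambda>a b. linear_ext (\<lambda>i. linear_ext (f i) b) a)"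
proof (rule bilinear_onI)
  show "linear_on H ground (\<lambda>b. linear_ext (\<lambda>i. linear_ext (f i) b) a)" for a
    by (rule finite_comb_linear[OF finite_comb_linear_ext]) (rule linear_ext_linear)
qed (rule linear_ext_linear)

lemma sw2_linear:
  "lin_space U \<Longrightarrow> bilinear_on H H U f \<Longrightarrow> linear_on H U (sw2 H f)"
  unfolding sw2_def by (intro linear_on_tensor_lift_arg lin_space_H comul_linear)

lemma sw_linear: "linear_on H ground (\<lambda>x. sw x f)"
  unfolding sw_def by (intro sw2_linear lin_space_ground bilinear_ext_bilinear)

text \<open>A linear function equals the extension of its own restriction to the basis, so on
  bilinear functions the basis expansion changes nothing. This is the passage from the given
  structure into the scalar calculus.\<close>

lemma sw2_eq_sw:
  assumes "bilinear_on H H ground f" "x \<in> carr H"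
  shows "sw2 H f x = sw x f"
  unfolding sw_def sw2_def
proof (rule tensor_lift_cong[OF lin_space_H lin_space_ground assms(1) comul_closed[OF assms(2)] _ lin_space_H])
  fix a b assume "a \<in> carr H" "b \<in> carr H"
  then show "f a b = linear_ext (\<lambda>i. linear_ext (f i) b) a"
    using assms(1) finite_comb_cong[OF finite_comb_linear_ext, of "\<lambda>i. linear_ext (f i) b" "\<lambda>i. f i b" a]
    by (simp add: bilinear_on_def linear_ext_eq basis_carr)
qed

lemma finite_comb_sw:
  assumes "x \<in> carr H"
  shows "finite_comb (basis \<times> basis) (\<lambda>f. sw x (\<lambda>a b. f (a, b)))"
proof -
  obtain xs where xs: "set xs \<subseteq> carr H \<times> carr H" "comul H x = tens_sum H H xs"
    using tensor_rep[OF lin_space_H comul_closed[OF assms]] by blast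
  have eq: "sw x (\<lambda>a b. f (a, b)) = (\<Sum>(c, z)\<leftarrow>map (Pair 1) xs. c *
      linear_ext (\<lambda>i. linear_ext (\<lambda>j. f (i, j)) (snd z)) (fst z))" for f
    unfolding sw_def sw2_def xs(2)
    by (subst tensor_lift_tens_sum[OF lin_space_ground bilinear_ext_bilinear xs(1)])
      (simp add: o_def case_prod_unfold)
  have "finite_comb UNIV (\<lambda>F. \<Sum>(c, z)\<leftarrow>map (Pair 1) xs. c * F z)"
    unfolding finite_comb_def by blast
  then show ?thesis
    unfolding eq
    by (rule finite_comb_bind) (rule finite_comb_bind[OF finite_comb_linear_ext]
        finite_comb_map[OF finite_comb_linear_ext] | simp)+
qed

lemma sw_cong:
  assumes "x \<in> carr H" "\<And>a b. a \<in> basis \<Longrightarrow> b \<in> basis \<Longrightarrow> f a b = g a b"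
  shows "sw x f = sw x g"
  using finite_comb_cong[OF finite_comb_sw[OF assms(1)], of "\<lambda>(a, b). f a b" "\<lambda>(a, b). g a b"] assms(2)
  by auto

text \<open>The axiom is an equation in the threefold tensor product. The trilinear extension of
  \<open>f\<close> induces a functional \<open>\<phi>\<close> there, and applying
  \<open>\<phi>\<close> to both sides gives the scalar identity; extension and \<open>f\<close>
  agree on basis triples, the only ones that the sums read.\<close>

lemma sw_coassoc:
  assumes "x \<in> carr H"
  shows "sw x (\<lambda>a b. sw a (\<lambda>c d. f c d b)) = sw x (\<lambda>c w. sw w (\<lambda>d b. f c d b))"
proof -
  let ?e = "\<lambda>c d b. linear_ext (\<lambda>i. linear_ext (\<lambda>j. linear_ext (f i j) b) d) c"
  have l1: "linear_on H ground (\<lambda>c. ?e c d b)" for b d by (rule linear_ext_linear)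
  have l2: "linear_on H ground (\<lambda>d. ?e c d b)" for b c
    by (rule finite_comb_linear[OF finite_comb_linear_ext] linear_ext_linear)+
  have l3: "linear_on H ground (\<lambda>b. ?e c d b)" for c d
    by (rule finite_comb_linear[OF finite_comb_linear_ext] linear_ext_linear)+
  have e: "?e i j k = f i j k" if "i \<in> basis" "j \<in> basis" "k \<in> basis" for i j k
    using that by (simp add: linear_ext_basis)
  let ?T = "tensor H H"
  define \<phi> where "\<phi> = tensor_lift H ?T (\<lambda>c. tensor_lift H H (\<lambda>d b. ?e c d b))"
  have bil: "bilinear_on H H ground (\<lambda>d b. ?e c d b)" for c by (intro bilinear_onI l2 l3)
  have g: "bilinear_on H ?T ground (\<lambda>c. tensor_lift H H (\<lambda>d b. ?e c d b))"
    by (rule bilinear_onI)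
      (intro linear_on_tensor_lift_param tensor_lift_linear lin_space_H lin_space_ground bil l1 | assumption)+
  have \<phi>: "linear_on (tensor H ?T) ground \<phi>"
    unfolding \<phi>_def by (intro tensor_lift_linear lin_space_H lin_space_ground g)
  have \<phi>_tens: "\<phi> (tens H ?T c t) = tensor_lift H H (\<lambda>d b. ?e c d b) t"
    if "c \<in> carr H" "t \<in> carr ?T" for c t
    unfolding \<phi>_def by (rule tensor_lift_tens[OF lin_space_ground g that])
  define \<psi> where "\<psi> y z = sw2 H (\<lambda>y1 y2. tens H ?T y1 (tens H H y2 z)) y" for y z
  have b1: "bilinear_on H H (tensor H ?T) (\<lambda>y1 y2. tens H ?T y1 (tens H H y2 z))" if "z \<in> carr H" for z
    using that by (intro bilinear_onI linear_on_tens_left linear_on_tens_right linear_on_id tens_in_tensor)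
  have b2: "bilinear_on H H (tensor H ?T) \<psi>"
    unfolding \<psi>_def
    by (rule bilinear_onI, erule sw2_linear[OF lin_space_tensor b1], unfold sw2_def)
      (intro linear_on_tensor_lift_param lin_space_H lin_space_tensor comul_closed b1
        linear_on_tens_right linear_on_id tens_in_tensor | assumption)+
  have b3: "bilinear_on H H (tensor H ?T) (\<lambda>y z. tens H ?T y (comul H z))"
    by (intro bilinear_onI linear_on_tens_left linear_on_tens_right linear_on_id comul_linear comul_closed)
  have \<phi>\<psi>: "\<phi> (\<psi> y z) = sw y (\<lambda>c d. ?e c d z)" if yz: "y \<in> carr H" "z \<in> carr H" for y z
  proof -
    have "\<phi> (\<psi> y z) = tensor_lift H H (\<lambda>y1 y2. \<phi> (tens H ?T y1 (tens H H y2 z))) (comul H y)"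
      unfolding \<psi>_def sw2_def
      by (intro linear_on_tensor_lift[OF lin_space_H lin_space_tensor lin_space_ground b1 \<phi>] yz comul_closed)
    also have "\<dots> = tensor_lift H H (\<lambda>c d. ?e c d z) (comul H y)"
      by (rule tensor_lift_cong[OF lin_space_H lin_space_ground _ comul_closed[OF yz(1)] _ lin_space_H, symmetric])
        (auto intro!: bilinear_onI l1 l2 simp: \<phi>_tens tens_in_tensor tensor_lift_tens[OF lin_space_ground bil] yz)
    also have "\<dots> = sw y (\<lambda>c d. ?e c d z)"
      by (intro sw2_eq_sw[unfolded sw2_def] bilinear_onI l1 l2 yz)
    finally show ?thesis .
  qed
  have comp: "sw x (\<lambda>y z. \<phi> (h y z)) = \<phi> (sw2 H h x)" if h: "bilinear_on H H (tensor H ?T) h" for h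
  proof -
    have "bilinear_on H H ground (\<lambda>y z. \<phi> (h y z))"
      by (intro bilinear_onI linear_on_comp[OF \<phi>]) (use h in \<open>simp_all add: bilinear_on_def\<close>)
    then have "sw x (\<lambda>y z. \<phi> (h y z)) = sw2 H (\<lambda>y z. \<phi> (h y z)) x"
      by (intro sw2_eq_sw[symmetric] assms)
    also have "\<dots> = \<phi> (sw2 H h x)"
      unfolding sw2_def
      by (intro linear_on_tensor_lift[OF lin_space_H lin_space_tensor lin_space_ground h \<phi>, symmetric]
          comul_closed assms)
    finally show ?thesis .
  qed
  have "sw x (\<lambda>a b. sw a (\<lambda>c d. f c d b)) = sw x (\<lambda>a b. sw a (\<lambda>c d. ?e c d b))"
    using assms by (intro sw_cong) (auto simp: basis_carr e)
  also have "\<dots> = sw x (\<lambda>a b. \<phi> (\<psi> a b))"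
    using assms by (intro sw_cong) (auto simp: basis_carr \<phi>\<psi>)
  also have "\<dots> = \<phi> (sw2 H (\<lambda>y z. tens H ?T y (comul H z)) x)"
    unfolding comp[OF b2] using coassoc[OF assms] by (simp add: \<psi>_def[abs_def])
  also have "\<dots> = sw x (\<lambda>y z. \<phi> (tens H ?T y (comul H z)))"
    by (rule comp[OF b3, symmetric])
  also have "\<dots> = sw x (\<lambda>c w. sw w (\<lambda>d b. ?e c d b))"
    using assms by (intro sw_cong)
      (auto simp: basis_carr \<phi>_tens intro!: sw2_eq_sw[unfolded sw2_def] bil)
  also have "\<dots> = sw x (\<lambda>c w. sw w (\<lambda>d b. f c d b))"
    using assms by (intro sw_cong) (auto simp: basis_carr e)
  finally show ?thesis .
qed

lemma sw_counit_left:
  assumes "x \<in> carr H" "linear_on H ground f"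
  shows "sw x (\<lambda>a b. \<epsilon> a * f b) = f x"
proof -
  have "sw x (\<lambda>a b. \<epsilon> a * f b) = sw2 H (\<lambda>a b. \<epsilon> a * f b) x"
    by (intro sw2_eq_sw[symmetric] bilinear_on_mult counit_linear assms)
  also have "\<dots> = sw2 H (\<lambda>a b. f (scl H (\<epsilon> a) b)) x"
    unfolding sw2_def
    by (rule tensor_lift_cong[OF lin_space_H lin_space_ground bilinear_on_mult[OF counit_linear assms(2)]
          comul_closed[OF assms(1)] _ lin_space_H])
      (use assms(2) in \<open>simp add: linear_on_def ground_def\<close>)
  also have "\<dots> = f (sw2 H (\<lambda>a b. scl H (\<epsilon> a) b) x)"
    unfolding sw2_def
    by (intro linear_on_tensor_lift[where U = H and U' = ground, symmetric] lin_space_H lin_space_ground assms comul_closed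
        bilinear_onI linear_on_scl_form counit_linear linear_on_scl)
  finally show ?thesis by (simp add: counit_left assms(1))
qed

lemma sw_counit_right:
  assumes "x \<in> carr H" "linear_on H ground f"
  shows "sw x (\<lambda>a b. \<epsilon> b * f a) = f x"
proof -
  have bil: "bilinear_on H H ground (\<lambda>a b. \<epsilon> b * f a)"
    by (intro bilinear_onI linear_form_mult_left linear_form_mult_right counit_linear assms)
  have "sw x (\<lambda>a b. \<epsilon> b * f a) = sw2 H (\<lambda>a b. \<epsilon> b * f a) x"
    by (intro sw2_eq_sw[symmetric] bil assms)
  also have "\<dots> = sw2 H (\<lambda>a b. f (scl H (\<epsilon> b) a)) x"
    unfolding sw2_def
    by (rule tensor_lift_cong[OF lin_space_H lin_space_ground bil
          comul_closed[OF assms(1)] _ lin_space_H])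
      (use assms(2) in \<open>simp add: linear_on_def ground_def\<close>)
  also have "\<dots> = f (sw2 H (\<lambda>a b. scl H (\<epsilon> b) a) x)"
    unfolding sw2_def
    by (intro linear_on_tensor_lift[where U = H and U' = ground, symmetric] lin_space_H lin_space_ground assms comul_closed
        bilinear_onI linear_on_scl_form counit_linear linear_on_scl)
  finally show ?thesis by (simp add: counit_right assms(1))
qed

text \<open>At a basis vector \<open>f\<close> agrees with its linear extension, so the counit law
  extends from linear functions to all functions.\<close>

lemma sw_counit_left_basis:
  assumes "x \<in> basis"
  shows "sw x (\<lambda>a b. \<epsilon> a * f b) = f x"
proof -
  have "sw x (\<lambda>a b. \<epsilon> a * f b) = sw x (\<lambda>a b. \<epsilon> a * linear_ext f b)"
    using assms by (intro sw_cong) (auto simp: linear_ext_basis basis_carr)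
  then show ?thesis using assms by (simp add: sw_counit_left linear_ext_linear basis_carr linear_ext_basis)
qed

lemma sw_counit_right_basis:
  assumes "x \<in> basis"
  shows "sw x (\<lambda>a b. \<epsilon> b * f a) = f x"
proof -
  have "sw x (\<lambda>a b. \<epsilon> b * f a) = sw x (\<lambda>a b. \<epsilon> b * linear_ext f a)"
    using assms by (intro sw_cong) (auto simp: linear_ext_basis basis_carr)
  then show ?thesis using assms by (simp add: sw_counit_right linear_ext_linear basis_carr linear_ext_basis)
qed

text \<open>
  In \<open>swn n x F\<close> the \<open>n + 1\<close> Sweedler components of \<open>x\<close> are \<open>p 0, \<dots>, p n\<close>; the entries of \<open>p\<close> beyond \<open>n\<close>
  repeat the last component, and \<open>F\<close> should not depend on them.
\<close>

primrec swn :: "nat \<Rightarrow> 'a \<Rightarrow> ((nat \<Rightarrow> 'a) \<Rightarrow> 'k) \<Rightarrow> 'k"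
  where "swn 0 x F = F (\<lambda>_. x)"
  | "swn (Suc n) x F = sw x (\<lambda>a b. swn n b (\<lambda>p. F (case_nat a p)))"

lemma finite_comb_swn_basis: "x \<in> basis \<Longrightarrow> finite_comb {p. \<forall>j. p j \<in> basis} (swn n x)"
proof (induction n arbitrary: x)
  case 0
  have "swn 0 x = (\<lambda>F. F (\<lambda>_. x))" by (simp add: fun_eq_iff)
  with 0 show ?case by (auto intro: finite_comb_point)
next
  case (Suc n)
  have "finite_comb {p. \<forall>j. p j \<in> basis} (\<lambda>F. swn n b (\<lambda>p. F (case_nat a p)))"
    if "a \<in> basis" "b \<in> basis" for a b
    by (rule finite_comb_map[OF Suc.IH[OF that(2)], where g = "case_nat a"])
      (use that in \<open>auto split: nat.splits\<close>)
  then have "finite_comb {p. \<forall>j. p j \<in> basis}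
      (\<lambda>F. sw x (\<lambda>a b. (\<lambda>(a, b). swn n b (\<lambda>p. F (case_nat a p))) (a, b)))"
    using Suc.prems by (intro finite_comb_bind[OF finite_comb_sw]) (auto simp: basis_carr)
  then show ?case by simp
qed

text \<open>For \<open>n = 0\<close> the only tuple is constantly \<open>x\<close>, which need not
  be a basis vector; tuples are therefore located in the carrier and not in the basis.\<close>

lemma finite_comb_swn: "x \<in> carr H \<Longrightarrow> finite_comb {p. \<forall>j. p j \<in> carr H} (swn n x)"
proof (cases n)
  case 0
  have "swn 0 x = (\<lambda>F. F (\<lambda>_. x))" by (simp add: fun_eq_iff)
  with 0 show "x \<in> carr H \<Longrightarrow> ?thesis" by (auto intro: finite_comb_point)
next
  case (Suc m)
  assume x: "x \<in> carr H"
  have "finite_comb {p. \<forall>j. p j \<in> carr H} (\<lambda>F. swn m b (\<lambda>p. F (case_nat a p)))"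
    if "a \<in> basis" "b \<in> basis" for a b
    by (rule finite_comb_map[OF finite_comb_swn_basis[OF that(2)], where g = "case_nat a"])
      (use that basis_carr in \<open>auto split: nat.splits\<close>)
  then have "finite_comb {p. \<forall>j. p j \<in> carr H}
      (\<lambda>F. sw x (\<lambda>a b. (\<lambda>(a, b). swn m b (\<lambda>p. F (case_nat a p))) (a, b)))"
    using x by (intro finite_comb_bind[OF finite_comb_sw]) auto
  moreover have "swn n x = (\<lambda>F. sw x (\<lambda>a b. swn m b (\<lambda>p. F (case_nat a p))))"
    by (simp add: Suc fun_eq_iff)
  ultimately show ?thesis by simp
qed

lemma swn_cong:
  assumes "x \<in> carr H" "\<And>p. (\<And>j. p j \<in> carr H) \<Longrightarrow> F p = G p"
  shows "swn n x F = swn n x G"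
  using assms by (intro finite_comb_cong[OF finite_comb_swn]) auto

lemma swn_swap:
  "x \<in> carr H \<Longrightarrow> y \<in> carr H \<Longrightarrow>
    swn n x (\<lambda>p. swn k y (\<lambda>q. F p q)) = swn k y (\<lambda>q. swn n x (\<lambda>p. F p q))"
  by (rule finite_comb_swap[OF finite_comb_swn finite_comb_swn])

lemma swn_mult_left: "x \<in> carr H \<Longrightarrow> swn n x (\<lambda>p. c * F p) = c * swn n x F"
  by (rule finite_comb_mult_left[OF finite_comb_swn])

lemma swn_mult_right: "x \<in> carr H \<Longrightarrow> swn n x (\<lambda>p. F p * c) = swn n x F * c"
  by (rule finite_comb_mult_right[OF finite_comb_swn])

lemma swn_linear_param:
  assumes "x \<in> carr H" "\<And>p. (\<And>j. p j \<in> carr H) \<Longrightarrow> linear_on V ground (\<lambda>v. F v p)"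
  shows "linear_on V ground (\<lambda>v. swn n x (\<lambda>p. F v p))"
  using assms by (intro finite_comb_linear[OF finite_comb_swn]) auto

text \<open>At least one coproduct must be taken: \<open>swn 0 x F\<close> is the value of
  \<open>F\<close> at \<open>x\<close> and inherits linearity from \<open>F\<close> alone.\<close>

lemma swn_linear: "linear_on V H g \<Longrightarrow> linear_on V ground (\<lambda>v. swn (Suc n) (g v) F)"
  by (simp add: linear_on_comp[OF sw_linear])

text \<open>The sums \<open>swn\<close> bracket to the right, so splitting a first component costs
  one use of coassociativity per new component. The condition on \<open>h\<close> hides the padding:
  beyond index \<open>K\<close> the two nestings produce different entries.\<close>

lemma swn_merge_first:
  assumes "x \<in> carr H" "\<And>b q q'. (\<And>j. j \<le> K \<Longrightarrow> q j = q' j) \<Longrightarrow> h b q = h b q'"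
  shows "sw x (\<lambda>a b. swn K a (\<lambda>q. h b q)) = swn (Suc K) x (\<lambda>r. h (r (Suc K)) r)"
  using assms
proof (induction K arbitrary: x h)
  case 0
  have "h b (\<lambda>_. a) = h b (case_nat a (\<lambda>_. b))" for a b by (rule "0.prems") simp
  then show ?case by simp
next
  case (Suc K)
  have "sw x (\<lambda>a b. swn (Suc K) a (\<lambda>q. h b q)) =
      sw x (\<lambda>c w. sw w (\<lambda>d b. swn K d (\<lambda>q. h b (case_nat c q))))"
    by (simp add: sw_coassoc[OF Suc.prems(1)])
  also have "\<dots> = sw x (\<lambda>c w. swn (Suc K) w (\<lambda>r. h (r (Suc K)) (case_nat c r)))"
  proof (intro sw_cong Suc.prems(1) Suc.IH)
    show "h b (case_nat c q) = h b (case_nat c q')" if "\<And>j. j \<le> K \<Longrightarrow> q j = q' j" for b c q q'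
      by (rule Suc.prems(2)) (use that in \<open>simp split: nat.split\<close>)
  qed (simp add: basis_carr)
  finally show ?case by simp
qed

lemma swn_merge_last:
  assumes "x \<in> carr H"
    and "\<And>r r' p p'. (\<And>j. j < M \<Longrightarrow> r j = r' j) \<Longrightarrow> (\<And>j. j \<le> N \<Longrightarrow> p j = p' j) \<Longrightarrow> g r p = g r' p'"
  shows "swn M x (\<lambda>r. swn N (r M) (\<lambda>p. g r p)) = swn (M + N) x (\<lambda>s. g s (\<lambda>j. s (M + j)))"
  using assms
proof (induction M arbitrary: x g)
  case 0
  have "g (\<lambda>_. x) = (\<lambda>p. g p p)" by (intro ext "0.prems") simp_all
  then show ?case by simp
next
  case (Suc M)
  have "sw x (\<lambda>a b. swn M b (\<lambda>r. swn N (r M) (\<lambda>p. g (case_nat a r) p))) =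
      sw x (\<lambda>a b. swn (M + N) b (\<lambda>s. g (case_nat a s) (\<lambda>j. s (M + j))))"
  proof (intro sw_cong Suc.prems(1) Suc.IH)
    show "g (case_nat a r) p = g (case_nat a r') p'"
      if "\<And>j. j < M \<Longrightarrow> r j = r' j" "\<And>j. j \<le> N \<Longrightarrow> p j = p' j" for a r r' p p'
      by (rule Suc.prems(2)) (use that in \<open>simp_all split: nat.split\<close>)
  qed (simp add: basis_carr)
  then show ?case by simp
qed

text \<open>Peeling off leading components reduces to \<open>i = 0\<close>. There the sum over the
  tail is exchanged with the sum over the split component, and the nested result is rebracketed,
  first at its front and then at its end.\<close>

lemma swn_merge:
  assumes "x \<in> carr H" "i \<le> N"
    and "\<And>p p' q q'. \<forall>j\<le>N. j \<noteq> i \<longrightarrow> p j = p' j \<Longrightarrow> \<forall>j\<le>K. q j = q' j \<Longrightarrow> G p q = G p' q'"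
  shows "swn N x (\<lambda>p. swn K (p i) (\<lambda>q. G p q)) =
    swn (N + K) x (\<lambda>r. G (\<lambda>j. if j < i then r j else r (j + K)) (\<lambda>j. r (i + j)))"
  using assms
proof (induction N arbitrary: x i G)
  case 0
  have "G (\<lambda>_. x) = (\<lambda>q. G (\<lambda>j. q (j + K)) q)"
    by (intro ext "0.prems"(3)) (use "0.prems"(2) in simp_all)
  then show ?case using "0.prems"(2) by simp
next
  case (Suc N)
  show ?case
  proof (cases i)
    case 0
    have dep: "G (case_nat a p) q = G (case_nat a' p') q'"
      if "\<And>j. j \<le> N \<Longrightarrow> p j = p' j" "\<And>j. j \<le> K \<Longrightarrow> q j = q' j" for a a' p p' q q'
      by (rule Suc.prems(3)) (use 0 that in \<open>auto split: nat.splits\<close>)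
    have "swn (Suc N) x (\<lambda>p. swn K (p i) (\<lambda>q. G p q)) =
        sw x (\<lambda>a b. swn N b (\<lambda>p. swn K a (\<lambda>q. G (case_nat a p) q)))"
      by (simp add: 0)
    \<comment> \<open>\<open>G\<close> may not read the slot that is being split, so
      \<open>a\<close> can be replaced by \<open>undefined\<close>; the summand then depends on the
      first component only through its own coproduct.\<close>
    also have "\<dots> = sw x (\<lambda>a b. swn K a (\<lambda>q. swn N b (\<lambda>p. G (case_nat undefined p) q)))"
    proof (intro sw_cong Suc.prems)
      fix a b assume ab: "a \<in> basis" "b \<in> basis"
      have "G (case_nat a p) = G (case_nat undefined p)" for p
        by (intro ext dep) simp_all
      then show "swn N b (\<lambda>p. swn K a (\<lambda>q. G (case_nat a p) q)) =
          swn K a (\<lambda>q. swn N b (\<lambda>p. G (case_nat undefined p) q))"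
        using swn_swap[OF ab(2,1)[THEN basis_carr]] by simp
    qed
    also have "\<dots> = swn (Suc K) x (\<lambda>r. swn N (r (Suc K)) (\<lambda>p. G (case_nat undefined p) r))"
    proof (rule swn_merge_first[OF Suc.prems(1)])
      fix b and q q' :: "nat \<Rightarrow> 'a" assume q: "\<And>j. j \<le> K \<Longrightarrow> q j = q' j"
      have "(\<lambda>p. G (case_nat undefined p) q) = (\<lambda>p. G (case_nat undefined p) q')"
        by (intro ext dep) (simp_all add: q)
      then show "swn N b (\<lambda>p. G (case_nat undefined p) q) = swn N b (\<lambda>p. G (case_nat undefined p) q')"
        by simp
    qed
    also have "\<dots> = swn (Suc K + N) x (\<lambda>s. G (case_nat undefined (\<lambda>j. s (Suc K + j))) s)"
      by (rule swn_merge_last[OF Suc.prems(1)]) (rule dep, auto)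
    also have "(\<lambda>s. G (case_nat undefined (\<lambda>j. s (Suc K + j))) s) =
        (\<lambda>r. G (\<lambda>j. if j < i then r j else r (j + K)) (\<lambda>j. r (i + j)))"
      by (intro ext Suc.prems(3)) (auto simp: 0 add.commute split: nat.splits)
    finally show ?thesis by (simp add: add.commute)
  next
    case (Suc i')
    have "sw x (\<lambda>a b. swn N b (\<lambda>p. swn K (p i') (\<lambda>q. G (case_nat a p) q))) =
      sw x (\<lambda>a b. swn (N + K) b (\<lambda>r.
        G (case_nat a (\<lambda>j. if j < i' then r j else r (j + K))) (\<lambda>j. r (i' + j))))"
    proof (intro sw_cong Suc.prems(1) Suc.IH)
      show "G (case_nat a p) q = G (case_nat a p') q'"
        if "\<forall>j\<le>N. j \<noteq> i' \<longrightarrow> p j = p' j" "\<forall>j\<le>K. q j = q' j" for a p p' q q'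
        by (rule Suc.prems(3)) (use that in \<open>simp_all add: Suc split: nat.split\<close>)
    qed (use Suc.prems(2) in \<open>simp_all add: basis_carr Suc\<close>)
    also have "(\<lambda>a r. G (case_nat a (\<lambda>j. if j < i' then r j else r (j + K))) (\<lambda>j. r (i' + j))) =
        (\<lambda>a r. G (\<lambda>j. if j < i then case_nat a r j else case_nat a r (j + K))
          (\<lambda>j. case_nat a r (i + j)))"
      by (intro ext arg_cong2[of _ _ _ _ G]) (auto simp: Suc split: nat.splits)
    finally show ?thesis by (simp add: Suc)
  qed
qed

text \<open>When no coproduct is left, the right-hand side is \<open>L\<close> at \<open>x\<close>
  itself and not at a basis expansion, so \<open>N = 0\<close> asks for a basis vector, while any
  element will do for \<open>N > 0\<close>. The induction descends to basis components, which is why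
  both cases are carried along.\<close>

lemma swn_counit:
  assumes "x \<in> basis \<or> x \<in> carr H \<and> N > 0" "i \<le> Suc N"
    and "\<And>p p'. \<forall>j\<le>Suc N. j \<noteq> i \<longrightarrow> p j = p' j \<Longrightarrow> L p = L p'"
  shows "swn (Suc N) x (\<lambda>p. \<epsilon> (p i) * L p) = swn N x (\<lambda>p. L (\<lambda>j. if j < i then p j else p (j - 1)))"
  using assms
proof (induction N arbitrary: x i L)
  case 0
  have dep: "L p = L p'" if "\<And>j. j \<le> 1 \<Longrightarrow> j \<noteq> i \<Longrightarrow> p j = p' j" for p p'
    by (rule "0.prems"(3)) (use that in simp)
  show ?case
  proof (cases i)
    case i: 0
    have "(\<lambda>a b. L (case_nat a (\<lambda>_. b))) = (\<lambda>a b. L (\<lambda>_. b))"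
      by (intro ext dep) (auto simp: i split: nat.splits)
    then show ?thesis using "0.prems"(1) sw_counit_left_basis[of x "\<lambda>b. L (\<lambda>_. b)"]
      by (simp add: i fun_eq_iff)
  next
    case i: (Suc i')
    then have i': "i' = 0" using "0.prems"(2) by simp
    have "(\<lambda>a b. L (case_nat a (\<lambda>_. b))) = (\<lambda>a b. L (\<lambda>_. a))"
      by (intro ext dep) (auto simp: i i' split: nat.splits)
    then show ?thesis using "0.prems"(1) sw_counit_right_basis[of x "\<lambda>b. L (\<lambda>_. b)"]
      by (simp add: i i' fun_eq_iff)
  qed
next
  case (Suc N)
  have x: "x \<in> carr H" using Suc.prems(1) basis_carr by blast
  have dep: "L p = L p'" if "\<And>j. j \<le> Suc (Suc N) \<Longrightarrow> j \<noteq> i \<Longrightarrow> p j = p' j" for p p'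
    by (rule Suc.prems(3)) (use that in simp)
  show ?case
  proof (cases i)
    case 0
    have "(\<lambda>a p. L (case_nat a p)) = (\<lambda>a p. L (\<lambda>j. p (j - 1)))"
      by (intro ext dep) (auto simp: 0 split: nat.splits)
    then have eq: "L (case_nat a p) = L (\<lambda>j. p (j - 1))" for a p by (simp add: fun_eq_iff)
    have "swn (Suc (Suc N)) x (\<lambda>p. \<epsilon> (p i) * L p) =
        sw x (\<lambda>a b. \<epsilon> a * swn (Suc N) b (\<lambda>p. L (\<lambda>j. p (j - 1))))"
      unfolding swn.simps(2)[of "Suc N" x] using x
      by (intro sw_cong) (simp_all add: 0 basis_carr eq swn_mult_left del: swn.simps)
    also have "\<dots> = swn (Suc N) x (\<lambda>p. L (\<lambda>j. p (j - 1)))"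
      by (intro sw_counit_left x swn_linear linear_on_id)
    finally show ?thesis by (simp add: 0)
  next
    case i: (Suc i')
    have "sw x (\<lambda>a b. swn (Suc N) b (\<lambda>p. \<epsilon> (p i') * L (case_nat a p))) =
      sw x (\<lambda>a b. swn N b (\<lambda>p. L (case_nat a (\<lambda>j. if j < i' then p j else p (j - 1)))))"
    proof (intro sw_cong x Suc.IH)
      show "L (case_nat a p) = L (case_nat a p')"
        if "\<forall>j\<le>Suc N. j \<noteq> i' \<longrightarrow> p j = p' j" for a p p'
        by (rule dep) (use that in \<open>simp add: i split: nat.split\<close>)
    qed (use Suc.prems(2) in \<open>simp_all add: i\<close>)
    also have "\<dots> = sw x (\<lambda>a b. swn N b (\<lambda>p. L (\<lambda>j. if j < i then case_nat a p j else case_nat a p (j - 1))))"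
    proof -
      have "(\<lambda>a p. L (case_nat a (\<lambda>j. if j < i' then p j else p (j - 1)))) =
          (\<lambda>a p. L (\<lambda>j. if j < i then case_nat a p j else case_nat a p (j - 1)))"
        by (intro ext dep) (auto simp: i split: nat.splits)
      then show ?thesis by (simp add: fun_eq_iff)
    qed
    finally show ?thesis by (simp add: i)
  qed
qed

end

lemma tensor_algebra_simps [simp]:
  "carr (tensor_algebra A C) = carr (tensor A C)" "scl (tensor_algebra A C) = scl (tensor A C)"
  "unt (tensor_algebra A C) = tens A C (unt A) (unt C)"
  by (simp_all add: tensor_algebra_def)

text \<open>The product is a lift of a lift; a linear \<open>\<phi>\<close> commutes with both and
  meets only pure tensors, on which its value is known.\<close>

lemma tensor_algebra_mul:
  assumes A: "k_algebra A" and C: "k_algebra C" and U: "lin_space U"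
    and \<phi>: "linear_on (tensor A C) U \<phi>"
    and s: "s \<in> carr (tensor A C)" and t: "t \<in> carr (tensor A C)"
  shows "\<phi> (mul (tensor_algebra A C) s t) =
    tensor_lift A C (\<lambda>a c. tensor_lift A C (\<lambda>a' c'. \<phi> (tens A C (mul A a a') (mul C c c'))) t) s"
    and "mul (tensor_algebra A C) s t \<in> carr (tensor A C)"
proof -
  interpret A: k_algebra A by fact
  interpret C: k_algebra C by fact
  let ?h = "\<lambda>a c a' c'. tens A C (mul A a a') (mul C c c')"
  note lin = linear_on_tens_left linear_on_tens_right
    bilinear_on_left[OF A.mul_bilinear linear_on_id] bilinear_on_right[OF A.mul_bilinear linear_on_id]
    bilinear_on_left[OF C.mul_bilinear linear_on_id] bilinear_on_right[OF C.mul_bilinear linear_on_id]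
  have cl: "mul A a a' \<in> carr A" "mul C c c' \<in> carr C"
    if "a \<in> carr A" "a' \<in> carr A" "c \<in> carr C" "c' \<in> carr C" for a a' c c'
    using that A.mul_bilinear C.mul_bilinear by (auto simp: bilinear_on_def linear_on_def)
  have h: "bilinear_on A C (tensor A C) (?h a c)" if "a \<in> carr A" "c \<in> carr C" for a c
    using that by (intro bilinear_onI lin cl)
  have H: "bilinear_on A C (tensor A C) (\<lambda>a c. tensor_lift A C (?h a c) t)"
    by (rule bilinear_onI)
      (intro linear_on_tensor_lift_param A.lin_space_axioms C.lin_space_axioms lin_space_tensor t h lin cl
        | assumption)+
  have "\<phi> (mul (tensor_algebra A C) s t) =
      tensor_lift A C (\<lambda>a c. \<phi> (tensor_lift A C (?h a c) t)) s"
    by (simp add: tensor_algebra_def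
        linear_on_tensor_lift[OF A.lin_space_axioms lin_space_tensor U H \<phi> s])
  also have "\<dots> = tensor_lift A C (\<lambda>a c. tensor_lift A C (\<lambda>a' c'. \<phi> (?h a c a' c')) t) s"
  proof (rule tensor_lift_cong[OF A.lin_space_axioms U _ s _ C.lin_space_axioms])
    show "bilinear_on A C U (\<lambda>a c. \<phi> (tensor_lift A C (?h a c) t))"
      using H by (auto simp: bilinear_on_def intro!: linear_on_comp[OF \<phi>])
  qed (simp add: linear_on_tensor_lift[OF A.lin_space_axioms lin_space_tensor U h \<phi> t])
  finally show "\<phi> (mul (tensor_algebra A C) s t) =
    tensor_lift A C (\<lambda>a c. tensor_lift A C (\<lambda>a' c'. \<phi> (?h a c a' c')) t) s" .
  show "mul (tensor_algebra A C) s t \<in> carr (tensor A C)"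
    using tensor_lift_closed[OF A.lin_space_axioms lin_space_tensor H s] by (simp add: tensor_algebra_def)
qed

section \<open>Coproducts of products and of the unit, and contraction of neighbouring
  components\<close>

context bialgebra
begin

lemma k_algebra_H: "k_algebra H"
  by (rule k_algebra_axioms)

lemma linear_on_swn: "n > 0 \<Longrightarrow> linear_on V H g \<Longrightarrow> linear_on V ground (\<lambda>v. swn n (g v) F)"
  using swn_linear[of V g "n - 1" F] by simp

text \<open>Bilinearity of \<open>f\<close> enters here: the components of a product are products of
  basis vectors, which are not basis vectors, so the expansions on the two sides agree only if
  \<open>f\<close> respects linear combinations.\<close>

lemma sw_mul:
  assumes x: "x \<in> carr H" and y: "y \<in> carr H" and f: "bilinear_on H H ground f"
  shows "sw (x \<cdot> y) f = sw x (\<lambda>x1 x2. sw y (\<lambda>y1 y2. f (x1 \<cdot> y1) (x2 \<cdot> y2)))"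
proof -
  let ?f = "tensor_lift H H f"
  have lin: "linear_on (tensor H H) ground ?f"
    by (intro tensor_lift_linear lin_space_H lin_space_ground f)
  have l: "linear_on H ground (\<lambda>a. f a b)" "linear_on H ground (f b)" if "b \<in> carr H" for b
    using f that by (auto simp: bilinear_on_def)
  have b: "bilinear_on H H ground (\<lambda>y1 y2. f (x1 \<cdot> y1) (x2 \<cdot> y2))"
    if "x1 \<in> carr H" "x2 \<in> carr H" for x1 x2
    using that l by (intro bilinear_onI)
      (auto intro!: linear_on_comp[OF l(1)] linear_on_comp[OF l(2)] linear_on_mul_right linear_on_id)
  have b': "bilinear_on H H ground (\<lambda>x1 x2. tensor_lift H H (\<lambda>y1 y2. f (x1 \<cdot> y1) (x2 \<cdot> y2)) (comul H y))"
    by (rule bilinear_onI; rule linear_on_tensor_lift_param)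
      (auto intro!: linear_on_comp[OF l(1)] linear_on_comp[OF l(2)] linear_on_mul_left linear_on_id b
        simp: y lin_space_H lin_space_ground)
  have "sw (x \<cdot> y) f = ?f (mul (tensor_algebra H H) (comul H x) (comul H y))"
    using x y f by (subst sw2_eq_sw[symmetric]) (simp_all add: sw2_def comul_mul)
  also have "\<dots> = sw2 H (\<lambda>x1 x2. tensor_lift H H (\<lambda>y1 y2. ?f (tens H H (x1 \<cdot> y1) (x2 \<cdot> y2))) (comul H y)) x"
    unfolding sw2_def using x y
    by (intro tensor_algebra_mul(1)[OF k_algebra_H k_algebra_H lin_space_ground lin]) simp_all
  also have "\<dots> = sw2 H (\<lambda>x1 x2. tensor_lift H H (\<lambda>y1 y2. f (x1 \<cdot> y1) (x2 \<cdot> y2)) (comul H y)) x"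
    unfolding sw2_def using x y
    by (intro tensor_lift_cong[OF lin_space_H lin_space_ground b' _ _ lin_space_H, symmetric]
        tensor_lift_cong[OF lin_space_H lin_space_ground b _ _ lin_space_H])
      (simp_all add: tensor_lift_tens[OF lin_space_ground f])
  also have "\<dots> = sw x (\<lambda>x1 x2. tensor_lift H H (\<lambda>y1 y2. f (x1 \<cdot> y1) (x2 \<cdot> y2)) (comul H y))"
    by (intro sw2_eq_sw b' x)
  also have "\<dots> = sw x (\<lambda>x1 x2. sw y (\<lambda>y1 y2. f (x1 \<cdot> y1) (x2 \<cdot> y2)))"
    using x y by (intro sw_cong sw2_eq_sw[unfolded sw2_def] b) (auto simp: basis_carr)
  finally show ?thesis .
qed

lemma sw_one:
  assumes f: "bilinear_on H H ground f"
  shows "sw \<one> f = f \<one> \<one>"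
  using sw2_eq_sw[OF f one_closed]
  by (simp add: sw2_def comul_unt tensor_lift_tens[OF lin_space_ground f])

text \<open>Forces a sequence into the carrier and fixes those already there. Independence of unread
  components then has to be checked for carrier-valued sequences only, where the rules for products
  and antipodes apply.\<close>

definition clamp :: "(nat \<Rightarrow> 'a) \<Rightarrow> nat \<Rightarrow> 'a"
  where "clamp p j = (if p j \<in> carr H then p j else 0)"

lemma clamp_closed [simp]: "clamp p j \<in> carr H"
  by (simp add: clamp_def)

lemma clamp_id: "(\<And>j. p j \<in> carr H) \<Longrightarrow> clamp p = p"
  by (simp add: clamp_def fun_eq_iff)

text \<open>The coproduct of the \<open>i\<close>-th component is inserted in place, which shifts the later components.\<close>

lemma swn_swn:
  assumes x: "x \<in> carr H" and i: "i \<le> N"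
    and dep: "\<And>p p' q q'. (\<And>j. p j \<in> carr H) \<Longrightarrow> (\<And>j. p' j \<in> carr H) \<Longrightarrow>
      (\<And>j. q j \<in> carr H) \<Longrightarrow> (\<And>j. q' j \<in> carr H) \<Longrightarrow>
      \<forall>j\<le>N. j \<noteq> i \<longrightarrow> p j = p' j \<Longrightarrow> \<forall>j\<le>K. q j = q' j \<Longrightarrow> G p q = G p' q'"
  shows "swn N x (\<lambda>p. swn K (p i) (\<lambda>q. G p q)) =
    swn (N + K) x (\<lambda>r. G (\<lambda>j. if j < i then r j else r (j + K)) (\<lambda>j. r (i + j)))"
proof -
  let ?G = "\<lambda>p q. G (clamp p) (clamp q)"
  have "swn N x (\<lambda>p. swn K (p i) (\<lambda>q. G p q)) = swn N x (\<lambda>p. swn K (p i) (\<lambda>q. ?G p q))"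
    by (intro swn_cong x) (simp_all add: clamp_id)
  also have "\<dots> = swn (N + K) x (\<lambda>r. ?G (\<lambda>j. if j < i then r j else r (j + K)) (\<lambda>j. r (i + j)))"
    by (intro swn_merge x i dep clamp_closed) (auto simp: clamp_def)
  also have "\<dots> = swn (N + K) x (\<lambda>r. G (\<lambda>j. if j < i then r j else r (j + K)) (\<lambda>j. r (i + j)))"
    by (intro swn_cong x) (simp add: clamp_id)
  finally show ?thesis .
qed

text \<open>With one component left, the right-hand side reads \<open>L\<close> at an arbitrary
  \<open>x\<close>, whence the linearity condition for \<open>N = Suc 0\<close>.\<close>

lemma swn_eps:
  assumes x: "x \<in> carr H" and N: "0 < N" and i: "i \<le> N"
    and dep: "\<And>p p'. (\<And>j. p j \<in> carr H) \<Longrightarrow> (\<And>j. p' j \<in> carr H) \<Longrightarrow>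
      \<forall>j\<le>N. j \<noteq> i \<longrightarrow> p j = p' j \<Longrightarrow> L p = L p'"
    and lin: "N = Suc 0 \<Longrightarrow> linear_on H ground (\<lambda>v. L (\<lambda>_. v))"
  shows "swn N x (\<lambda>p. \<epsilon> (p i) * L p) = swn (N - 1) x (\<lambda>p. L (\<lambda>j. if j < i then p j else p (j - 1)))"
proof (cases "N = Suc 0")
  case True
  then consider "i = 0" | "i = 1" using i by linarith
  then have "sw x (\<lambda>a b. \<epsilon> (case_nat a (\<lambda>_. b) i) * L (case_nat a (\<lambda>_. b))) = L (\<lambda>_. x)"
  proof cases
    case 1
    have "sw x (\<lambda>a b. \<epsilon> (case_nat a (\<lambda>_. b) i) * L (case_nat a (\<lambda>_. b))) =
        sw x (\<lambda>a b. \<epsilon> a * L (\<lambda>_. b))"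
      by (intro sw_cong x arg_cong2[of _ _ _ _ "(*)"] dep)
        (auto simp: 1 True basis_carr split: nat.splits)
    then show ?thesis using sw_counit_left[OF x lin[OF True]] by simp
  next
    case 2
    have "sw x (\<lambda>a b. \<epsilon> (case_nat a (\<lambda>_. b) i) * L (case_nat a (\<lambda>_. b))) =
        sw x (\<lambda>a b. \<epsilon> b * L (\<lambda>_. a))"
      by (intro sw_cong x arg_cong2[of _ _ _ _ "(*)"] dep)
        (auto simp: 2 True basis_carr split: nat.splits)
    then show ?thesis using sw_counit_right[OF x lin[OF True]] by simp
  qed
  then show ?thesis using True by simp
next
  case False
  have "swn N x (\<lambda>p. \<epsilon> (p i) * L p) = swn (Suc (N - 1)) x (\<lambda>p. \<epsilon> (p i) * L (clamp p))"
    using N by (simp del: swn.simps) (intro swn_cong x, simp add: clamp_id)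
  also have "\<dots> = swn (N - 1) x (\<lambda>p. L (clamp (\<lambda>j. if j < i then p j else p (j - 1))))"
    using False N i x by (intro swn_counit) (auto intro!: dep simp: clamp_def)
  also have "\<dots> = swn (N - 1) x (\<lambda>p. L (\<lambda>j. if j < i then p j else p (j - 1)))"
    by (intro swn_cong x) (simp add: clamp_id)
  finally show ?thesis .
qed

text \<open>The general cancellation step. Components \<open>i\<close> and \<open>i + 1\<close> are
  regrouped as the coproduct \<open>q\<close> of a single component, \<open>cancel\<close> evaluates
  that inner sum to a counit, and the counit law deletes the component; \<open>N\<close> of the
  \<open>N + 2\<close> components survive. Entry \<open>i\<close> of \<open>p\<close> is the slot
  occupied by the pair, so neither \<open>G\<close> nor \<open>L\<close> may read it.\<close>

lemma swn_contract:
  assumes x: "x \<in> carr H" and i: "i \<le> N" "0 < N"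
    and cancel: "\<And>p z. (\<And>j. p j \<in> carr H) \<Longrightarrow> z \<in> carr H \<Longrightarrow>
      swn (Suc 0) z (\<lambda>q. G p q) = \<epsilon> z * L p"
    and depG: "\<And>p p' q q'. (\<And>j. p j \<in> carr H) \<Longrightarrow> (\<And>j. p' j \<in> carr H) \<Longrightarrow>
      (\<And>j. q j \<in> carr H) \<Longrightarrow> (\<And>j. q' j \<in> carr H) \<Longrightarrow>
      \<forall>j\<le>N. j \<noteq> i \<longrightarrow> p j = p' j \<Longrightarrow> \<forall>j\<le>Suc 0. q j = q' j \<Longrightarrow> G p q = G p' q'"
    and depL: "\<And>p p'. (\<And>j. p j \<in> carr H) \<Longrightarrow> (\<And>j. p' j \<in> carr H) \<Longrightarrow>
      \<forall>j\<le>N. j \<noteq> i \<longrightarrow> p j = p' j \<Longrightarrow> L p = L p'"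
    and lin: "N = Suc 0 \<Longrightarrow> linear_on H ground (\<lambda>v. L (\<lambda>_. v))"
  shows "swn (Suc N) x (\<lambda>r. G (\<lambda>j. if j < i then r j else r (Suc j)) (\<lambda>j. r (i + j))) =
    swn (N - 1) x (\<lambda>p. L (\<lambda>j. if j < i then p j else p (j - 1)))"
proof -
  have "swn (Suc N) x (\<lambda>r. G (\<lambda>j. if j < i then r j else r (Suc j)) (\<lambda>j. r (i + j))) =
      swn N x (\<lambda>p. swn (Suc 0) (p i) (\<lambda>q. G p q))"
  proof -
    have "swn N x (\<lambda>p. swn (Suc 0) (p i) (\<lambda>q. G p q)) = swn (N + Suc 0) x
        (\<lambda>r. G (\<lambda>j. if j < i then r j else r (j + Suc 0)) (\<lambda>j. r (i + j)))"
      by (rule swn_swn[OF x i(1)], rule depG)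
    then show ?thesis unfolding add_Suc_right add_0_right ..
  qed
  also have "\<dots> = swn N x (\<lambda>p. \<epsilon> (p i) * L p)"
    by (intro swn_cong x cancel) simp_all
  also have "\<dots> = swn (N - 1) x (\<lambda>p. L (\<lambda>j. if j < i then p j else p (j - 1)))"
    by (rule swn_eps[OF x i(2,1) depL lin])
  finally show ?thesis .
qed

lemma swn_mul:
  assumes "x \<in> carr H" "y \<in> carr H"
    and "\<And>p i. (\<And>j. p j \<in> carr H) \<Longrightarrow> i \<le> n \<Longrightarrow> linear_on H ground (\<lambda>a. F (p(i := a)))"
    and "\<And>p p'. \<forall>j\<le>n. p j = p' j \<Longrightarrow> F p = F p'"
  shows "swn n (x \<cdot> y) F = swn n x (\<lambda>p. swn n y (\<lambda>q. F (\<lambda>j. p j \<cdot> q j)))"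
  using assms
proof (induction n arbitrary: x y F)
  case 0
  show ?case by simp
next
  case (Suc n)
  have bil: "bilinear_on H H ground (\<lambda>a b. swn n b (\<lambda>p. F (case_nat a p)))"
  proof (rule bilinear_onI)
    fix b assume b: "b \<in> carr H"
    have eq: "F (case_nat a p) = F ((case_nat b p)(0 := a))" for a p
      by (rule Suc.prems(4)) (simp split: nat.split)
    show "linear_on H ground (\<lambda>a. swn n b (\<lambda>p. F (case_nat a p)))"
      unfolding eq using b by (intro swn_linear_param Suc.prems(3)) (simp_all split: nat.split)
  next
    fix a assume a: "a \<in> carr H"
    show "linear_on H ground (\<lambda>b. swn n b (\<lambda>p. F (case_nat a p)))"
    \<comment> \<open>If no coproduct remains in the tail, linearity in its argument comes from the
      hypothesis on \<open>F\<close>; otherwise it is automatic for a Sweedler sum.\<close>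
    proof (cases "n = 0")
      case True
      have eq: "F (case_nat a (\<lambda>_. b)) = F ((\<lambda>_. a)(1 := b))" for b
        by (rule Suc.prems(4)) (simp add: True split: nat.split)
      show ?thesis
        unfolding True swn.simps(1) eq by (rule Suc.prems(3)) (use a in simp_all)
    next
      case False
      then show ?thesis by (intro linear_on_swn linear_on_id) simp
    qed
  qed
  have "swn (Suc n) (x \<cdot> y) F = sw x (\<lambda>x1 x2. sw y (\<lambda>y1 y2.
      swn n (x2 \<cdot> y2) (\<lambda>p. F (case_nat (x1 \<cdot> y1) p))))"
    by (simp add: sw_mul[OF Suc.prems(1,2) bil])
  also have "\<dots> = sw x (\<lambda>x1 x2. sw y (\<lambda>y1 y2. swn n x2 (\<lambda>p. swn n y2 (\<lambda>q.
      F (case_nat (x1 \<cdot> y1) (\<lambda>j. p j \<cdot> q j))))))"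
  proof (intro sw_cong Suc.prems(1,2) Suc.IH)
    fix x1 x2 y1 y2 i and p :: "nat \<Rightarrow> 'a"
    assume c: "x1 \<in> basis" "y1 \<in> basis" "\<And>j. p j \<in> carr H" "i \<le> n"
    have eq: "F (case_nat (x1 \<cdot> y1) (p(i := a))) = F ((case_nat (x1 \<cdot> y1) p)(Suc i := a))" for a
      by (rule Suc.prems(4)) (simp split: nat.split)
    show "linear_on H ground (\<lambda>a. F (case_nat (x1 \<cdot> y1) (p(i := a))))"
      unfolding eq using c by (intro Suc.prems(3)) (auto simp: basis_carr split: nat.split)
  next
    show "F (case_nat c p) = F (case_nat c p')" if "\<forall>j\<le>n. p j = p' j" for c p p'
      by (rule Suc.prems(4)) (use that in \<open>simp split: nat.split\<close>)
  qed (simp_all add: basis_carr)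
  also have "\<dots> = sw x (\<lambda>x1 x2. swn n x2 (\<lambda>p. sw y (\<lambda>y1 y2. swn n y2 (\<lambda>q.
      F (case_nat (x1 \<cdot> y1) (\<lambda>j. p j \<cdot> q j))))))"
  proof (intro sw_cong Suc.prems(1))
    fix x1 x2 assume "x2 \<in> basis"
    then have "finite_comb {p. \<forall>j. p j \<in> carr H} (swn n x2)"
      by (intro finite_comb_swn basis_carr)
    from finite_comb_swap[OF finite_comb_sw[OF Suc.prems(2)] this,
        of "\<lambda>z p. swn n (snd z) (\<lambda>q. F (case_nat (x1 \<cdot> fst z) (\<lambda>j. p j \<cdot> q j)))"]
    show "sw y (\<lambda>y1 y2. swn n x2 (\<lambda>p. swn n y2 (\<lambda>q. F (case_nat (x1 \<cdot> y1) (\<lambda>j. p j \<cdot> q j))))) =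
      swn n x2 (\<lambda>p. sw y (\<lambda>y1 y2. swn n y2 (\<lambda>q. F (case_nat (x1 \<cdot> y1) (\<lambda>j. p j \<cdot> q j)))))"
      by simp
  qed
  also have "\<dots> = swn (Suc n) x (\<lambda>p. swn (Suc n) y (\<lambda>q. F (\<lambda>j. p j \<cdot> q j)))"
  proof -
    have "case_nat (x1 \<cdot> y1) (\<lambda>j. p j \<cdot> q j) = (\<lambda>j. case_nat x1 p j \<cdot> case_nat y1 q j)" for x1 y1 p q
      by (simp add: fun_eq_iff split: nat.split)
    then show ?thesis by simp
  qed
  finally show ?case .
qed

lemma swn_one:
  assumes "\<And>p i. (\<And>j. p j \<in> carr H) \<Longrightarrow> i \<le> n \<Longrightarrow> linear_on H ground (\<lambda>a. F (p(i := a)))"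
    and "\<And>p p'. \<forall>j\<le>n. p j = p' j \<Longrightarrow> F p = F p'"
  shows "swn n \<one> F = F (\<lambda>_. \<one>)"
  using assms
proof (induction n arbitrary: F)
  case 0
  show ?case by simp
next
  case (Suc n)
  have bil: "bilinear_on H H ground (\<lambda>a b. swn n b (\<lambda>p. F (case_nat a p)))"
  proof (rule bilinear_onI)
    fix b assume b: "b \<in> carr H"
    have eq: "F (case_nat a p) = F ((case_nat b p)(0 := a))" for a p
      by (rule Suc.prems(2)) (simp split: nat.split)
    show "linear_on H ground (\<lambda>a. swn n b (\<lambda>p. F (case_nat a p)))"
      unfolding eq using b by (intro swn_linear_param Suc.prems(1)) (simp_all split: nat.split)
  next
    fix a assume a: "a \<in> carr H"
    show "linear_on H ground (\<lambda>b. swn n b (\<lambda>p. F (case_nat a p)))"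
    proof (cases "n = 0")
      case True
      have eq: "F (case_nat a (\<lambda>_. b)) = F ((\<lambda>_. a)(1 := b))" for b
        by (rule Suc.prems(2)) (simp add: True split: nat.split)
      show ?thesis
        unfolding True swn.simps(1) eq by (rule Suc.prems(1)) (use a in simp_all)
    next
      case False
      then show ?thesis by (intro linear_on_swn linear_on_id) simp
    qed
  qed
  have "swn (Suc n) \<one> F = swn n \<one> (\<lambda>p. F (case_nat \<one> p))"
    by (simp add: sw_one[OF bil])
  also have "\<dots> = F (case_nat \<one> (\<lambda>_. \<one>))"
  proof (rule Suc.IH)
    fix i and p :: "nat \<Rightarrow> 'a"
    assume c: "\<And>j. p j \<in> carr H" "i \<le> n"
    have eq: "F (case_nat \<one> (p(i := a))) = F ((case_nat \<one> p)(Suc i := a))" for a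
      by (rule Suc.prems(2)) (simp split: nat.split)
    show "linear_on H ground (\<lambda>a. F (case_nat \<one> (p(i := a))))"
      unfolding eq using c by (intro Suc.prems(1)) (auto split: nat.split)
  next
    show "F (case_nat c p) = F (case_nat c p')" if "\<forall>j\<le>n. p j = p' j" for c p p'
      by (rule Suc.prems(2)) (use that in \<open>simp split: nat.split\<close>)
  qed
  also have "\<dots> = F (\<lambda>_. \<one>)"
    by (rule Suc.prems(2)) (simp split: nat.split)
  finally show ?case .
qed

end

section \<open>Sweedler sums as a rewriting calculus\<close>

context bialgebra
begin

declare swn.simps [simp del]

lemmas linear_simps =
  linear_on_id linear_form_mult_left linear_form_mult_right swn_linear_param linear_on_swn
  linear_on_mul_left linear_on_mul_right

declare linear_simps [simp]

lemma Suc_Suc_0 [simp]: "Suc (Suc 0) = 2"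
  by simp

lemma swn_0 [simp]: "swn 0 x F = F (\<lambda>_. x)"
  by (simp add: swn.simps)

lemma sw_eq_swn: "sw x f = swn (Suc 0) x (\<lambda>p. f (p 0) (p (Suc 0)))"
  by (simp add: swn.simps)

text \<open>Oriented so that scalars move inside and every sum moves outwards; nested sums then meet
  and can be merged.\<close>

lemma swn_mult_left' [simp]: "x \<in> carr H \<Longrightarrow> c * swn n x F = swn n x (\<lambda>p. c * F p)"
  by (simp add: swn_mult_left)

lemma swn_mult_right' [simp]: "x \<in> carr H \<Longrightarrow> swn n x F * c = swn n x (\<lambda>p. F p * c)"
  by (simp add: swn_mult_right)

text \<open>Vector-valued Sweedler expressions enter the scalar calculus through a linear form
  applied to them.\<close>

lemma swn_form:
  assumes "lin_space U" "bilinear_on H H U h" "linear_on U ground f" "x \<in> carr H"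
  shows "f (sw2 H h x) = swn (Suc 0) x (\<lambda>p. f (h (p 0) (p (Suc 0))))"
proof -
  have "bilinear_on H H ground (\<lambda>a b. f (h a b))"
    using assms(2) by (auto simp: bilinear_on_def intro!: linear_on_comp[OF assms(3)])
  then have "sw2 H (\<lambda>a b. f (h a b)) x = swn (Suc 0) x (\<lambda>p. f (h (p 0) (p (Suc 0))))"
    using assms(4) by (simp add: sw2_eq_sw sw_eq_swn)
  then show ?thesis
    using linear_on_tensor_lift[OF lin_space_H assms(1) lin_space_ground assms(2,3) comul_closed[OF assms(4)]]
    by (simp add: sw2_def)
qed

text \<open>Rewriting below a sum may use that all components lie in the carrier; without this no
  rule for products or antipodes would apply there.\<close>

lemma swn_cong' [cong]:
  assumes "n = n'" "x = x'" "x' \<in> carr H" "\<And>p. (\<And>j. p j \<in> carr H) \<Longrightarrow> F p = G p"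
  shows "swn n x F = swn n' x' G"
  unfolding assms(1,2) using assms(3,4) by (rule swn_cong)

declare swn_eps [simp]

text \<open>The two slots are listed separately, so that linearity in a slot becomes a concrete
  statement about the summand at literal indices.\<close>

lemma swn1_mul [simp]:
  assumes "x \<in> carr H" "y \<in> carr H"
    and "\<And>p. (\<And>j. p j \<in> carr H) \<Longrightarrow> linear_on H ground (\<lambda>a. F (p(0 := a)))"
    and "\<And>p. (\<And>j. p j \<in> carr H) \<Longrightarrow> linear_on H ground (\<lambda>a. F (p(Suc 0 := a)))"
    and "\<And>p p'. \<forall>j\<le>Suc 0. p j = p' j \<Longrightarrow> F p = F p'"
  shows "swn (Suc 0) (x \<cdot> y) F =
    swn (Suc 0) x (\<lambda>p. swn (Suc 0) y (\<lambda>q. F (\<lambda>j. p j \<cdot> q j)))"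
proof (rule swn_mul[OF assms(1,2) _ assms(5)])
  fix p :: "nat \<Rightarrow> 'a" and i :: nat assume "\<And>j. p j \<in> carr H" "i \<le> Suc 0"
  then show "linear_on H ground (\<lambda>a. F (p(i := a)))"
    using assms(3,4) by (auto simp: le_Suc_eq simp del: fun_upd_apply)
qed simp

lemma swn1_one:
  assumes "\<And>p. (\<And>j. p j \<in> carr H) \<Longrightarrow> linear_on H ground (\<lambda>a. F (p(0 := a)))"
    and "\<And>p. (\<And>j. p j \<in> carr H) \<Longrightarrow> linear_on H ground (\<lambda>a. F (p(Suc 0 := a)))"
    and "\<And>p p'. \<forall>j\<le>Suc 0. p j = p' j \<Longrightarrow> F p = F p'"
  shows "swn (Suc 0) \<one> F = F (\<lambda>_. \<one>)"
proof (rule swn_one[OF _ assms(3)])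
  fix p :: "nat \<Rightarrow> 'a" and i :: nat assume "\<And>j. p j \<in> carr H" "i \<le> Suc 0"
  then show "linear_on H ground (\<lambda>a. F (p(i := a)))"
    using assms(1,2) by (auto simp: le_Suc_eq simp del: fun_upd_apply)
qed simp

lemma swn2_mul [simp]:
  assumes "x \<in> carr H" "y \<in> carr H"
    and "\<And>p. (\<And>j. p j \<in> carr H) \<Longrightarrow> linear_on H ground (\<lambda>a. F (p(0 := a)))"
    and "\<And>p. (\<And>j. p j \<in> carr H) \<Longrightarrow> linear_on H ground (\<lambda>a. F (p(Suc 0 := a)))"
    and "\<And>p. (\<And>j. p j \<in> carr H) \<Longrightarrow> linear_on H ground (\<lambda>a. F (p(2 := a)))"
    and "\<And>p p'. \<forall>j\<le>2. p j = p' j \<Longrightarrow> F p = F p'"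
  shows "swn 2 (x \<cdot> y) F = swn 2 x (\<lambda>p. swn 2 y (\<lambda>q. F (\<lambda>j. p j \<cdot> q j)))"
proof (rule swn_mul[OF assms(1,2) _ assms(6)])
  fix p :: "nat \<Rightarrow> 'a" and i :: nat assume p: "\<And>j. p j \<in> carr H" and "i \<le> 2"
  then consider "i = 0" | "i = Suc 0" | "i = 2" by linarith
  then show "linear_on H ground (\<lambda>a. F (p(i := a)))"
    by cases (use assms(3-5) p in simp_all)
qed simp

end

section \<open>The antipode reverses products and coproducts\<close>

context hopf_algebra
begin

lemma S_closed [simp]: "x \<in> carr H \<Longrightarrow> S x \<in> carr H"
  using antipode_linear by (rule linear_on_closed)

lemmas linear_on_S [simp] = linear_on_comp[OF antipode_linear]

lemma antipode_left_end:
  assumes "linear_on H ground f" "z \<in> carr H"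
  shows "swn (Suc 0) z (\<lambda>q. f (S (q 0) \<cdot> q (Suc 0))) = \<epsilon> z * f \<one>"
proof -
  have "bilinear_on H H H (\<lambda>y z. S y \<cdot> z)"
    by (rule bilinear_onI) simp_all
  from swn_form[OF lin_space_H this assms] show ?thesis
    using assms by (simp add: antipode_left linear_on_def ground_def)
qed

lemma antipode_right_end:
  assumes "linear_on H ground f" "z \<in> carr H"
  shows "swn (Suc 0) z (\<lambda>q. f (q 0 \<cdot> S (q (Suc 0)))) = \<epsilon> z * f \<one>"
proof -
  have "bilinear_on H H H (\<lambda>y z. y \<cdot> S z)"
    by (rule bilinear_onI) simp_all
  from swn_form[OF lin_space_H this assms] show ?thesis
    using assms by (simp add: antipode_right linear_on_def ground_def)
qed

text \<open>In a product associated to the right, a cancelling pair stands either at the very end or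
  before a further factor \<open>w\<close>; the two shapes need separate rules. The second is the
  first for the form \<open>u \<mapsto> f (u \<cdot> w)\<close>.\<close>

lemma antipode_left_mid:
  assumes f: "linear_on H ground f" and z: "z \<in> carr H" and w: "w \<in> carr H"
  shows "swn (Suc 0) z (\<lambda>q. f (S (q 0) \<cdot> (q (Suc 0) \<cdot> w))) = \<epsilon> z * f w"
proof -
  have "linear_on H ground (\<lambda>u. f (u \<cdot> w))" using w by (intro linear_on_comp[OF f]) simp
  from antipode_left_end[OF this z] show ?thesis
    using z w by (simp add: mul_assoc unt_left)
qed

lemma antipode_right_mid:
  assumes f: "linear_on H ground f" and z: "z \<in> carr H" and w: "w \<in> carr H"
  shows "swn (Suc 0) z (\<lambda>q. f (q 0 \<cdot> (S (q (Suc 0)) \<cdot> w))) = \<epsilon> z * f w"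
proof -
  have "linear_on H ground (\<lambda>u. f (u \<cdot> w))" using w by (intro linear_on_comp[OF f]) simp
  from antipode_right_end[OF this z] show ?thesis
    using z w by (simp add: mul_assoc unt_left)
qed

text \<open>Uniqueness of convolution inverses, spelled out. In \<open>?Q\<close>, the value of
  \<open>f\<close> at S(x' y') x'' y'' S(y''') S(x'''), cancelling y'' S(y''') and then x'' S(x''')
  leaves S(x y), while cancelling S(x' y') against x'' y'' leaves S(y) S(x).\<close>

lemma S_mul:
  assumes x: "x \<in> carr H" and y: "y \<in> carr H"
  shows "S (x \<cdot> y) = S y \<cdot> S x"
proof (rule separating_eqI[OF lin_space_H separating_forms[OF lin_space_H]])
  fix f :: "'a \<Rightarrow> 'k" assume "f \<in> {f. linear_on H ground f}"
  then have f [simp]: "linear_on H ground f" by simp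
  note [simp] = linear_on_comp[OF f]
  let ?Q = "swn 2 x (\<lambda>p. swn 2 y (\<lambda>q. f (S (p 0 \<cdot> q 0) \<cdot> (p 1 \<cdot> (q 1 \<cdot> (S (q 2) \<cdot> S (p 2)))))))"
  have "?Q = swn 2 x (\<lambda>p. f (S (p 0 \<cdot> y) \<cdot> (p 1 \<cdot> S (p 2))))"
  proof (intro swn_cong x)
    fix p :: "nat \<Rightarrow> 'a" assume p [simp]: "\<And>j. p j \<in> carr H"
    \<comment> \<open>The contraction is told the position of the pair, the summand with the pair
      \<open>q\<close> separated from the kept components \<open>r\<close>, and the summand after
      cancellation. The remaining factors around the pair form the linear form to which the antipode
      axiom is applied.\<close>
    show "swn 2 y (\<lambda>q. f (S (p 0 \<cdot> q 0) \<cdot> (p 1 \<cdot> (q 1 \<cdot> (S (q 2) \<cdot> S (p 2)))))) =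
        f (S (p 0 \<cdot> y) \<cdot> (p 1 \<cdot> S (p 2)))"
      using swn_contract[of y 1 1 "\<lambda>r q. f (S (p 0 \<cdot> r 0) \<cdot> (p 1 \<cdot> (q 0 \<cdot> (S (q 1) \<cdot> S (p 2)))))"
          "\<lambda>r. f (S (p 0 \<cdot> r 0) \<cdot> (p 1 \<cdot> S (p 2)))"] y
      by (simp add: antipode_right_mid[where f = "\<lambda>u. f (S (p 0 \<cdot> _) \<cdot> (p (Suc 0) \<cdot> u))"])
  qed
  also have "\<dots> = f (S (x \<cdot> y))"
    using swn_contract[of x 1 1 "\<lambda>r q. f (S (r 0 \<cdot> y) \<cdot> (q 0 \<cdot> S (q 1)))"
        "\<lambda>r. f (S (r 0 \<cdot> y))"] x y
    by (simp add: antipode_right_end[where f = "\<lambda>u. f (S (_ \<cdot> y) \<cdot> u)"] unt_right)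
  finally have 1: "?Q = f (S (x \<cdot> y))" .
  \<comment> \<open>Regrouped so that the first two components of x and of y come from one coproduct
    each; multiplicativity of the coproduct then shows S(z') z'' for z the product of the two first
    components.\<close>
  have "?Q = swn 1 x (\<lambda>p. swn 1 (p 0) (\<lambda>p'. swn 1 y (\<lambda>q. swn 1 (q 0) (\<lambda>q'.
      f (S (p' 0 \<cdot> q' 0) \<cdot> (p' 1 \<cdot> (q' 1 \<cdot> (S (q 1) \<cdot> S (p 1)))))))))"
    using x y by (simp add: swn_swn)
  also have "\<dots> = swn 1 x (\<lambda>p. swn 1 y (\<lambda>q. swn 1 (p 0 \<cdot> q 0) (\<lambda>r.
      f (S (r 0) \<cdot> (r 1 \<cdot> (S (q 1) \<cdot> S (p 1)))))))"
    using x y by (simp add: mul_assoc swn_swap[of p y for p])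
  also have "\<dots> = swn 1 x (\<lambda>p. \<epsilon> (p 0) * swn 1 y (\<lambda>q. \<epsilon> (q 0) * f (S (q 1) \<cdot> S (p 1))))"
    using x y by (simp add: antipode_left_mid[OF f] counit_mul mult.assoc del: swn_eps)
  also have "\<dots> = f (S y \<cdot> S x)"
    using x y by simp
  finally show "f (S (x \<cdot> y)) = f (S y \<cdot> S x)" using 1 by simp
qed (use x y in simp_all)

lemma S_one: "S \<one> = \<one>"
proof -
  have "f (S \<one>) = f \<one>" if f: "linear_on H ground f" for f
    using antipode_left_end[OF f, of \<one>]
    by (simp add: swn1_one unt_right counit_unt linear_on_comp[OF f])
  then show ?thesis
    by (intro separating_eqI[OF lin_space_H separating_forms[OF lin_space_H]]) simp_all
qed

lemma counit_S: "x \<in> carr H \<Longrightarrow> \<epsilon> (S x) = \<epsilon> x"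
  using antipode_left_end[OF counit_linear, of x]
  by (simp add: counit_mul counit_unt mult.commute[of "\<epsilon> (S _)"] linear_form_eps)

text \<open>A convolution argument again. The five components of x in \<open>?Q\<close> give S(x1)'
  x2 S(x5) and S(x1)'' x3 S(x4). Cancelling x3 S(x4) and then x2 S(x5) leaves the coproduct of S(x).
  Alternatively x2 and x3 form a coproduct that multiplies the one of S(x1), and their product
  cancels, which leaves S(x'') and S(x').\<close>

lemma sw_S:
  assumes x: "x \<in> carr H" and f: "bilinear_on H H ground f"
  shows "swn 1 (S x) (\<lambda>p. f (p 0) (p 1)) = swn 1 x (\<lambda>p. f (S (p 1)) (S (p 0)))"
proof -
  note [simp] = bilinear_on_left[OF f] bilinear_on_right[OF f]
  let ?Q = "swn 4 x (\<lambda>p. swn 1 (S (p 0)) (\<lambda>s. f (s 0 \<cdot> (p 1 \<cdot> S (p 4))) (s 1 \<cdot> (p 2 \<cdot> S (p 3)))))"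
  have "?Q = swn 2 x (\<lambda>p. swn 1 (S (p 0)) (\<lambda>s. f (s 0 \<cdot> (p 1 \<cdot> S (p 2))) (s 1)))"
    using swn_contract[of x 2 3 "\<lambda>p q. swn 1 (S (p 0)) (\<lambda>s. f (s 0 \<cdot> (p 1 \<cdot> S (p 3))) (s 1 \<cdot> (q 0 \<cdot> S (q 1))))"
      "\<lambda>p. swn 1 (S (p 0)) (\<lambda>s. f (s 0 \<cdot> (p 1 \<cdot> S (p 3))) (s 1))"] x
    by (simp add: unt_right antipode_right_end[where
        f = "\<lambda>u. swn (Suc 0) (S (_ 0)) (\<lambda>s. f (s 0 \<cdot> (_ (Suc 0) \<cdot> S (_ 3))) (s (Suc 0) \<cdot> u))"])
  also have "\<dots> = swn 1 (S x) (\<lambda>p. f (p 0) (p 1))"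
    using swn_contract[of x 1 1 "\<lambda>p q. swn 1 (S (p 0)) (\<lambda>s. f (s 0 \<cdot> (q 0 \<cdot> S (q 1))) (s 1))"
      "\<lambda>p. swn 1 (S (p 0)) (\<lambda>s. f (s 0) (s 1))"] x
    by (simp add: unt_right antipode_right_end[where
        f = "\<lambda>u. swn (Suc 0) (S (_ 0)) (\<lambda>s. f (s 0 \<cdot> u) (s (Suc 0)))"])
  finally have 1: "?Q = swn 1 (S x) (\<lambda>p. f (p 0) (p 1))" .
  \<comment> \<open>The coproduct of S(z') z'' is \<epsilon>(z) times \<one> \<otimes> \<one>; here
    it is multiplied from the right by u \<otimes> v.\<close>
  have mid: "swn 1 z (\<lambda>q. swn 1 (S (q 0)) (\<lambda>s. swn 1 (q 1) (\<lambda>t. f (s 0 \<cdot> (t 0 \<cdot> u)) (s 1 \<cdot> (t 1 \<cdot> v))))) =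
      \<epsilon> z * f u v" if "z \<in> carr H" "u \<in> carr H" "v \<in> carr H" for z u v
    using antipode_left_end[of "\<lambda>w. swn 1 w (\<lambda>s. f (s 0 \<cdot> u) (s 1 \<cdot> v))" z] that
    by (simp add: mul_assoc swn1_one unt_left)
  have "?Q = swn 2 x (\<lambda>p. swn 1 (p 0) (\<lambda>q. swn 1 (S (q 0)) (\<lambda>s. swn 1 (q 1)
      (\<lambda>t. f (s 0 \<cdot> (t 0 \<cdot> S (p 2))) (s 1 \<cdot> (t 1 \<cdot> S (p 1)))))))"
    using x by (simp add: swn_swn swn_swap[of "S a" c for a c])
  also have "\<dots> = swn 1 x (\<lambda>p. f (S (p 1)) (S (p 0)))"
    using x mid by simp
  finally show ?thesis using 1 by simp
qed

end

section \<open>The inverse antipode\<close>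

locale bij_hopf_algebra = hopf_algebra H S
  for H :: "('k::field, 'a::ab_group_add) bialgebra_data" and S :: "'a \<Rightarrow> 'a" +
  assumes bij: "bij_betw S (carr H) (carr H)"
begin

abbreviation Si :: "'a \<Rightarrow> 'a"
  where "Si \<equiv> inv_into (carr H) S"

lemma Si_closed [simp]: "x \<in> carr H \<Longrightarrow> Si x \<in> carr H"
  using bij_betw_apply[OF bij_betw_inv_into[OF bij]] .

lemma S_Si [simp]: "x \<in> carr H \<Longrightarrow> S (Si x) = x"
  using bij by (rule bij_betw_inv_into_right)

lemma Si_S [simp]: "x \<in> carr H \<Longrightarrow> Si (S x) = x"
  using bij by (rule bij_betw_inv_into_left)

lemma S_inj: "S x = S y \<Longrightarrow> x \<in> carr H \<Longrightarrow> y \<in> carr H \<Longrightarrow> x = y"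
  using bij by (auto simp: bij_betw_def inj_on_def)

lemma Si_linear: "linear_on H H Si"
proof -
  have "Si (x + y) = Si x + Si y" if "x \<in> carr H" "y \<in> carr H" for x y
    by (rule S_inj) (use that antipode_linear in \<open>simp_all add: linear_on_def\<close>)
  moreover have "Si (scl H c x) = scl H c (Si x)" if "x \<in> carr H" for c x
    by (rule S_inj) (use that antipode_linear in \<open>simp_all add: linear_on_def\<close>)
  ultimately show ?thesis by (simp add: linear_on_def)
qed

lemmas linear_on_Si [simp] = linear_on_comp[OF Si_linear]

lemma Si_mul: "x \<in> carr H \<Longrightarrow> y \<in> carr H \<Longrightarrow> Si (x \<cdot> y) = Si y \<cdot> Si x"
  by (rule S_inj) (simp_all add: S_mul)

lemma Si_one: "Si \<one> = \<one>"
  using Si_S[OF one_closed] by (simp add: S_one)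

lemma counit_Si: "x \<in> carr H \<Longrightarrow> \<epsilon> (Si x) = \<epsilon> x"
  using counit_S[of "Si x"] by simp

lemma sw_Si:
  assumes x: "x \<in> carr H" and f: "bilinear_on H H ground f"
  shows "swn 1 (Si x) (\<lambda>p. f (p 0) (p 1)) = swn 1 x (\<lambda>p. f (Si (p 1)) (Si (p 0)))"
proof -
  have "bilinear_on H H ground (\<lambda>a b. f (Si b) (Si a))"
    by (intro bilinear_onI bilinear_on_left[OF f] bilinear_on_right[OF f]) simp_all
  from sw_S[OF Si_closed[OF x] this] show ?thesis using x by simp
qed

lemma swn1_S [simp]:
  assumes x: "x \<in> carr H"
    and "\<And>p. (\<And>j. p j \<in> carr H) \<Longrightarrow> linear_on H ground (\<lambda>a. F (p(0 := a)))"
    and "\<And>p. (\<And>j. p j \<in> carr H) \<Longrightarrow> linear_on H ground (\<lambda>a. F (p(Suc 0 := a)))"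
    and dep: "\<And>p p'. \<forall>j\<le>Suc 0. p j = p' j \<Longrightarrow> F p = F p'"
  shows "swn (Suc 0) (S x) F = swn (Suc 0) x (\<lambda>p. F (\<lambda>j. S (p (Suc 0 - j))))"
    and "swn (Suc 0) (Si x) F = swn (Suc 0) x (\<lambda>p. F (\<lambda>j. Si (p (Suc 0 - j))))"
proof -
  \<comment> \<open>\<open>F\<close> reads two entries only, hence is a function of two arguments; a
    constant sequence with one update has just the shape in which linearity is assumed.\<close>
  let ?f = "\<lambda>a b. F ((\<lambda>_. b)(0 := a))"
  have eq: "?f a b = F ((\<lambda>_. a)(Suc 0 := b))" for a b
    by (rule dep) (simp add: le_Suc_eq)
  have f: "bilinear_on H H ground ?f"
  proof (rule bilinear_onI)
    show "linear_on H ground (\<lambda>a. ?f a b)" if "b \<in> carr H" for b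
      by (rule assms(2)) (rule that)
    show "linear_on H ground (\<lambda>b. ?f a b)" if "a \<in> carr H" for a
      unfolding eq by (rule assms(3)) (rule that)
  qed
  have F: "F p = ?f (p 0) (p (Suc 0))" for p
    by (rule dep) (simp add: le_Suc_eq)
  have G: "F (\<lambda>j. g (p (Suc 0 - j))) = ?f (g (p (Suc 0))) (g (p 0))" for p and g :: "'a \<Rightarrow> 'a"
    by (rule dep) (simp add: le_Suc_eq)
  show "swn (Suc 0) (S x) F = swn (Suc 0) x (\<lambda>p. F (\<lambda>j. S (p (Suc 0 - j))))"
    unfolding G using sw_S[OF x f] by (simp add: F[symmetric] cong del: swn_cong')
  show "swn (Suc 0) (Si x) F = swn (Suc 0) x (\<lambda>p. F (\<lambda>j. Si (p (Suc 0 - j))))"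
    unfolding G using sw_Si[OF x f] by (simp add: F[symmetric] cong del: swn_cong')
qed

text \<open>\<open>Si\<close> reverses products, so applying it to the pair S(z') z'' produces
  \<open>Si\<close> of the second component before the first one. This flipped order is the source
  of all cancellations involving the inverse antipode.\<close>

lemma Si_left_end:
  assumes f: "linear_on H ground f" and z: "z \<in> carr H"
  shows "swn (Suc 0) z (\<lambda>q. f (Si (q (Suc 0)) \<cdot> q 0)) = \<epsilon> z * f \<one>"
  using antipode_left_end[of "\<lambda>u. f (Si u)" z] z
  by (simp add: Si_mul Si_one linear_on_comp[OF f])

lemma Si_right_end:
  assumes f: "linear_on H ground f" and z: "z \<in> carr H"
  shows "swn (Suc 0) z (\<lambda>q. f (q (Suc 0) \<cdot> Si (q 0))) = \<epsilon> z * f \<one>"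
  using antipode_right_end[of "\<lambda>u. f (Si u)" z] z
  by (simp add: Si_mul Si_one linear_on_comp[OF f])

lemma Si_left_mid:
  assumes f: "linear_on H ground f" and z: "z \<in> carr H" and w: "w \<in> carr H"
  shows "swn (Suc 0) z (\<lambda>q. f (Si (q (Suc 0)) \<cdot> (q 0 \<cdot> w))) = \<epsilon> z * f w"
  using Si_left_end[of "\<lambda>u. f (u \<cdot> w)" z] z w
  by (simp add: mul_assoc unt_left linear_on_comp[OF f])

lemma Si_right_mid:
  assumes f: "linear_on H ground f" and z: "z \<in> carr H" and w: "w \<in> carr H"
  shows "swn (Suc 0) z (\<lambda>q. f (q (Suc 0) \<cdot> (Si (q 0) \<cdot> w))) = \<epsilon> z * f w"
  using Si_right_end[of "\<lambda>u. f (u \<cdot> w)" z] z w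
  by (simp add: mul_assoc unt_left linear_on_comp[OF f])

end

lemma finite_comb_sum_list:
  assumes "finite_comb Q L"
  shows "L (\<lambda>p. \<Sum>z\<leftarrow>zs. F z p) = (\<Sum>z\<leftarrow>zs. L (F z))"
proof -
  obtain xs where xs: "\<And>F. L F = (\<Sum>(c, p)\<leftarrow>xs. c * F p)"
    using assms by (rule finite_combE) blast
  have "(\<Sum>(c, p)\<leftarrow>xs. c * (f p + g p)) = (\<Sum>(c, p)\<leftarrow>xs. c * f p) + (\<Sum>(c, p)\<leftarrow>xs. c * g p)" for f g
    by (induction xs) (auto simp: algebra_simps)
  moreover have "(\<Sum>(c, p)\<leftarrow>xs. c * 0) = (0::'b)"
    by (induction xs) auto
  ultimately show ?thesis
    unfolding xs by (induction zs) simp_all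
qed

lemma (in bialgebra) swn_sum_list:
  "x \<in> carr H \<Longrightarrow> swn n x (\<lambda>p. \<Sum>z\<leftarrow>zs. F z p) = (\<Sum>z\<leftarrow>zs. swn n x (F z))"
  by (rule finite_comb_sum_list[OF finite_comb_swn])

section \<open>The finite dual\<close>

context bij_hopf_algebra
begin

abbreviation D :: "('k, 'a \<Rightarrow> 'k) bialgebra_data"
  where "D \<equiv> dual H"

lemma dual_simps [simp]:
  "carr (dual_space H) = carr D" "scl (dual_space H) = fscale" "scl D = fscale"
  by (simp_all add: dual_def dual_space_def)

lemma dual_space_cong [simp]:
  "tensor (dual_space H) (dual_space H) = tensor D D"
  "tens (dual_space H) (dual_space H) = tens D D"
  "tensor_lift (dual_space H) (dual_space H) = tensor_lift D D"
  by (intro ext tensor_space_cong tens_space_cong tensor_lift_space_cong; simp)+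

lemma eval2_linear_dual:
  assumes "set xs \<subseteq> carr (linear_dual H) \<times> carr (linear_dual H)"
  shows "eval2 (linear_dual H) (tens_sum (linear_dual H) (linear_dual H) xs) a b = (\<Sum>(\<alpha>, \<gamma>)\<leftarrow>xs. \<alpha> a * \<gamma> b)"
proof -
  have "bilinear_on (linear_dual H) (linear_dual H) ground (\<lambda>\<alpha> \<gamma>. \<alpha> a * \<gamma> b)"
    by (auto simp: bilinear_on_def linear_on_def ground_def linear_dual_def fscale_def algebra_simps)
  then show ?thesis
    unfolding eval2_def by (intro tensor_lift_tens_sum[OF lin_space_ground _ assms])
qed

lemma extend0_linear: "linear_on H ground f \<Longrightarrow> extend0 H f \<in> carr (linear_dual H)"
  by (auto simp: linear_dual_def extend0_def linear_on_def)

text \<open>Membership in the finite dual as a finite splitting of \<beta>(ab). Lists of linear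
  forms replace tensors of functionals, which leaves the values of the forms off the carrier
  free.\<close>

lemma dual_memE:
  assumes "\<beta> \<in> carr D"
  obtains xs where "\<And>\<alpha> \<gamma>. (\<alpha>, \<gamma>) \<in> set xs \<Longrightarrow> linear_on H ground \<alpha> \<and> linear_on H ground \<gamma>"
    and "\<And>a b. a \<in> carr H \<Longrightarrow> b \<in> carr H \<Longrightarrow> \<beta> (a \<cdot> b) = (\<Sum>(\<alpha>, \<gamma>)\<leftarrow>xs. \<alpha> a * \<gamma> b)"
proof -
  obtain t where t: "t \<in> carr (tensor (linear_dual H) (linear_dual H))"
    and ev: "\<And>a b. a \<in> carr H \<Longrightarrow> b \<in> carr H \<Longrightarrow> eval2 (linear_dual H) t a b = \<beta> (a \<cdot> b)"
    using assms by (auto simp: dual_def dual_space_def)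
  obtain xs where xs: "set xs \<subseteq> carr (linear_dual H) \<times> carr (linear_dual H)"
    "t = tens_sum (linear_dual H) (linear_dual H) xs"
    using tensor_rep[OF lin_space_linear_dual t] by blast
  show thesis
  proof (rule that)
    show "linear_on H ground \<alpha> \<and> linear_on H ground \<gamma>" if "(\<alpha>, \<gamma>) \<in> set xs" for \<alpha> \<gamma>
      using that xs(1) by (auto simp: linear_dual_def)
    show "\<beta> (a \<cdot> b) = (\<Sum>(\<alpha>, \<gamma>)\<leftarrow>xs. \<alpha> a * \<gamma> b)" if "a \<in> carr H" "b \<in> carr H" for a b
      using ev[OF that] eval2_linear_dual[OF xs(1)] xs(2) by simp
  qed
qed

lemma dual_memI:
  assumes "linear_on H ground \<beta>" "\<And>x. x \<notin> carr H \<Longrightarrow> \<beta> x = 0"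
    and lin: "\<And>\<alpha> \<gamma>. (\<alpha>, \<gamma>) \<in> set xs \<Longrightarrow> linear_on H ground \<alpha> \<and> linear_on H ground \<gamma>"
    and eq: "\<And>a b. a \<in> carr H \<Longrightarrow> b \<in> carr H \<Longrightarrow> \<beta> (a \<cdot> b) = (\<Sum>(\<alpha>, \<gamma>)\<leftarrow>xs. \<alpha> a * \<gamma> b)"
  shows "\<beta> \<in> carr D"
proof -
  let ?ys = "map (\<lambda>(\<alpha>, \<gamma>). (extend0 H \<alpha>, extend0 H \<gamma>)) xs"
  have ys: "set ?ys \<subseteq> carr (linear_dual H) \<times> carr (linear_dual H)"
    using lin by (auto intro!: extend0_linear)
  have "eval2 (linear_dual H) (tens_sum (linear_dual H) (linear_dual H) ?ys) a b = \<beta> (a \<cdot> b)"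
    if "a \<in> carr H" "b \<in> carr H" for a b
    unfolding eval2_linear_dual[OF ys]
    using that by (simp add: eq o_def case_prod_unfold extend0_def)
  then show ?thesis
    using assms(1,2) tens_sum_in_tensor[OF ys]
    by (auto simp: dual_def dual_space_def linear_dual_def)
qed

lemma dual_linear: "\<beta> \<in> carr D \<Longrightarrow> linear_on H ground \<beta>"
  by (simp add: dual_def dual_space_def linear_dual_def)

lemma dual_outside: "\<beta> \<in> carr D \<Longrightarrow> x \<notin> carr H \<Longrightarrow> \<beta> x = 0"
  by (simp add: dual_def dual_space_def linear_dual_def)

lemma dual_eqI:
  "\<alpha> \<in> carr D \<Longrightarrow> \<beta> \<in> carr D \<Longrightarrow> (\<And>x. x \<in> carr H \<Longrightarrow> \<alpha> x = \<beta> x) \<Longrightarrow> \<alpha> = \<beta>"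
  by (metis dual_outside ext)

lemma lin_space_dual: "lin_space D"
proof -
  have "0 \<in> carr D"
    by (rule dual_memI[where xs = "[]"]) (simp_all add: linear_on_def ground_def)
  moreover have "\<alpha> + \<beta> \<in> carr D" if \<alpha>: "\<alpha> \<in> carr D" and \<beta>: "\<beta> \<in> carr D" for \<alpha> \<beta>
  proof -
    obtain xs where xs: "\<And>\<alpha> \<gamma>. (\<alpha>, \<gamma>) \<in> set xs \<Longrightarrow> linear_on H ground \<alpha> \<and> linear_on H ground \<gamma>"
      "\<And>a b. a \<in> carr H \<Longrightarrow> b \<in> carr H \<Longrightarrow> \<alpha> (a \<cdot> b) = (\<Sum>(\<alpha>, \<gamma>)\<leftarrow>xs. \<alpha> a * \<gamma> b)"
      using \<alpha> by (rule dual_memE) blast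
    obtain ys where ys: "\<And>\<alpha> \<gamma>. (\<alpha>, \<gamma>) \<in> set ys \<Longrightarrow> linear_on H ground \<alpha> \<and> linear_on H ground \<gamma>"
      "\<And>a b. a \<in> carr H \<Longrightarrow> b \<in> carr H \<Longrightarrow> \<beta> (a \<cdot> b) = (\<Sum>(\<alpha>, \<gamma>)\<leftarrow>ys. \<alpha> a * \<gamma> b)"
      using \<beta> by (rule dual_memE) blast
    show ?thesis
    proof (rule dual_memI[where xs = "xs @ ys"])
      show "linear_on H ground (\<alpha> + \<beta>)"
        using dual_linear[OF \<alpha>] dual_linear[OF \<beta>] by (auto simp: linear_on_def ground_def algebra_simps)
    qed (use xs ys \<alpha> \<beta> in \<open>auto simp: dual_outside\<close>)
  qed
  moreover have "fscale c \<beta> \<in> carr D" if \<beta>: "\<beta> \<in> carr D" for c \<beta>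
  proof -
    obtain xs where xs: "\<And>\<alpha> \<gamma>. (\<alpha>, \<gamma>) \<in> set xs \<Longrightarrow> linear_on H ground \<alpha> \<and> linear_on H ground \<gamma>"
      "\<And>a b. a \<in> carr H \<Longrightarrow> b \<in> carr H \<Longrightarrow> \<beta> (a \<cdot> b) = (\<Sum>(\<alpha>, \<gamma>)\<leftarrow>xs. \<alpha> a * \<gamma> b)"
      using \<beta> by (rule dual_memE) blast
    have *: "c * (\<Sum>(\<alpha>, \<gamma>)\<leftarrow>xs. \<alpha> a * \<gamma> b) = (\<Sum>(\<alpha>, \<gamma>)\<leftarrow>map (\<lambda>(\<alpha>, \<gamma>). (\<lambda>x. c * \<alpha> x, \<gamma>)) xs. \<alpha> a * \<gamma> b)" for a b
      by (induction xs) (auto simp: algebra_simps)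
    show ?thesis
    proof (rule dual_memI[where xs = "map (\<lambda>(\<alpha>, \<gamma>). (\<lambda>x. c * \<alpha> x, \<gamma>)) xs"])
      show "linear_on H ground (fscale c \<beta>)"
        using dual_linear[OF \<beta>] by (auto simp: linear_on_def ground_def fscale_def algebra_simps)
      show "fscale c \<beta> (a \<cdot> b) = (\<Sum>(\<alpha>, \<gamma>)\<leftarrow>map (\<lambda>(\<alpha>, \<gamma>). (\<lambda>x. c * \<alpha> x, \<gamma>)) xs. \<alpha> a * \<gamma> b)"
        if "a \<in> carr H" "b \<in> carr H" for a b
        unfolding *[symmetric] using xs(2) that by (simp add: fscale_def)
    qed (use xs(1) \<beta> in \<open>auto simp: dual_outside fscale_def intro!: linear_form_mult_left\<close>)
  qed
  ultimately show ?thesis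
    by (simp add: lin_space_def vector_space_fscale fsc.subspace_def)
qed

lemma dual_mul: "mul D \<alpha> \<beta> = extend0 H (\<lambda>b. sw2 H (\<lambda>b1 b2. \<alpha> b1 * \<beta> b2) b)"
  unfolding dual_def by simp

lemma dual_unt: "unt D = extend0 H \<epsilon>"
  unfolding dual_def by simp

lemma dual_mul_apply:
  "\<alpha> \<in> carr D \<Longrightarrow> \<beta> \<in> carr D \<Longrightarrow> x \<in> carr H \<Longrightarrow>
    mul D \<alpha> \<beta> x = swn (Suc 0) x (\<lambda>p. \<alpha> (p 0) * \<beta> (p (Suc 0)))"
  by (simp add: dual_mul extend0_def sw2_eq_sw bilinear_on_mult dual_linear sw_eq_swn)

lemma dual_unt_apply: "x \<in> carr H \<Longrightarrow> unt D x = \<epsilon> x"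
  by (simp add: dual_unt extend0_def)

lemma dual_unt_closed [simp]: "unt D \<in> carr D"
  by (rule dual_memI[where xs = "[(\<epsilon>, \<epsilon>)]"])
    (auto simp: dual_unt extend0_def counit_linear counit_mul linear_on_cong[OF _ lin_space_H, of "\<lambda>x. if x \<in> carr H then \<epsilon> x else 0" \<epsilon>])

lemma sum_list_times:
  "(\<Sum>(a, b)\<leftarrow>xs. f a b) * (\<Sum>(c, d)\<leftarrow>ys. g c d) =
    (\<Sum>((a, b), (c, d))\<leftarrow>List.product xs ys. f a b * (g c d :: 'c::comm_semiring_1))"
proof (induction xs)
  case (Cons z xs)
  obtain a b where z: "z = (a, b)" by fastforce
  have "(\<Sum>w\<leftarrow>ys. f a b * (case w of (c, d) \<Rightarrow> g c d)) = f a b * (\<Sum>(c, d)\<leftarrow>ys. g c d)"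
    by (induction ys) (auto simp: algebra_simps)
  then show ?case using Cons by (simp add: z distrib_right o_def case_prod_unfold)
qed simp

text \<open>Since the coproduct is multiplicative, \<alpha>\<beta> at ab is \<alpha>(a' b')
  \<beta>(a'' b''); splitting both values and collecting what belongs to a and to b gives
  convolutions of the pieces, one pair for each pair of summands.\<close>

lemma dual_mul_closed [simp]:
  assumes \<alpha>: "\<alpha> \<in> carr D" and \<beta>: "\<beta> \<in> carr D"
  shows "mul D \<alpha> \<beta> \<in> carr D"
proof -
  obtain xs where xs: "\<And>\<alpha> \<gamma>. (\<alpha>, \<gamma>) \<in> set xs \<Longrightarrow> linear_on H ground \<alpha> \<and> linear_on H ground \<gamma>"
    "\<And>a b. a \<in> carr H \<Longrightarrow> b \<in> carr H \<Longrightarrow> \<alpha> (a \<cdot> b) = (\<Sum>(\<alpha>, \<gamma>)\<leftarrow>xs. \<alpha> a * \<gamma> b)"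
    using \<alpha> by (rule dual_memE) blast
  obtain ys where ys: "\<And>\<alpha> \<gamma>. (\<alpha>, \<gamma>) \<in> set ys \<Longrightarrow> linear_on H ground \<alpha> \<and> linear_on H ground \<gamma>"
    "\<And>a b. a \<in> carr H \<Longrightarrow> b \<in> carr H \<Longrightarrow> \<beta> (a \<cdot> b) = (\<Sum>(\<alpha>, \<gamma>)\<leftarrow>ys. \<alpha> a * \<gamma> b)"
    using \<beta> by (rule dual_memE) blast
  note l = dual_linear[OF \<alpha>] dual_linear[OF \<beta>]
  note [simp] = linear_on_comp[OF l(1)] linear_on_comp[OF l(2)]
  let ?u = "\<lambda>f g x. swn (Suc 0) x (\<lambda>p. f (p 0) * g (p (Suc 0)))"
  let ?zs = "map (\<lambda>((\<alpha>1, \<alpha>2), (\<beta>1, \<beta>2)). (?u \<alpha>1 \<beta>1, ?u \<alpha>2 \<beta>2)) (List.product xs ys)"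
  show ?thesis
  proof (rule dual_memI[where xs = ?zs])
    show "linear_on H ground (mul D \<alpha> \<beta>)"
      by (subst linear_on_cong[OF dual_mul_apply[OF \<alpha> \<beta>] lin_space_H]) simp_all
    show "mul D \<alpha> \<beta> x = 0" if "x \<notin> carr H" for x
      using that by (simp add: dual_mul extend0_def)
    show "linear_on H ground f \<and> linear_on H ground g" if "(f, g) \<in> set ?zs" for f g
      using that by auto
    fix a b assume ab: "a \<in> carr H" "b \<in> carr H"
    have "mul D \<alpha> \<beta> (a \<cdot> b) = swn (Suc 0) a (\<lambda>p. swn (Suc 0) b (\<lambda>q. \<alpha> (p 0 \<cdot> q 0) * \<beta> (p (Suc 0) \<cdot> q (Suc 0))))"
      using ab by (simp add: dual_mul_apply \<alpha> \<beta>)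
    also have "\<dots> = swn (Suc 0) a (\<lambda>p. swn (Suc 0) b (\<lambda>q.
        \<Sum>((\<alpha>1, \<alpha>2), (\<beta>1, \<beta>2))\<leftarrow>List.product xs ys. (\<alpha>1 (p 0) * \<alpha>2 (q 0)) * (\<beta>1 (p (Suc 0)) * \<beta>2 (q (Suc 0)))))"
      using ab by (simp add: xs ys sum_list_times)
    also have "\<dots> = (\<Sum>((\<alpha>1, \<alpha>2), (\<beta>1, \<beta>2))\<leftarrow>List.product xs ys. ?u \<alpha>1 \<beta>1 a * ?u \<alpha>2 \<beta>2 b)"
      using ab by (simp add: swn_sum_list case_prod_unfold mult_ac swn_swap[of b a])
    also have "\<dots> = (\<Sum>(f, g)\<leftarrow>?zs. f a * g b)"
      by (simp add: o_def case_prod_unfold)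
    finally show "mul D \<alpha> \<beta> (a \<cdot> b) = (\<Sum>(f, g)\<leftarrow>?zs. f a * g b)" .
  qed
qed

text \<open>Precomposition with an anti-multiplicative map exchanges the two sides of a splitting of
  \<beta>(ab); needed for both \<open>S\<close> and \<open>Si\<close>.\<close>

lemma dual_comp_closed:
  assumes \<beta>: "\<beta> \<in> carr D" and g: "linear_on H H g"
    and anti: "\<And>a b. a \<in> carr H \<Longrightarrow> b \<in> carr H \<Longrightarrow> g (a \<cdot> b) = g b \<cdot> g a"
  shows "extend0 H (\<lambda>x. \<beta> (g x)) \<in> carr D"
proof -
  obtain xs where xs: "\<And>\<alpha> \<gamma>. (\<alpha>, \<gamma>) \<in> set xs \<Longrightarrow> linear_on H ground \<alpha> \<and> linear_on H ground \<gamma>"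
    "\<And>a b. a \<in> carr H \<Longrightarrow> b \<in> carr H \<Longrightarrow> \<beta> (a \<cdot> b) = (\<Sum>(\<alpha>, \<gamma>)\<leftarrow>xs. \<alpha> a * \<gamma> b)"
    using \<beta> by (rule dual_memE) blast
  have gc: "g x \<in> carr H" if "x \<in> carr H" for x using linear_on_closed[OF g that] .
  show ?thesis
  proof (rule dual_memI[where xs = "map (\<lambda>(\<alpha>, \<gamma>). (\<lambda>x. \<gamma> (g x), \<lambda>x. \<alpha> (g x))) xs"])
    show "linear_on H ground (extend0 H (\<lambda>x. \<beta> (g x)))"
      by (subst linear_on_cong[OF _ lin_space_H, of _ "\<lambda>x. \<beta> (g x)"])
        (simp_all add: extend0_def linear_on_comp[OF dual_linear[OF \<beta>] g])
  qed (use xs in \<open>auto simp: extend0_def anti gc o_def case_prod_unfold mult.commute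
      intro!: linear_on_comp[OF _ g]\<close>)
qed

lemma dual_translate_closed:
  assumes \<beta>: "\<beta> \<in> carr D" and b: "b \<in> carr H"
  shows "extend0 H (\<lambda>x. \<beta> (x \<cdot> b)) \<in> carr D" "extend0 H (\<lambda>x. \<beta> (b \<cdot> x)) \<in> carr D"
proof -
  note [simp] = linear_on_comp[OF dual_linear[OF \<beta>]]
  obtain xs where xs: "\<And>\<alpha> \<gamma>. (\<alpha>, \<gamma>) \<in> set xs \<Longrightarrow> linear_on H ground \<alpha> \<and> linear_on H ground \<gamma>"
    "\<And>a b. a \<in> carr H \<Longrightarrow> b \<in> carr H \<Longrightarrow> \<beta> (a \<cdot> b) = (\<Sum>(\<alpha>, \<gamma>)\<leftarrow>xs. \<alpha> a * \<gamma> b)"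
    using \<beta> by (rule dual_memE) blast
  show "extend0 H (\<lambda>x. \<beta> (x \<cdot> b)) \<in> carr D"
  proof (rule dual_memI[where xs = "map (\<lambda>(\<alpha>, \<gamma>). (\<alpha>, \<lambda>x. \<gamma> (x \<cdot> b))) xs"])
    show "linear_on H ground (extend0 H (\<lambda>x. \<beta> (x \<cdot> b)))"
      using b by (subst linear_on_cong[OF _ lin_space_H, of _ "\<lambda>x. \<beta> (x \<cdot> b)"]) (simp_all add: extend0_def)
  qed (use xs b in \<open>auto simp: extend0_def mul_assoc o_def case_prod_unfold
      intro!: linear_on_comp[of H ground _ H "\<lambda>x. x \<cdot> b"]\<close>)
  show "extend0 H (\<lambda>x. \<beta> (b \<cdot> x)) \<in> carr D"
  proof (rule dual_memI[where xs = "map (\<lambda>(\<alpha>, \<gamma>). (\<lambda>x. \<alpha> (b \<cdot> x), \<gamma>)) xs"])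
    show "linear_on H ground (extend0 H (\<lambda>x. \<beta> (b \<cdot> x)))"
      using b by (subst linear_on_cong[OF _ lin_space_H, of _ "\<lambda>x. \<beta> (b \<cdot> x)"]) (simp_all add: extend0_def)
  qed (use xs b in \<open>auto simp: extend0_def mul_assoc[symmetric] o_def case_prod_unfold
      intro!: linear_on_comp[of H ground _ H "\<lambda>x. b \<cdot> x"]\<close>)
qed

end

section \<open>The coproduct of the finite dual and its Sweedler sums\<close>

lemma fun_sum_apply: "(\<Sum>i\<in>A. f i) x = (\<Sum>i\<in>A. f i x)"
  by (induction A rule: infinite_finite_induct) auto

lemma fun_sum_list_apply: "(\<Sum>i\<leftarrow>xs. f i) x = (\<Sum>i\<leftarrow>xs. f i x)"
  by (induction xs) auto

context bij_hopf_algebra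
begin

lemma eval_linear [simp]: "linear_on D ground (\<lambda>\<beta>. \<beta> x)"
  by (simp add: linear_on_def ground_def fscale_def)

lemma eval2_bilinear: "bilinear_on D D ground (\<lambda>\<alpha> \<gamma>. \<alpha> a * \<gamma> b)"
  by (intro bilinear_on_mult eval_linear)

text \<open>
  The translates \<open>\<beta>(- b)\<close> span a finite-dimensional space, and the coordinates of \<open>\<beta>(- b)\<close> with
  respect to a basis of translates are again elements of the finite dual, as functions of \<open>b\<close>.
\<close>

lemma dual_comul_exists:
  assumes \<beta>: "\<beta> \<in> carr D"
  shows "\<exists>t \<in> carr (tensor D D). \<forall>a\<in>carr H. \<forall>b\<in>carr H.
    tensor_lift D D (\<lambda>\<alpha> \<gamma>. \<alpha> a * \<gamma> b) t = \<beta> (a \<cdot> b)"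
proof -
  define lr where "lr b = extend0 H (\<lambda>x. \<beta> (x \<cdot> b))" for b
  obtain xs where xs: "\<And>\<alpha> \<gamma>. (\<alpha>, \<gamma>) \<in> set xs \<Longrightarrow> linear_on H ground \<alpha> \<and> linear_on H ground \<gamma>"
    "\<And>a b. a \<in> carr H \<Longrightarrow> b \<in> carr H \<Longrightarrow> \<beta> (a \<cdot> b) = (\<Sum>(\<alpha>, \<gamma>)\<leftarrow>xs. \<alpha> a * \<gamma> b)"
    using \<beta> by (rule dual_memE) blast
  obtain F where F: "F \<subseteq> lr ` carr H" "fsc.independent F" "lr ` carr H \<subseteq> fsc.span F"
    by (rule fsc.maximal_independent_subset)
  \<comment> \<open>The left-hand forms of one splitting of \<beta> span all translates; this bounds
    the size of the independent set \<open>F\<close>.\<close>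
  define T where "T = (\<lambda>z. extend0 H (fst z)) ` set xs"
  have "lr b \<in> fsc.span T" if b: "b \<in> carr H" for b
  proof -
    have "lr b = (\<Sum>z\<leftarrow>xs. fscale (snd z b) (extend0 H (fst z)))"
      using xs(2) b
      by (auto simp: lr_def extend0_def fun_eq_iff fun_sum_list_apply fscale_def case_prod_unfold mult.commute)
    moreover have base: "extend0 H (fst z) \<in> fsc.span T" if "z \<in> set xs" for z
      using that by (intro fsc.span_base) (simp add: T_def)
    moreover have "set ys \<subseteq> set xs \<Longrightarrow>
        (\<Sum>z\<leftarrow>ys. fscale (snd z b) (extend0 H (fst z))) \<in> fsc.span T" for ys
      by (induction ys) (auto simp: fsc.span_zero intro!: fsc.span_add fsc.span_scale base)
    ultimately show ?thesis by simp
  qed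
  then have finF: "finite F"
    using fsc.independent_span_bound[of T F] F(1,2) by (force simp: T_def)
  define c where "c b v = fsc.representation F (lr b) v" for b v
  have lr_span: "lr b \<in> fsc.span F" if "b \<in> carr H" for b using F(3) that by auto
  have lr_sum: "lr b = (\<Sum>v\<in>F. fscale (c b v) v)" if "b \<in> carr H" for b
    unfolding c_def by (rule fsc.sum_representation_eq[OF F(2) lr_span[OF that] finF subset_refl, symmetric])
  have lin_mul: "linear_on H ground (\<lambda>b. \<beta> (x \<cdot> b))" if "x \<in> carr H" for x
    using that by (intro linear_on_comp[OF dual_linear[OF \<beta>]]) simp
  have lr_add: "lr (a + b) = lr a + lr b" if "a \<in> carr H" "b \<in> carr H" for a b
    using lin_mul that by (auto simp: lr_def extend0_def linear_on_def fun_eq_iff)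
  have lr_scale: "lr (scl H k b) = fscale k (lr b)" if "b \<in> carr H" for k b
    using lin_mul that by (auto simp: lr_def extend0_def linear_on_def fun_eq_iff fscale_def ground_def)
  have c_linear: "linear_on H ground (\<lambda>b. c b v)" for v
    using lr_span by (auto simp: linear_on_def ground_def c_def lr_add lr_scale
        fsc.representation_add[OF F(2)] fsc.representation_scale[OF F(2)])
  \<comment> \<open>Each basis vector is itself a translate of \<beta>, so its values at products
    are again values of \<beta>.\<close>
  obtain g where g: "\<And>w. w \<in> F \<Longrightarrow> g w \<in> carr H \<and> w = lr (g w)"
  proof -
    have "\<forall>w\<in>F. \<exists>b. b \<in> carr H \<and> w = lr b" using F(1) by blast
    from bchoice[OF this] show thesis using that by blast
  qed
  obtain ws where ws: "set ws = F" "distinct ws" using finite_distinct_list[OF finF] by blast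
  \<comment> \<open>Translating by \<open>b \<cdot> d\<close> is translating by \<open>d\<close> and
    then precomposing with multiplication by \<open>b\<close>. Expanding the first step in
    \<open>F\<close> shows that the coordinates behave like matrix coefficients of a representation;
    this is a splitting of each coordinate and puts it into the finite dual.\<close>
  have c_mul: "c (b \<cdot> d) v = (\<Sum>w\<in>F. c (b \<cdot> g w) v * c d w)" if bd: "b \<in> carr H" "d \<in> carr H" for b d v
  proof -
    have "lr (b \<cdot> d) = (\<Sum>w\<in>F. fscale (c d w) (lr (b \<cdot> g w)))"
    proof (rule ext)
      fix x
      show "lr (b \<cdot> d) x = (\<Sum>w\<in>F. fscale (c d w) (lr (b \<cdot> g w))) x"
      proof (cases "x \<in> carr H")
        case True
        have "lr (b \<cdot> d) x = lr d (x \<cdot> b)"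
          using True bd by (simp add: lr_def extend0_def mul_assoc)
        also have "\<dots> = (\<Sum>w\<in>F. c d w * w (x \<cdot> b))"
          by (subst lr_sum[OF bd(2)]) (simp add: fun_sum_apply fscale_def)
        also have "\<dots> = (\<Sum>w\<in>F. c d w * lr (g w) (x \<cdot> b))"
          using g by (intro sum.cong) auto
        also have "\<dots> = (\<Sum>w\<in>F. fscale (c d w) (lr (b \<cdot> g w))) x"
          unfolding fun_sum_apply using True bd g[THEN conjunct1]
          by (intro sum.cong) (auto simp: lr_def extend0_def mul_assoc fscale_def)
        finally show ?thesis .
      qed (simp add: lr_def extend0_def fun_sum_apply fscale_def)
    qed
    then show ?thesis
      using g[THEN conjunct1] bd lr_span unfolding c_def
      by (simp add: fsc.representation_sum[OF F(2)] fsc.representation_scale[OF F(2)]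
          fsc.span_scale mult.commute)
  qed
  have d_mem: "extend0 H (\<lambda>b. c b v) \<in> carr D" for v
  proof (rule dual_memI[where xs = "map (\<lambda>w. (\<lambda>b. c (b \<cdot> g w) v, \<lambda>d. c d w)) ws"])
    show "linear_on H ground (extend0 H (\<lambda>b. c b v))"
      by (subst linear_on_cong[OF _ lin_space_H, of _ "\<lambda>b. c b v"]) (simp_all add: extend0_def c_linear)
    show "extend0 H (\<lambda>b. c b v) (a \<cdot> b) =
        (\<Sum>(\<alpha>, \<gamma>)\<leftarrow>map (\<lambda>w. (\<lambda>b. c (b \<cdot> g w) v, \<lambda>d. c d w)) ws. \<alpha> a * \<gamma> b)"
      if "a \<in> carr H" "b \<in> carr H" for a b
      using that ws by (simp add: extend0_def c_mul o_def sum_list_distinct_conv_sum_set)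
  qed (use ws g in \<open>auto simp: extend0_def intro!: c_linear linear_on_comp[OF c_linear]\<close>)
  \<comment> \<open>The resulting coproduct of \<beta>: each basis translate paired with its
    coordinate function.\<close>
  let ?ys = "map (\<lambda>v. (v, extend0 H (\<lambda>b. c b v))) ws"
  have ys: "set ?ys \<subseteq> carr D \<times> carr D"
  proof -
    have "v \<in> carr D" if "v \<in> F" for v
      using F(1) that dual_translate_closed(1)[OF \<beta>] by (auto simp: lr_def)
    then show ?thesis using ws d_mem by auto
  qed
  have "tensor_lift D D (\<lambda>\<alpha> \<gamma>. \<alpha> a * \<gamma> b) (tens_sum D D ?ys) = \<beta> (a \<cdot> b)"
    if ab: "a \<in> carr H" "b \<in> carr H" for a b
  proof -
    have "tensor_lift D D (\<lambda>\<alpha> \<gamma>. \<alpha> a * \<gamma> b) (tens_sum D D ?ys) = (\<Sum>v\<in>F. v a * c b v)"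
      unfolding tensor_lift_tens_sum[OF lin_space_ground eval2_bilinear ys]
      using ws ab by (simp add: o_def extend0_def sum_list_distinct_conv_sum_set)
    also have "\<dots> = lr b a"
      by (subst lr_sum[OF ab(2)]) (simp add: fun_sum_apply fscale_def mult.commute)
    finally show ?thesis using ab by (simp add: lr_def extend0_def)
  qed
  then show ?thesis using tens_sum_in_tensor[OF ys] by blast
qed

definition evals :: "(('a \<Rightarrow> 'k) \<Rightarrow> 'k) set"
  where "evals = {\<lambda>\<beta>. \<beta> x | x. x \<in> carr H}"

lemma separating_evals: "separating D evals"
proof -
  have "\<beta> = 0" if "\<beta> \<in> carr D" "\<forall>\<phi>\<in>evals. \<phi> \<beta> = 0" for \<beta>
    using that lin_space.zero_closed[OF lin_space_dual]
    by (intro dual_eqI) (auto simp: evals_def)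
  then show ?thesis by (auto simp: separating_def evals_def)
qed

text \<open>The description in \<open>dual\<close> determines the coproduct: a solution exists by
  the preceding lemma, and it is unique because pairs of point evaluations separate the tensor
  square.\<close>

lemma dual_comul:
  assumes \<beta>: "\<beta> \<in> carr D"
  shows dual_comul_closed: "comul D \<beta> \<in> carr (tensor D D)"
    and dual_comul_eval: "a \<in> carr H \<Longrightarrow> b \<in> carr H \<Longrightarrow>
      tensor_lift D D (\<lambda>\<alpha> \<gamma>. \<alpha> a * \<gamma> b) (comul D \<beta>) = \<beta> (a \<cdot> b)"
proof -
  let ?P = "\<lambda>t. t \<in> carr (tensor D D) \<and> (\<forall>a\<in>carr H. \<forall>b\<in>carr H.
    tensor_lift D D (\<lambda>\<alpha> \<gamma>. \<alpha> a * \<gamma> b) t = \<beta> (a \<cdot> b))"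
  have def: "comul D \<beta> = (THE t. ?P t)"
  proof -
    have "comul D \<beta> = (THE t. t \<in> carr (tensor (dual_space H) (dual_space H)) \<and>
        (\<forall>a\<in>carr H. \<forall>b\<in>carr H. eval2 (dual_space H) t a b = \<beta> (a \<cdot> b)))"
      unfolding dual_def by simp
    then show ?thesis unfolding eval2_def dual_space_cong .
  qed
  have "\<exists>!t. ?P t"
  proof (rule ex_ex1I)
    show "\<exists>t. ?P t" using dual_comul_exists[OF \<beta>] by blast
    fix s t assume "?P s" "?P t"
    then show "s = t"
      by (intro separating_eqI[OF lin_space_tensor separating_tensor[OF lin_space_dual lin_space_dual
            separating_evals separating_evals]]) (auto simp: evals_def tens_form_def)
  qed
  from theI'[OF this] have P: "?P (comul D \<beta>)" unfolding def .
  from P show "comul D \<beta> \<in> carr (tensor D D)" by blast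
  from P show "a \<in> carr H \<Longrightarrow> b \<in> carr H \<Longrightarrow>
      tensor_lift D D (\<lambda>\<alpha> \<gamma>. \<alpha> a * \<gamma> b) (comul D \<beta>) = \<beta> (a \<cdot> b)" by blast
qed

text \<open>Linearity, like equality, can be tested by separating functionals. This reduces
  linearity of the structure maps to that of their scalar pairing formulas.\<close>

lemma linear_on_eqI:
  assumes V: "lin_space V" and W: "lin_space W" and \<Phi>: "separating W \<Phi>"
    and closed: "\<And>x. x \<in> carr V \<Longrightarrow> f x \<in> carr W"
    and lin: "\<And>\<phi>. \<phi> \<in> \<Phi> \<Longrightarrow> linear_on V ground (\<lambda>x. \<phi> (f x))"
  shows "linear_on V W f"
proof -
  interpret V: lin_space V by fact
  interpret W: lin_space W by fact
  have l: "linear_on W ground \<phi>" if "\<phi> \<in> \<Phi>" for \<phi> using \<Phi> that by (simp add: separating_def)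
  have "f (x + y) = f x + f y" if "x \<in> carr V" "y \<in> carr V" for x y
    using that closed lin l
    by (intro separating_eqI[OF W \<Phi>]) (auto simp: linear_on_def)
  moreover have "f (scl V c x) = scl W c (f x)" if "x \<in> carr V" for c x
    using that closed lin l
    by (intro separating_eqI[OF W \<Phi>]) (auto simp: linear_on_def)
  ultimately show ?thesis using closed by (simp add: linear_on_def)
qed

lemma dual_comul_linear: "linear_on D (tensor D D) (comul D)"
proof (rule linear_on_eqI[OF lin_space_dual lin_space_tensor
      separating_tensor[OF lin_space_dual lin_space_dual separating_evals separating_evals] dual_comul_closed])
  fix \<phi> assume "\<phi> \<in> {tens_form D D \<phi> \<psi> |\<phi> \<psi>. \<phi> \<in> evals \<and> \<psi> \<in> evals}"
  then obtain a b where ab: "a \<in> carr H" "b \<in> carr H" "\<phi> = tens_form D D (\<lambda>\<beta>. \<beta> a) (\<lambda>\<beta>. \<beta> b)"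
    by (auto simp: evals_def)
  show "linear_on D ground (\<lambda>x. \<phi> (comul D x))"
    by (subst linear_on_cong[OF _ lin_space_dual, of _ "\<lambda>\<beta>. \<beta> (a \<cdot> b)"])
      (simp_all add: ab tens_form_def dual_comul_eval)
qed

lemma dual_sw2_eval:
  assumes U: "lin_space U" and f: "bilinear_on D D U f" and g: "linear_on U ground g" and \<beta>: "\<beta> \<in> carr D"
  shows "g (sw2 D f \<beta>) = sw2 D (\<lambda>\<alpha> \<gamma>. g (f \<alpha> \<gamma>)) \<beta>"
  unfolding sw2_def
  by (rule linear_on_tensor_lift[OF lin_space_dual U lin_space_ground f g dual_comul_closed[OF \<beta>]])

lemma dual_sw2_linear:
  "lin_space U \<Longrightarrow> bilinear_on D D U f \<Longrightarrow> linear_on D U (sw2 D f)"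
  unfolding sw2_def by (intro linear_on_tensor_lift_arg lin_space_dual dual_comul_linear)

text \<open>The value depends on the chosen representation of the coproduct unless \<open>f\<close> is bilinear.\<close>

definition dsw :: "('a \<Rightarrow> 'k) \<Rightarrow> (('a \<Rightarrow> 'k) \<Rightarrow> ('a \<Rightarrow> 'k) \<Rightarrow> 'k) \<Rightarrow> 'k"
  where "dsw \<beta> f = (\<Sum>(\<alpha>, \<gamma>)\<leftarrow>(SOME xs. set xs \<subseteq> carr D \<times> carr D \<and> comul D \<beta> = tens_sum D D xs). f \<alpha> \<gamma>)"

lemma dsw_rep:
  assumes "\<beta> \<in> carr D"
  obtains xs where "set xs \<subseteq> carr D \<times> carr D" "comul D \<beta> = tens_sum D D xs"
    "\<And>f. dsw \<beta> f = (\<Sum>(\<alpha>, \<gamma>)\<leftarrow>xs. f \<alpha> \<gamma>)"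
  unfolding dsw_def
  using someI_ex[OF tensor_rep[OF lin_space_dual dual_comul_closed[OF assms]]] by blast

lemma dsw_sw2: "bilinear_on D D ground f \<Longrightarrow> \<beta> \<in> carr D \<Longrightarrow> sw2 D f \<beta> = dsw \<beta> f"
  by (rule dsw_rep, assumption) (simp add: sw2_def tensor_lift_tens_sum[OF lin_space_ground])

lemma finite_comb_dsw:
  assumes "\<beta> \<in> carr D"
  shows "finite_comb (carr D \<times> carr D) (\<lambda>f. dsw \<beta> (\<lambda>\<alpha> \<gamma>. f (\<alpha>, \<gamma>)))"
proof -
  obtain xs where "set xs \<subseteq> carr D \<times> carr D" "\<And>f. dsw \<beta> f = (\<Sum>(\<alpha>, \<gamma>)\<leftarrow>xs. f \<alpha> \<gamma>)"
    by (rule dsw_rep[OF assms]) blast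
  then show ?thesis
    unfolding finite_comb_def
    by (intro exI[of _ "map (Pair 1) xs"]) (auto simp: o_def case_prod_unfold image_iff)
qed

lemma dsw_cong [cong]:
  assumes "\<beta> = \<beta>'" "\<beta>' \<in> carr D" "\<And>\<alpha> \<gamma>. \<alpha> \<in> carr D \<Longrightarrow> \<gamma> \<in> carr D \<Longrightarrow> f \<alpha> \<gamma> = g \<alpha> \<gamma>"
  shows "dsw \<beta> f = dsw \<beta>' g"
  using finite_comb_cong[OF finite_comb_dsw[OF assms(2)], of "\<lambda>(\<alpha>, \<gamma>). f \<alpha> \<gamma>" "\<lambda>(\<alpha>, \<gamma>). g \<alpha> \<gamma>"] assms
  by auto

lemma dsw_swn:
  "\<beta> \<in> carr D \<Longrightarrow> x \<in> carr H \<Longrightarrow>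
    dsw \<beta> (\<lambda>\<alpha> \<gamma>. swn n x (\<lambda>p. F \<alpha> \<gamma> p)) = swn n x (\<lambda>p. dsw \<beta> (\<lambda>\<alpha> \<gamma>. F \<alpha> \<gamma> p))"
  using finite_comb_swap[OF finite_comb_dsw finite_comb_swn, where F = "\<lambda>z p. F (fst z) (snd z) p"] by simp

lemma dsw_mult_left: "\<beta> \<in> carr D \<Longrightarrow> dsw \<beta> (\<lambda>\<alpha> \<gamma>. c * F \<alpha> \<gamma>) = c * dsw \<beta> F"
  using finite_comb_mult_left[OF finite_comb_dsw, of \<beta> c "\<lambda>z. F (fst z) (snd z)"] by simp

lemma dsw_mult_right: "\<beta> \<in> carr D \<Longrightarrow> dsw \<beta> (\<lambda>\<alpha> \<gamma>. F \<alpha> \<gamma> * c) = dsw \<beta> F * c"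
  using finite_comb_mult_right[OF finite_comb_dsw, of \<beta> "\<lambda>z. F (fst z) (snd z)" c] by simp

text \<open>The defining property of the coproduct of \<beta>. As a rewrite rule it eliminates
  Sweedler sums over functionals in favour of products in \<open>H\<close>.\<close>

lemma dsw_eval:
  assumes "\<beta> \<in> carr D" "x \<in> carr H" "y \<in> carr H"
  shows "dsw \<beta> (\<lambda>\<alpha> \<gamma>. \<alpha> x * \<gamma> y) = \<beta> (x \<cdot> y)"
  using dual_comul_eval[OF assms] dsw_sw2[OF eval2_bilinear assms(1)] by (simp add: sw2_def)

lemma linear_on_dsw_param:
  assumes "\<beta> \<in> carr D" "\<And>\<alpha> \<gamma>. \<alpha> \<in> carr D \<Longrightarrow> \<gamma> \<in> carr D \<Longrightarrow> linear_on V ground (\<lambda>v. F v \<alpha> \<gamma>)"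
  shows "linear_on V ground (\<lambda>v. dsw \<beta> (\<lambda>\<alpha> \<gamma>. F v \<alpha> \<gamma>))"
proof -
  have "linear_on V ground (\<lambda>v. dsw \<beta> (\<lambda>\<alpha> \<gamma>. F v (fst (\<alpha>, \<gamma>)) (snd (\<alpha>, \<gamma>))))"
    by (rule finite_comb_linear[OF finite_comb_dsw[OF assms(1)], of V "\<lambda>v z. F v (fst z) (snd z)"])
      (auto intro: assms(2))
  then show ?thesis unfolding fst_conv snd_conv .
qed

lemma linear_on_dual_sw2_param:
  assumes "lin_space P" "lin_space U" "\<beta> \<in> carr D"
    "\<And>p. p \<in> carr P \<Longrightarrow> bilinear_on D D U (f p)"
    "\<And>\<alpha> \<gamma>. \<alpha> \<in> carr D \<Longrightarrow> \<gamma> \<in> carr D \<Longrightarrow> linear_on P U (\<lambda>p. f p \<alpha> \<gamma>)"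
  shows "linear_on P U (\<lambda>p. sw2 D (f p) \<beta>)"
  unfolding sw2_def
  by (intro linear_on_tensor_lift_param lin_space_dual assms dual_comul_closed)

lemma dual_mul_bilinear: "bilinear_on D D D (mul D)"
proof (rule bilinear_onI)
  fix \<gamma> assume \<gamma>: "\<gamma> \<in> carr D"
  show "linear_on D D (\<lambda>\<alpha>. mul D \<alpha> \<gamma>)"
  proof (rule linear_on_eqI[OF lin_space_dual lin_space_dual separating_evals])
    fix \<phi> assume "\<phi> \<in> evals"
    then obtain x where x: "x \<in> carr H" "\<phi> = (\<lambda>\<beta>. \<beta> x)" by (auto simp: evals_def)
    show "linear_on D ground (\<lambda>\<alpha>. \<phi> (mul D \<alpha> \<gamma>))"
      by (subst linear_on_cong[OF _ lin_space_dual, of _ "\<lambda>\<alpha>. swn (Suc 0) x (\<lambda>p. \<alpha> (p 0) * \<gamma> (p (Suc 0)))"])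
        (simp_all add: x \<gamma> dual_mul_apply)
  qed (simp add: \<gamma>)
  show "linear_on D D (mul D \<gamma>)"
  proof (rule linear_on_eqI[OF lin_space_dual lin_space_dual separating_evals])
    fix \<phi> assume "\<phi> \<in> evals"
    then obtain x where x: "x \<in> carr H" "\<phi> = (\<lambda>\<beta>. \<beta> x)" by (auto simp: evals_def)
    show "linear_on D ground (\<lambda>\<alpha>. \<phi> (mul D \<gamma> \<alpha>))"
      by (subst linear_on_cong[OF _ lin_space_dual, of _ "\<lambda>\<alpha>. swn (Suc 0) x (\<lambda>p. \<gamma> (p 0) * \<alpha> (p (Suc 0)))"])
        (simp_all add: x \<gamma> dual_mul_apply)
  qed (simp add: \<gamma>)
qed

lemma linear_on_fscale: "f \<in> carr D \<Longrightarrow> linear_on V ground g \<Longrightarrow> linear_on V D (\<lambda>v. fscale (g v) f)"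
  using linear_on_scl_form[OF lin_space_dual, of V g f] by simp

lemma linear_on_fscale_right: "linear_on D D (\<lambda>\<alpha>. fscale c \<alpha>)"
  using lin_space.linear_on_scl[OF lin_space_dual, of c] by simp

text \<open>Pairing \<beta>' with x and \<beta>'' with b gives \<beta>(xb): acting from the left on
  functionals is translating the argument from the right.\<close>

lemma lreg_eq:
  assumes b: "b \<in> carr H" and \<beta>: "\<beta> \<in> carr D"
  shows "lreg H b \<beta> = extend0 H (\<lambda>x. \<beta> (x \<cdot> b))"
proof (rule dual_eqI)
  have bil: "bilinear_on D D D (\<lambda>\<beta>1 \<beta>2. fscale (\<beta>2 b) \<beta>1)"
    by (intro bilinear_onI linear_on_fscale linear_on_fscale_right eval_linear)
  show "lreg H b \<beta> \<in> carr D"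
    unfolding lreg_def using linear_on_closed[OF dual_sw2_linear[OF lin_space_dual bil] \<beta>] .
  fix x assume x: "x \<in> carr H"
  have "lreg H b \<beta> x = sw2 D (\<lambda>\<beta>1 \<beta>2. fscale (\<beta>2 b) \<beta>1 x) \<beta>"
    unfolding lreg_def by (rule dual_sw2_eval[OF lin_space_dual bil eval_linear \<beta>])
  also have "(\<lambda>\<beta>1 \<beta>2. fscale (\<beta>2 b) \<beta>1 x) = (\<lambda>\<beta>1 \<beta>2. \<beta>1 x * \<beta>2 b)"
    by (simp add: fscale_def mult.commute)
  also have "sw2 D (\<lambda>\<beta>1 \<beta>2. \<beta>1 x * \<beta>2 b) \<beta> = extend0 H (\<lambda>x. \<beta> (x \<cdot> b)) x"
    using x b \<beta> by (simp add: sw2_def dual_comul_eval extend0_def)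
  finally show "lreg H b \<beta> x = extend0 H (\<lambda>x. \<beta> (x \<cdot> b)) x" .
qed (rule dual_translate_closed(1)[OF \<beta> b])

lemma rreg_eq:
  assumes b: "b \<in> carr H" and \<beta>: "\<beta> \<in> carr D"
  shows "rreg H \<beta> b = extend0 H (\<lambda>x. \<beta> (b \<cdot> x))"
proof (rule dual_eqI)
  have bil: "bilinear_on D D D (\<lambda>\<beta>1 \<beta>2. fscale (\<beta>1 b) \<beta>2)"
    by (intro bilinear_onI linear_on_fscale linear_on_fscale_right eval_linear)
  show "rreg H \<beta> b \<in> carr D"
    unfolding rreg_def using linear_on_closed[OF dual_sw2_linear[OF lin_space_dual bil] \<beta>] .
  fix x assume x: "x \<in> carr H"
  have "rreg H \<beta> b x = sw2 D (\<lambda>\<beta>1 \<beta>2. fscale (\<beta>1 b) \<beta>2 x) \<beta>"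
    unfolding rreg_def by (rule dual_sw2_eval[OF lin_space_dual bil eval_linear \<beta>])
  also have "(\<lambda>\<beta>1 \<beta>2. fscale (\<beta>1 b) \<beta>2 x) = (\<lambda>\<beta>1 \<beta>2. \<beta>1 b * \<beta>2 x)"
    by (simp add: fscale_def)
  also have "sw2 D (\<lambda>\<beta>1 \<beta>2. \<beta>1 b * \<beta>2 x) \<beta> = extend0 H (\<lambda>x. \<beta> (b \<cdot> x)) x"
    using x b \<beta> by (simp add: sw2_def dual_comul_eval extend0_def)
  finally show "rreg H \<beta> b x = extend0 H (\<lambda>x. \<beta> (b \<cdot> x)) x" .
qed (rule dual_translate_closed(2)[OF \<beta> b])

lemma lreg_closed [simp]: "b \<in> carr H \<Longrightarrow> \<beta> \<in> carr D \<Longrightarrow> lreg H b \<beta> \<in> carr D"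
  by (simp add: lreg_eq dual_translate_closed)

lemma rreg_closed [simp]: "b \<in> carr H \<Longrightarrow> \<beta> \<in> carr D \<Longrightarrow> rreg H \<beta> b \<in> carr D"
  by (simp add: rreg_eq dual_translate_closed)

lemma lreg_apply: "b \<in> carr H \<Longrightarrow> \<beta> \<in> carr D \<Longrightarrow> x \<in> carr H \<Longrightarrow> lreg H b \<beta> x = \<beta> (x \<cdot> b)"
  by (simp add: lreg_eq extend0_def)

lemma rreg_apply: "b \<in> carr H \<Longrightarrow> \<beta> \<in> carr D \<Longrightarrow> x \<in> carr H \<Longrightarrow> rreg H \<beta> b x = \<beta> (b \<cdot> x)"
  by (simp add: rreg_eq extend0_def)

lemma coreg_bilinear:
  "\<mu> \<in> carr D \<Longrightarrow> bilinear_on H H H (\<lambda>b1 b2. scl H (\<mu> b1) b2)"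
  by (intro bilinear_onI linear_on_scl_form lin_space_H dual_linear linear_on_scl)

lemma coreg_closed [simp]: "b \<in> carr H \<Longrightarrow> \<mu> \<in> carr D \<Longrightarrow> coreg H b \<mu> \<in> carr H"
  unfolding coreg_def using linear_on_closed[OF sw2_linear[OF lin_space_H coreg_bilinear]] .

lemma coreg_form:
  assumes "b \<in> carr H" "\<mu> \<in> carr D" "linear_on H ground f"
  shows "f (coreg H b \<mu>) = swn (Suc 0) b (\<lambda>p. \<mu> (p 0) * f (p (Suc 0)))"
  using swn_form[OF lin_space_H coreg_bilinear[OF assms(2)] assms(3,1)] assms(1,3)
  by (simp add: coreg_def linear_on_def ground_def)

text \<open>Precomposition with \<open>Si\<close> also preserves the finite dual, as
  \<open>Si\<close> reverses products, and it undoes precomposition with \<open>S\<close>.\<close>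

lemma dual_antipode_bij: "bij_betw (dual_antipode H S) (carr D) (carr D)"
proof (rule bij_betw_byWitness[where f' = "\<lambda>\<beta>. extend0 H (\<lambda>x. \<beta> (Si x))"])
  show "\<forall>\<beta>\<in>carr D. extend0 H (\<lambda>x. dual_antipode H S \<beta> (Si x)) = \<beta>"
    "\<forall>\<beta>\<in>carr D. dual_antipode H S (extend0 H (\<lambda>x. \<beta> (Si x))) = \<beta>"
    by (auto simp: dual_antipode_def extend0_def fun_eq_iff dual_outside)
  show "dual_antipode H S ` carr D \<subseteq> carr D"
    using dual_comp_closed[OF _ antipode_linear S_mul] by (auto simp: dual_antipode_def[abs_def])
  show "(\<lambda>\<beta>. extend0 H (\<lambda>x. \<beta> (Si x))) ` carr D \<subseteq> carr D"
    using dual_comp_closed[OF _ Si_linear Si_mul] by auto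
qed

lemma dual_antipode_inv_eq:
  assumes \<beta>: "\<beta> \<in> carr D"
  shows "dual_antipode_inv H S \<beta> = extend0 H (\<lambda>x. \<beta> (Si x))"
proof -
  have "extend0 H (\<lambda>x. \<beta> (Si x)) \<in> carr D"
    using dual_comp_closed[OF \<beta> Si_linear Si_mul] .
  moreover have "dual_antipode H S (extend0 H (\<lambda>x. \<beta> (Si x))) = \<beta>"
    using \<beta> by (auto simp: dual_antipode_def extend0_def fun_eq_iff dual_outside)
  ultimately show ?thesis
    unfolding dual_antipode_inv_def
    using bij_betw_inv_into_left[OF dual_antipode_bij] by fastforce
qed

lemma dual_antipode_inv_closed [simp]: "\<beta> \<in> carr D \<Longrightarrow> dual_antipode_inv H S \<beta> \<in> carr D"
  by (simp add: dual_antipode_inv_eq dual_comp_closed[OF _ Si_linear Si_mul])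

lemma dual_antipode_inv_apply:
  "\<beta> \<in> carr D \<Longrightarrow> x \<in> carr H \<Longrightarrow> dual_antipode_inv H S \<beta> x = \<beta> (Si x)"
  by (simp add: dual_antipode_inv_eq extend0_def)

end

context bialgebra
begin

text \<open>\<open>sw3\<close> brackets to the left and \<open>swn\<close> to the right;
  coassociativity identifies them once a linear form has made the expression scalar.\<close>

lemma sw3_trilinear:
  assumes U: "lin_space U"
    and l1: "\<And>b c. b \<in> carr H \<Longrightarrow> c \<in> carr H \<Longrightarrow> linear_on H U (\<lambda>a. h a b c)"
    and l2: "\<And>a c. a \<in> carr H \<Longrightarrow> c \<in> carr H \<Longrightarrow> linear_on H U (\<lambda>b. h a b c)"
    and l3: "\<And>a b. a \<in> carr H \<Longrightarrow> b \<in> carr H \<Longrightarrow> linear_on H U (\<lambda>c. h a b c)"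
    and x: "x \<in> carr H"
  shows sw3_closed: "sw3 H h x \<in> carr U"
    and swn_form3: "linear_on U ground g \<Longrightarrow> g (sw3 H h x) = swn 2 x (\<lambda>p. g (h (p 0) (p 1) (p 2)))"
proof -
  have b1: "bilinear_on H H U (\<lambda>y1 y2. h y1 y2 z)" if "z \<in> carr H" for z
    using that by (intro bilinear_onI l1 l2)
  have b2: "bilinear_on H H U (\<lambda>y z. sw2 H (\<lambda>y1 y2. h y1 y2 z) y)"
    by (rule bilinear_onI, erule sw2_linear[OF U b1], unfold sw2_def)
      (intro linear_on_tensor_lift_param lin_space_H U comul_closed b1 l3 | assumption)+
  show "sw3 H h x \<in> carr U"
    unfolding sw3_def by (rule linear_on_closed[OF sw2_linear[OF U b2] x])
  assume g: "linear_on U ground g"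
  show "g (sw3 H h x) = swn 2 x (\<lambda>p. g (h (p 0) (p 1) (p 2)))"
    unfolding sw3_def swn_form[OF U b2 g x] using x
    by (simp add: swn_form[OF U b1 g] swn_swn)
qed

end

text \<open>The two sums over functionals stay nested; evaluation removes the inner one first and
  then the outer one.\<close>

lemma (in bij_hopf_algebra) dual_sw3_trilinear:
  assumes U: "lin_space U"
    and l1: "\<And>b c. b \<in> carr D \<Longrightarrow> c \<in> carr D \<Longrightarrow> linear_on D U (\<lambda>a. h a b c)"
    and l2: "\<And>a c. a \<in> carr D \<Longrightarrow> c \<in> carr D \<Longrightarrow> linear_on D U (\<lambda>b. h a b c)"
    and l3: "\<And>a b. a \<in> carr D \<Longrightarrow> b \<in> carr D \<Longrightarrow> linear_on D U (\<lambda>c. h a b c)"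
    and x: "x \<in> carr D"
  shows dual_sw3_closed: "sw3 D h x \<in> carr U"
    and dsw_form3: "linear_on U ground g \<Longrightarrow>
      g (sw3 D h x) = dsw x (\<lambda>y c. dsw y (\<lambda>a b. g (h a b c)))"
proof -
  have b1: "bilinear_on D D U (\<lambda>y1 y2. h y1 y2 z)" if "z \<in> carr D" for z
    using that by (intro bilinear_onI l1 l2)
  have b2: "bilinear_on D D U (\<lambda>y z. sw2 D (\<lambda>y1 y2. h y1 y2 z) y)"
    by (rule bilinear_onI, erule dual_sw2_linear[OF U b1])
      (intro linear_on_dual_sw2_param lin_space_dual U b1 l3 | assumption)+
  show "sw3 D h x \<in> carr U"
    unfolding sw3_def by (rule linear_on_closed[OF dual_sw2_linear[OF U b2] x])
  assume g: "linear_on U ground g"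
  have b3: "bilinear_on D D ground (\<lambda>y1 y2. g (h y1 y2 z))" if "z \<in> carr D" for z
    using that by (intro bilinear_onI linear_on_comp[OF g] l1 l2)
  have b4: "bilinear_on D D ground (\<lambda>y z. g (sw2 D (\<lambda>y1 y2. h y1 y2 z) y))"
    using b2 by (auto simp: bilinear_on_def intro!: linear_on_comp[OF g])
  show "g (sw3 D h x) = dsw x (\<lambda>y c. dsw y (\<lambda>a b. g (h a b c)))"
    unfolding sw3_def dual_sw2_eval[OF U b2 g x] dsw_sw2[OF b4 x] using x
    by (simp add: dual_sw2_eval[OF U b1 g] dsw_sw2[OF b3])
qed

section \<open>The Heisenberg and Drinfeld doubles\<close>

context bij_hopf_algebra
begin

abbreviation W :: "('k, ('k, 'a \<Rightarrow> 'k, 'a) tensor) space_data"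
  where "W \<equiv> tensor D H"

abbreviation tn :: "('a \<Rightarrow> 'k) \<Rightarrow> 'a \<Rightarrow> ('k, 'a \<Rightarrow> 'k, 'a) tensor"
  where "tn \<equiv> tens D H"

definition ev :: "('k, 'a \<Rightarrow> 'k, 'a) tensor \<Rightarrow> 'a \<Rightarrow> ('a \<Rightarrow> 'k) \<Rightarrow> 'k"
  where "ev t x f = tens_form D H (\<lambda>\<beta>. \<beta> x) f t"

lemma tn_closed [simp]: "\<beta> \<in> carr D \<Longrightarrow> b \<in> carr H \<Longrightarrow> tn \<beta> b \<in> carr W"
  by (rule tens_in_tensor)

lemma ev_tn [simp]:
  "linear_on H ground f \<Longrightarrow> \<beta> \<in> carr D \<Longrightarrow> b \<in> carr H \<Longrightarrow> ev (tn \<beta> b) x f = \<beta> x * f b"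
  unfolding ev_def by (rule tens_form_tens[OF eval_linear])

lemma ev_linear: "linear_on H ground f \<Longrightarrow> linear_on W ground (\<lambda>t. ev t x f)"
  unfolding ev_def by (rule tens_form_linear[OF lin_space_dual eval_linear])

lemma linear_on_ev [simp]:
  "linear_on H ground f \<Longrightarrow> linear_on V W g \<Longrightarrow> linear_on V ground (\<lambda>v. ev (g v) x f)"
  by (rule linear_on_comp[OF ev_linear])

lemma lin_space_W: "lin_space W"
  by (rule lin_space_tensor)

definition evs :: "(('k, 'a \<Rightarrow> 'k, 'a) tensor \<Rightarrow> 'k) set"
  where "evs = {\<lambda>t. ev t x f | x f. x \<in> carr H \<and> linear_on H ground f}"

lemma separating_evs: "separating W evs"
proof -
  have "evs = {tens_form D H \<phi> \<psi> |\<phi> \<psi>. \<phi> \<in> evals \<and> \<psi> \<in> {f. linear_on H ground f}}"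
    by (auto simp: evs_def evals_def ev_def[abs_def])
  then show ?thesis
    using separating_tensor[OF lin_space_dual lin_space_H separating_evals separating_forms[OF lin_space_H]]
    by simp
qed

lemma W_eqI:
  "s \<in> carr W \<Longrightarrow> t \<in> carr W \<Longrightarrow>
    (\<And>x f. x \<in> carr H \<Longrightarrow> linear_on H ground f \<Longrightarrow> ev s x f = ev t x f) \<Longrightarrow> s = t"
  by (rule separating_eqI[OF lin_space_W separating_evs]) (auto simp: evs_def)

lemma W_form_eqI:
  assumes "linear_on W ground f" "linear_on W ground g" "t \<in> carr W"
    and "\<And>\<beta> b. \<beta> \<in> carr D \<Longrightarrow> b \<in> carr H \<Longrightarrow> f (tn \<beta> b) = g (tn \<beta> b)"
  shows "f t = g t"
  by (rule tensor_linear_ext[OF lin_space_dual lin_space_ground assms(1,2,4,3)])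

lemma linear_on_W_I:
  assumes "lin_space V" "\<And>v. v \<in> carr V \<Longrightarrow> g v \<in> carr W"
    and "\<And>x f. x \<in> carr H \<Longrightarrow> linear_on H ground f \<Longrightarrow> linear_on V ground (\<lambda>v. ev (g v) x f)"
  shows "linear_on V W g"
  by (rule linear_on_eqI[OF assms(1) lin_space_W separating_evs assms(2)]) (auto simp: evs_def assms(3))

text \<open>The Heisenberg product, the Drinfeld product and the action all have this shape, so
  bilinearity and the values on pure tensors are obtained for the three at once.\<close>

definition lift4 where
  "lift4 h = (\<lambda>x y. tensor_lift D H (\<lambda>\<alpha> a. tensor_lift D H (h \<alpha> a) y) x)"

lemma lift4:
  assumes "\<And>a \<beta> b. a \<in> carr H \<Longrightarrow> \<beta> \<in> carr D \<Longrightarrow> b \<in> carr H \<Longrightarrow> linear_on D W (\<lambda>\<alpha>. h \<alpha> a \<beta> b)"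
    and "\<And>\<alpha> \<beta> b. \<alpha> \<in> carr D \<Longrightarrow> \<beta> \<in> carr D \<Longrightarrow> b \<in> carr H \<Longrightarrow> linear_on H W (\<lambda>a. h \<alpha> a \<beta> b)"
    and "\<And>\<alpha> a b. \<alpha> \<in> carr D \<Longrightarrow> a \<in> carr H \<Longrightarrow> b \<in> carr H \<Longrightarrow> linear_on D W (\<lambda>\<beta>. h \<alpha> a \<beta> b)"
    and "\<And>\<alpha> a \<beta>. \<alpha> \<in> carr D \<Longrightarrow> a \<in> carr H \<Longrightarrow> \<beta> \<in> carr D \<Longrightarrow> linear_on H W (\<lambda>b. h \<alpha> a \<beta> b)"
  shows lift4_bilinear: "bilinear_on W W W (lift4 h)"
    and lift4_tn: "\<alpha> \<in> carr D \<Longrightarrow> a \<in> carr H \<Longrightarrow> \<beta> \<in> carr D \<Longrightarrow> b \<in> carr H \<Longrightarrow>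
      lift4 h (tn \<alpha> a) (tn \<beta> b) = h \<alpha> a \<beta> b"
proof -
  have b1: "bilinear_on D H W (h \<alpha> a)" if "\<alpha> \<in> carr D" "a \<in> carr H" for \<alpha> a
    using that by (intro bilinear_onI assms)
  have b2: "bilinear_on D H W (\<lambda>\<alpha> a. tensor_lift D H (h \<alpha> a) y)" if "y \<in> carr W" for y
    by (rule bilinear_onI; rule linear_on_tensor_lift_param)
      (intro lin_space_dual lin_space_H lin_space_W that b1 assms | assumption)+
  show "bilinear_on W W W (lift4 h)"
    unfolding lift4_def
  proof (rule bilinear_onI)
    show "linear_on W W (\<lambda>x. tensor_lift D H (\<lambda>\<alpha> a. tensor_lift D H (h \<alpha> a) y) x)" if "y \<in> carr W" for y
      by (rule tensor_lift_linear[OF lin_space_dual lin_space_W b2[OF that]])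
    show "linear_on W W (\<lambda>y. tensor_lift D H (\<lambda>\<alpha> a. tensor_lift D H (h \<alpha> a) y) x)" if "x \<in> carr W" for x
      by (rule linear_on_tensor_lift_param)
        (intro lin_space_dual lin_space_W that b2 tensor_lift_linear b1 | assumption)+
  qed
  show "lift4 h (tn \<alpha> a) (tn \<beta> b) = h \<alpha> a \<beta> b"
    if "\<alpha> \<in> carr D" "a \<in> carr H" "\<beta> \<in> carr D" "b \<in> carr H"
    unfolding lift4_def using that
    by (simp add: tensor_lift_tens[OF lin_space_W b2] tensor_lift_tens[OF lin_space_W b1])
qed

lemma lreg_linear_left: "\<beta> \<in> carr D \<Longrightarrow> linear_on H D (\<lambda>b. lreg H b \<beta>)"
  by (rule linear_on_eqI[OF lin_space_H lin_space_dual separating_evals])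
    (auto simp: evals_def lreg_apply linear_on_comp[OF dual_linear]
      cong: linear_on_cong[OF _ lin_space_H])

lemma dual_linear_comp [simp]:
  "\<beta> \<in> carr D \<Longrightarrow> linear_on V H g \<Longrightarrow> linear_on V ground (\<lambda>v. \<beta> (g v))"
  by (rule linear_on_comp[OF dual_linear])

abbreviation X :: "('k, ('k, 'a \<Rightarrow> 'k, 'a) tensor) algebra_data"
  where "X \<equiv> heisenberg H"

abbreviation DD :: "('k, ('k, 'a \<Rightarrow> 'k, 'a) tensor) bialgebra_data"
  where "DD \<equiv> drinfeld H S"

lemma X_simps [simp]: "carr X = carr W" "scl X = fscale" "unt X = tn (unt D) \<one>"
  by (simp_all add: heisenberg_def)

lemma DD_simps [simp]: "carr DD = carr W" "scl DD = fscale" "unt DD = tn (unt D) \<one>"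
  by (simp_all add: drinfeld_def)

lemma W_simps [simp]: "scl W = fscale"
  by (simp add: tensor_def)

lemma linear_on_D_I:
  assumes "lin_space V" "\<And>v. v \<in> carr V \<Longrightarrow> g v \<in> carr D"
    and "\<And>x. x \<in> carr H \<Longrightarrow> linear_on V ground (\<lambda>v. g v x)"
  shows "linear_on V D g"
  by (rule linear_on_eqI[OF assms(1) lin_space_dual separating_evals assms(2)]) (auto simp: evals_def assms(3))

lemma linear_on_H_I:
  assumes "lin_space V" "\<And>v. v \<in> carr V \<Longrightarrow> g v \<in> carr H"
    and "\<And>f. linear_on H ground f \<Longrightarrow> linear_on V ground (\<lambda>v. f (g v))"
  shows "linear_on V H g"
  by (rule linear_on_eqI[OF assms(1) lin_space_H separating_forms[OF lin_space_H] assms(2)]) (auto simp: assms(3))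

lemma lreg_linear_right: "b \<in> carr H \<Longrightarrow> linear_on D D (\<lambda>\<beta>. lreg H b \<beta>)"
  by (rule linear_on_D_I) (simp_all add: lin_space_H lin_space_dual lreg_apply cong: linear_on_cong)

lemmas lreg_linear = lreg_linear_left lreg_linear_right

lemma rreg_linear_left: "\<beta> \<in> carr D \<Longrightarrow> linear_on H D (\<lambda>b. rreg H \<beta> b)"
  by (rule linear_on_D_I) (simp_all add: lin_space_H lin_space_dual rreg_apply dual_linear_comp[of \<beta> H "\<lambda>b. b \<cdot> _"] cong: linear_on_cong)

lemma rreg_linear_right: "b \<in> carr H \<Longrightarrow> linear_on D D (\<lambda>\<beta>. rreg H \<beta> b)"
  by (rule linear_on_D_I) (simp_all add: lin_space_H lin_space_dual rreg_apply cong: linear_on_cong)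

lemmas rreg_linear = rreg_linear_left rreg_linear_right

lemma coreg_linear_left: "\<mu> \<in> carr D \<Longrightarrow> linear_on H H (\<lambda>b. coreg H b \<mu>)"
  by (rule linear_on_H_I) (simp_all add: lin_space_H lin_space_dual coreg_form cong: linear_on_cong)

lemma coreg_linear_right: "b \<in> carr H \<Longrightarrow> linear_on D H (\<lambda>\<mu>. coreg H b \<mu>)"
  by (rule linear_on_H_I) (simp_all add: lin_space_H lin_space_dual coreg_form cong: linear_on_cong)

lemmas coreg_linear = coreg_linear_left coreg_linear_right

lemma dual_antipode_inv_linear: "linear_on D D (dual_antipode_inv H S)"
  by (rule linear_on_D_I) (simp_all add: lin_space_dual dual_antipode_inv_apply cong: linear_on_cong)

lemmas linear_on_dual_mul =
  bilinear_on_left[OF dual_mul_bilinear] bilinear_on_right[OF dual_mul_bilinear]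

lemmas vector_linear =
  linear_on_id linear_on_tens_left linear_on_tens_right linear_on_dual_mul
  linear_on_mul_left linear_on_mul_right linear_on_S linear_on_Si
  linear_on_comp[OF lreg_linear(1)] linear_on_comp[OF lreg_linear(2)]
  linear_on_comp[OF rreg_linear(1)] linear_on_comp[OF rreg_linear(2)]
  linear_on_comp[OF coreg_linear(1)] linear_on_comp[OF coreg_linear(2)]
  linear_on_comp[OF dual_antipode_inv_linear]

lemmas closed = mul_closed S_closed Si_closed dual_mul_closed lreg_closed rreg_closed
  coreg_closed dual_antipode_inv_closed tn_closed

definition heis_mul where
  "heis_mul \<alpha> a \<beta> b = sw2 H (\<lambda>a1 a2. tn (mul D \<alpha> (lreg H a1 \<beta>)) (a2 \<cdot> b)) a"

definition drin_mul where
  "drin_mul \<mu> m \<nu> n =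
    sw3 H (\<lambda>m1 m2 m3. tn (mul D \<mu> (rreg H (lreg H m1 \<nu>) (Si m3))) (m2 \<cdot> n)) m"

definition pure_act where
  "pure_act \<mu> m \<beta> b =
    sw3 D (\<lambda>\<mu>1 \<mu>2 \<mu>3. sw3 H (\<lambda>m1 m2 m3.
      tn (mul D (mul D \<mu>3 (lreg H m1 \<beta>)) (dual_antipode_inv H S \<mu>2))
        (coreg H ((m2 \<cdot> b) \<cdot> S m3) (dual_antipode_inv H S \<mu>1))) m) \<mu>"

lemma mul_X: "mul X = lift4 heis_mul"
  by (simp add: heisenberg_def lift4_def heis_mul_def[abs_def])

lemma mul_DD: "mul DD = lift4 drin_mul"
  by (simp add: drinfeld_def lift4_def drin_mul_def[abs_def])

lemma heis_act_lift: "heis_act H S = lift4 pure_act"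
  by (simp add: fun_eq_iff heis_act_def lift4_def pure_act_def[abs_def])

lemma heis_mul_bilinear:
  assumes "\<alpha> \<in> carr D" "\<beta> \<in> carr D" "b \<in> carr H"
  shows "bilinear_on H H W (\<lambda>a1 a2. tn (mul D \<alpha> (lreg H a1 \<beta>)) (a2 \<cdot> b))"
  using assms by (intro bilinear_onI vector_linear closed)

lemma heis_mul_closed:
  assumes "\<alpha> \<in> carr D" "a \<in> carr H" "\<beta> \<in> carr D" "b \<in> carr H"
  shows "heis_mul \<alpha> a \<beta> b \<in> carr W"
  unfolding heis_mul_def
  using linear_on_closed[OF sw2_linear[OF lin_space_W heis_mul_bilinear] assms(2)] assms by blast

text \<open>Multiplication in the dual splits x, and a' \<rightharpoonup> \<beta> evaluates \<beta>
  at x'' a'.\<close>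

lemma ev_heis_mul:
  assumes [simp]: "\<alpha> \<in> carr D" "a \<in> carr H" "\<beta> \<in> carr D" "b \<in> carr H" "x \<in> carr H"
    and f [simp]: "linear_on H ground f"
  shows "ev (heis_mul \<alpha> a \<beta> b) x f =
    swn 1 x (\<lambda>p. swn 1 a (\<lambda>q. \<alpha> (p 0) * (\<beta> (p 1 \<cdot> q 0) * f (q 1 \<cdot> b))))"
proof -
  have "ev (heis_mul \<alpha> a \<beta> b) x f =
      swn (Suc 0) a (\<lambda>q. ev (tn (mul D \<alpha> (lreg H (q 0) \<beta>)) (q (Suc 0) \<cdot> b)) x f)"
    unfolding heis_mul_def by (rule swn_form[OF lin_space_W heis_mul_bilinear]) (simp_all add: ev_linear)
  then show ?thesis
    by (simp add: dual_mul_apply lreg_apply mult.assoc swn_swap[of a x])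
qed

lemma linear_form_comp [simp]:
  "linear_on H ground f \<Longrightarrow> linear_on V H g \<Longrightarrow> linear_on V ground (\<lambda>v. f (g v))"
  by (rule linear_on_comp)

lemma heis_mul_linear1:
  "a \<in> carr H \<Longrightarrow> \<beta> \<in> carr D \<Longrightarrow> b \<in> carr H \<Longrightarrow> linear_on D W (\<lambda>\<alpha>. heis_mul \<alpha> a \<beta> b)"
  by (rule linear_on_W_I)
    (simp_all add: lin_space_dual lin_space_H heis_mul_closed ev_heis_mul cong: linear_on_cong)

lemma heis_mul_linear2:
  "\<alpha> \<in> carr D \<Longrightarrow> \<beta> \<in> carr D \<Longrightarrow> b \<in> carr H \<Longrightarrow> linear_on H W (\<lambda>a. heis_mul \<alpha> a \<beta> b)"
  by (rule linear_on_W_I)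
    (simp_all add: lin_space_dual lin_space_H heis_mul_closed ev_heis_mul cong: linear_on_cong)

lemma heis_mul_linear3:
  "\<alpha> \<in> carr D \<Longrightarrow> a \<in> carr H \<Longrightarrow> b \<in> carr H \<Longrightarrow> linear_on D W (\<lambda>\<beta>. heis_mul \<alpha> a \<beta> b)"
  by (rule linear_on_W_I)
    (simp_all add: lin_space_dual lin_space_H heis_mul_closed ev_heis_mul cong: linear_on_cong)

lemma heis_mul_linear4:
  "\<alpha> \<in> carr D \<Longrightarrow> a \<in> carr H \<Longrightarrow> \<beta> \<in> carr D \<Longrightarrow> linear_on H W (\<lambda>b. heis_mul \<alpha> a \<beta> b)"
  by (rule linear_on_W_I)
    (simp_all add: lin_space_dual lin_space_H heis_mul_closed ev_heis_mul cong: linear_on_cong)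

lemmas heis_mul_linear = heis_mul_linear1 heis_mul_linear2 heis_mul_linear3 heis_mul_linear4

lemmas X_bilinear = lift4_bilinear[OF heis_mul_linear, folded mul_X]
lemmas X_mul_tn = lift4_tn[OF heis_mul_linear, folded mul_X]

lemma drin_mul_trilinear:
  assumes "\<mu> \<in> carr D" "\<nu> \<in> carr D" "n \<in> carr H"
  shows "\<And>m2 m3. m2 \<in> carr H \<Longrightarrow> m3 \<in> carr H \<Longrightarrow> linear_on H W (\<lambda>m1. tn (mul D \<mu> (rreg H (lreg H m1 \<nu>) (Si m3))) (m2 \<cdot> n))"
    and "\<And>m1 m3. m1 \<in> carr H \<Longrightarrow> m3 \<in> carr H \<Longrightarrow> linear_on H W (\<lambda>m2. tn (mul D \<mu> (rreg H (lreg H m1 \<nu>) (Si m3))) (m2 \<cdot> n))"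
    and "\<And>m1 m2. m1 \<in> carr H \<Longrightarrow> m2 \<in> carr H \<Longrightarrow> linear_on H W (\<lambda>m3. tn (mul D \<mu> (rreg H (lreg H m1 \<nu>) (Si m3))) (m2 \<cdot> n))"
proof -
  show "\<And>m2 m3. m2 \<in> carr H \<Longrightarrow> m3 \<in> carr H \<Longrightarrow> linear_on H W (\<lambda>m1. tn (mul D \<mu> (rreg H (lreg H m1 \<nu>) (Si m3))) (m2 \<cdot> n))"
    using assms by (intro vector_linear closed)
  show "\<And>m1 m3. m1 \<in> carr H \<Longrightarrow> m3 \<in> carr H \<Longrightarrow> linear_on H W (\<lambda>m2. tn (mul D \<mu> (rreg H (lreg H m1 \<nu>) (Si m3))) (m2 \<cdot> n))"
    using assms by (intro vector_linear closed)
  show "\<And>m1 m2. m1 \<in> carr H \<Longrightarrow> m2 \<in> carr H \<Longrightarrow> linear_on H W (\<lambda>m3. tn (mul D \<mu> (rreg H (lreg H m1 \<nu>) (Si m3))) (m2 \<cdot> n))"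
    using assms by (intro vector_linear closed)
qed

lemma drin_mul_closed:
  assumes "\<mu> \<in> carr D" "m \<in> carr H" "\<nu> \<in> carr D" "n \<in> carr H"
  shows "drin_mul \<mu> m \<nu> n \<in> carr W"
  unfolding drin_mul_def
  using sw3_closed[OF lin_space_W drin_mul_trilinear[OF assms(1,3,4)] assms(2)] .

text \<open>The functional m' \<rightharpoonup> \<nu> \<leftharpoonup> \<open>Si\<close>(m''') is
  \<nu> translated on both sides: its value at y is \<nu>(\<open>Si\<close>(m''') y m').\<close>

lemma ev_drin_mul:
  assumes [simp]: "\<mu> \<in> carr D" "m \<in> carr H" "\<nu> \<in> carr D" "n \<in> carr H" "x \<in> carr H"
    and f [simp]: "linear_on H ground f"
  shows "ev (drin_mul \<mu> m \<nu> n) x f =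
    swn 1 x (\<lambda>p. swn 2 m (\<lambda>q. \<mu> (p 0) * (\<nu> (Si (q 2) \<cdot> (p 1 \<cdot> q 0)) * f (q 1 \<cdot> n))))"
proof -
  have "ev (drin_mul \<mu> m \<nu> n) x f =
      swn 2 m (\<lambda>q. ev (tn (mul D \<mu> (rreg H (lreg H (q 0) \<nu>) (Si (q 2)))) (q 1 \<cdot> n)) x f)"
    unfolding drin_mul_def
    by (rule swn_form3[OF lin_space_W drin_mul_trilinear[OF assms(1,3,4)] assms(2) ev_linear[OF f]])
  then show ?thesis
    by (simp add: dual_mul_apply lreg_apply rreg_apply mult.assoc mul_assoc swn_swap[of m x])
qed

lemma drin_mul_linear1:
  "m \<in> carr H \<Longrightarrow> \<nu> \<in> carr D \<Longrightarrow> n \<in> carr H \<Longrightarrow> linear_on D W (\<lambda>\<mu>. drin_mul \<mu> m \<nu> n)"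
  by (rule linear_on_W_I)
    (simp_all add: lin_space_dual lin_space_H drin_mul_closed ev_drin_mul cong: linear_on_cong)

lemma drin_mul_linear2:
  "\<mu> \<in> carr D \<Longrightarrow> \<nu> \<in> carr D \<Longrightarrow> n \<in> carr H \<Longrightarrow> linear_on H W (\<lambda>m. drin_mul \<mu> m \<nu> n)"
  by (rule linear_on_W_I)
    (simp_all add: lin_space_dual lin_space_H drin_mul_closed ev_drin_mul cong: linear_on_cong)

lemma drin_mul_linear3:
  "\<mu> \<in> carr D \<Longrightarrow> m \<in> carr H \<Longrightarrow> n \<in> carr H \<Longrightarrow> linear_on D W (\<lambda>\<nu>. drin_mul \<mu> m \<nu> n)"
  by (rule linear_on_W_I)
    (simp_all add: lin_space_dual lin_space_H drin_mul_closed ev_drin_mul cong: linear_on_cong)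

lemma drin_mul_linear4:
  "\<mu> \<in> carr D \<Longrightarrow> m \<in> carr H \<Longrightarrow> \<nu> \<in> carr D \<Longrightarrow> linear_on H W (\<lambda>n. drin_mul \<mu> m \<nu> n)"
  by (rule linear_on_W_I)
    (simp_all add: lin_space_dual lin_space_H drin_mul_closed ev_drin_mul cong: linear_on_cong)

lemmas drin_mul_linear = drin_mul_linear1 drin_mul_linear2 drin_mul_linear3 drin_mul_linear4

lemmas DD_bilinear = lift4_bilinear[OF drin_mul_linear, folded mul_DD]
lemmas DD_mul_tn = lift4_tn[OF drin_mul_linear, folded mul_DD]

text \<open>The sum over m is paired before the sum over \<mu>, so the three components of \<mu>
  appear as separate scalar factors, ready to be recombined. The conjugate of b keeps one unexpanded
  coproduct \<open>r\<close>; expanding it here would split m further in every later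
  formula.\<close>

lemma pure_act_inner:
  assumes "\<beta> \<in> carr D" "b \<in> carr H" "m \<in> carr H" "\<mu>1 \<in> carr D" "\<mu>2 \<in> carr D" "\<mu>3 \<in> carr D"
  defines "h \<equiv> \<lambda>\<mu>1 \<mu>2 \<mu>3 m1 m2 m3. tn (mul D (mul D \<mu>3 (lreg H m1 \<beta>)) (dual_antipode_inv H S \<mu>2))
        (coreg H ((m2 \<cdot> b) \<cdot> S m3) (dual_antipode_inv H S \<mu>1))"
  shows "sw3 H (h \<mu>1 \<mu>2 \<mu>3) m \<in> carr W"
    and "x \<in> carr H \<Longrightarrow> linear_on H ground f \<Longrightarrow> ev (sw3 H (h \<mu>1 \<mu>2 \<mu>3) m) x f =
      swn 2 x (\<lambda>p. swn 2 m (\<lambda>q. swn 1 (q 1 \<cdot> (b \<cdot> S (q 2)))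
        (\<lambda>r. \<mu>3 (p 0) * (\<beta> (p 1 \<cdot> q 0) * (\<mu>2 (Si (p 2)) * (\<mu>1 (Si (r 0)) * f (r 1)))))))"
proof -
  note [simp] = assms(1-6)
  have l: "\<And>m2 m3. m2 \<in> carr H \<Longrightarrow> m3 \<in> carr H \<Longrightarrow> linear_on H W (\<lambda>m1. h \<mu>1 \<mu>2 \<mu>3 m1 m2 m3)"
    "\<And>m1 m3. m1 \<in> carr H \<Longrightarrow> m3 \<in> carr H \<Longrightarrow> linear_on H W (\<lambda>m2. h \<mu>1 \<mu>2 \<mu>3 m1 m2 m3)"
    "\<And>m1 m2. m1 \<in> carr H \<Longrightarrow> m2 \<in> carr H \<Longrightarrow> linear_on H W (\<lambda>m3. h \<mu>1 \<mu>2 \<mu>3 m1 m2 m3)"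
    unfolding h_def by (intro vector_linear closed assms | assumption)+
  show "sw3 H (h \<mu>1 \<mu>2 \<mu>3) m \<in> carr W"
    by (rule sw3_closed[OF lin_space_W l]) simp_all
  assume x [simp]: "x \<in> carr H" and f [simp]: "linear_on H ground f"
  have "ev (sw3 H (h \<mu>1 \<mu>2 \<mu>3) m) x f = swn 2 m (\<lambda>q. ev (h \<mu>1 \<mu>2 \<mu>3 (q 0) (q 1) (q 2)) x f)"
    by (rule swn_form3[OF lin_space_W l _ ev_linear]) simp_all
  \<comment> \<open>The product of three functionals is bracketed to the left, so x is split first
    and then its first component.\<close>
  also have "\<dots> = swn 2 m (\<lambda>q. swn 1 x (\<lambda>p. swn 1 (p 0) (\<lambda>p'. \<mu>3 (p' 0) * \<beta> (p' 1 \<cdot> q 0)) * \<mu>2 (Si (p 1))) *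
      swn 1 (q 1 \<cdot> (b \<cdot> S (q 2))) (\<lambda>r. \<mu>1 (Si (r 0)) * f (r 1)))"
    by (simp add: h_def dual_mul_apply lreg_apply dual_antipode_inv_apply coreg_form mul_assoc
        del: swn1_mul swn_mult_left' swn_mult_right')
  also have "\<dots> = swn 2 x (\<lambda>p. swn 2 m (\<lambda>q. swn 1 (q 1 \<cdot> (b \<cdot> S (q 2)))
        (\<lambda>r. \<mu>3 (p 0) * (\<beta> (p 1 \<cdot> q 0) * (\<mu>2 (Si (p 2)) * (\<mu>1 (Si (r 0)) * f (r 1)))))))"
    by (simp add: swn_swn mult.assoc swn_swap[of c x for c] del: swn1_mul)
  finally show "ev (sw3 H (h \<mu>1 \<mu>2 \<mu>3) m) x f =
      swn 2 x (\<lambda>p. swn 2 m (\<lambda>q. swn 1 (q 1 \<cdot> (b \<cdot> S (q 2)))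
        (\<lambda>r. \<mu>3 (p 0) * (\<beta> (p 1 \<cdot> q 0) * (\<mu>2 (Si (p 2)) * (\<mu>1 (Si (r 0)) * f (r 1)))))))" .
qed

end

text \<open>The counit law for a counit that stands behind a constant factor of a right-associated
  product of scalars.\<close>

lemma (in bialgebra) swn_eps_left [simp]:
  assumes "x \<in> carr H" "0 < N" "i \<le> N"
    and "\<And>p p'. (\<And>j. p j \<in> carr H) \<Longrightarrow> (\<And>j. p' j \<in> carr H) \<Longrightarrow>
      \<forall>j\<le>N. j \<noteq> i \<longrightarrow> p j = p' j \<Longrightarrow> L p = L p'"
    and "N = Suc 0 \<Longrightarrow> linear_on H ground (\<lambda>v. L (\<lambda>_. v))"
  shows "swn N x (\<lambda>p. c * (\<epsilon> (p i) * L p)) =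
    swn (N - 1) x (\<lambda>p. c * L (\<lambda>j. if j < i then p j else p (j - 1)))"
  using swn_eps[OF assms] assms(1) by (simp only: swn_mult_left)

context bij_hopf_algebra
begin

text \<open>Constants between the two components of a functional are moved out, so that the
  components become neighbours and can be evaluated together.\<close>

lemma dsw_pull:
  assumes "\<beta> \<in> carr D"
  shows "dsw \<beta> (\<lambda>\<alpha> \<gamma>. \<alpha> x * (c * F \<alpha> \<gamma>)) = c * dsw \<beta> (\<lambda>\<alpha> \<gamma>. \<alpha> x * F \<alpha> \<gamma>)"
    and "dsw \<beta> (\<lambda>\<alpha> \<gamma>. \<gamma> x * (c * F \<alpha> \<gamma>)) = c * dsw \<beta> (\<lambda>\<alpha> \<gamma>. \<gamma> x * F \<alpha> \<gamma>)"
  using assms by (simp_all add: mult.left_commute[of _ c] dsw_mult_left)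

lemma dsw_evals:
  assumes "\<beta> \<in> carr D" "x \<in> carr H" "y \<in> carr H"
  shows "dsw \<beta> (\<lambda>\<alpha> \<gamma>. \<alpha> x * (\<gamma> y * c)) = \<beta> (x \<cdot> y) * c"
    and "dsw \<beta> (\<lambda>\<alpha> \<gamma>. \<gamma> y * (\<alpha> x * c)) = \<beta> (x \<cdot> y) * c"
    and "dsw \<beta> (\<lambda>\<alpha> \<gamma>. \<gamma> y * \<alpha> x) = \<beta> (x \<cdot> y)"
proof -
  show 1: "dsw \<beta> (\<lambda>\<alpha> \<gamma>. \<alpha> x * (\<gamma> y * c)) = \<beta> (x \<cdot> y) * c"
    using assms by (simp add: mult.assoc[symmetric] dsw_mult_right dsw_eval)
  show "dsw \<beta> (\<lambda>\<alpha> \<gamma>. \<gamma> y * (\<alpha> x * c)) = \<beta> (x \<cdot> y) * c"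
    unfolding mult.left_commute[of _ "_ x" c] by (rule 1)
  show "dsw \<beta> (\<lambda>\<alpha> \<gamma>. \<gamma> y * \<alpha> x) = \<beta> (x \<cdot> y)"
    unfolding mult.commute[of "_ y"] by (rule dsw_eval[OF assms])
qed

lemmas dsw_simps = dsw_swn dsw_mult_left dsw_pull dsw_eval dsw_evals

lemma linear_on_dsw [simp]:
  assumes "\<beta> \<in> carr D" "\<And>\<alpha> \<gamma>. \<alpha> \<in> carr D \<Longrightarrow> \<gamma> \<in> carr D \<Longrightarrow> linear_on V ground (\<lambda>v. F v \<alpha> \<gamma>)"
  shows "linear_on V ground (\<lambda>v. dsw \<beta> (\<lambda>\<alpha> \<gamma>. F v \<alpha> \<gamma>))"
  using assms by (rule linear_on_dsw_param)

lemma pure_act_trilinear: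
  assumes "\<beta> \<in> carr D" "b \<in> carr H" "m \<in> carr H"
  defines "h \<equiv> \<lambda>\<mu>1 \<mu>2 \<mu>3. sw3 H (\<lambda>m1 m2 m3. tn (mul D (mul D \<mu>3 (lreg H m1 \<beta>)) (dual_antipode_inv H S \<mu>2))
        (coreg H ((m2 \<cdot> b) \<cdot> S m3) (dual_antipode_inv H S \<mu>1))) m"
  shows "\<And>\<mu>2 \<mu>3. \<mu>2 \<in> carr D \<Longrightarrow> \<mu>3 \<in> carr D \<Longrightarrow> linear_on D W (\<lambda>\<mu>1. h \<mu>1 \<mu>2 \<mu>3)"
    and "\<And>\<mu>1 \<mu>3. \<mu>1 \<in> carr D \<Longrightarrow> \<mu>3 \<in> carr D \<Longrightarrow> linear_on D W (\<lambda>\<mu>2. h \<mu>1 \<mu>2 \<mu>3)"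
    and "\<And>\<mu>1 \<mu>2. \<mu>1 \<in> carr D \<Longrightarrow> \<mu>2 \<in> carr D \<Longrightarrow> linear_on D W (\<lambda>\<mu>3. h \<mu>1 \<mu>2 \<mu>3)"
proof -
  note facts = pure_act_inner[OF assms(1-3)]
  note [simp] = assms(1-3)
  show "linear_on D W (\<lambda>\<mu>1. h \<mu>1 \<mu>2 \<mu>3)" if "\<mu>2 \<in> carr D" "\<mu>3 \<in> carr D" for \<mu>2 \<mu>3
    unfolding h_def using that
    by (intro linear_on_W_I) (simp_all add: lin_space_dual facts cong: linear_on_cong del: swn1_mul)
  show "linear_on D W (\<lambda>\<mu>2. h \<mu>1 \<mu>2 \<mu>3)" if "\<mu>1 \<in> carr D" "\<mu>3 \<in> carr D" for \<mu>1 \<mu>3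
    unfolding h_def using that
    by (intro linear_on_W_I) (simp_all add: lin_space_dual facts cong: linear_on_cong del: swn1_mul)
  show "linear_on D W (\<lambda>\<mu>3. h \<mu>1 \<mu>2 \<mu>3)" if "\<mu>1 \<in> carr D" "\<mu>2 \<in> carr D" for \<mu>1 \<mu>2
    unfolding h_def using that
    by (intro linear_on_W_I) (simp_all add: lin_space_dual facts cong: linear_on_cong del: swn1_mul)
qed

lemma pure_act_closed:
  assumes "\<mu> \<in> carr D" "m \<in> carr H" "\<beta> \<in> carr D" "b \<in> carr H"
  shows "pure_act \<mu> m \<beta> b \<in> carr W"
  unfolding pure_act_def
  by (rule dual_sw3_closed[OF lin_space_W pure_act_trilinear[OF assms(3,4,2)] assms(1)])

text \<open>The functional parts contribute \<mu>'''(x'), \<mu>''(\<open>Si\<close>(x''')) and,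
  through the coregular action, \<mu>'(\<open>Si\<close>(c')) for the conjugate c. Taken in the
  order \<mu>', \<mu>'', \<mu>''' they are one value of \<mu> at a product, and no sum over \<mu>
  remains.\<close>

lemma ev_pure_act:
  assumes [simp]: "\<mu> \<in> carr D" "m \<in> carr H" "\<beta> \<in> carr D" "b \<in> carr H" "x \<in> carr H"
    and f [simp]: "linear_on H ground f"
  shows "ev (pure_act \<mu> m \<beta> b) x f =
    swn 2 x (\<lambda>p. swn 2 m (\<lambda>q. swn 1 (q 1 \<cdot> (b \<cdot> S (q 2)))
      (\<lambda>r. \<mu> (Si (r 0) \<cdot> (Si (p 2) \<cdot> p 0)) * (\<beta> (p 1 \<cdot> q 0) * f (r 1)))))"
  unfolding pure_act_def
  by (subst dsw_form3[OF lin_space_W pure_act_trilinear[OF assms(3,4,2)] assms(1) ev_linear[OF f]])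
    (simp_all add: pure_act_inner(2) dsw_simps mul_assoc mult_ac del: swn1_mul)

lemma pure_act_linear1:
  "m \<in> carr H \<Longrightarrow> \<beta> \<in> carr D \<Longrightarrow> b \<in> carr H \<Longrightarrow> linear_on D W (\<lambda>\<mu>. pure_act \<mu> m \<beta> b)"
  by (rule linear_on_W_I)
    (simp_all add: lin_space_dual lin_space_H pure_act_closed ev_pure_act cong: linear_on_cong del: swn1_mul)

lemma pure_act_linear2:
  "\<mu> \<in> carr D \<Longrightarrow> \<beta> \<in> carr D \<Longrightarrow> b \<in> carr H \<Longrightarrow> linear_on H W (\<lambda>m. pure_act \<mu> m \<beta> b)"
  by (rule linear_on_W_I)
    (simp_all add: lin_space_dual lin_space_H pure_act_closed ev_pure_act cong: linear_on_cong del: swn1_mul)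

lemma pure_act_linear3:
  "\<mu> \<in> carr D \<Longrightarrow> m \<in> carr H \<Longrightarrow> b \<in> carr H \<Longrightarrow> linear_on D W (\<lambda>\<beta>. pure_act \<mu> m \<beta> b)"
  by (rule linear_on_W_I)
    (simp_all add: lin_space_dual lin_space_H pure_act_closed ev_pure_act cong: linear_on_cong del: swn1_mul)

lemma pure_act_linear4:
  "\<mu> \<in> carr D \<Longrightarrow> m \<in> carr H \<Longrightarrow> \<beta> \<in> carr D \<Longrightarrow> linear_on H W (\<lambda>b. pure_act \<mu> m \<beta> b)"
  by (rule linear_on_W_I)
    (simp_all add: lin_space_dual lin_space_H pure_act_closed ev_pure_act cong: linear_on_cong del: swn1_mul)

lemmas pure_act_linear = pure_act_linear1 pure_act_linear2 pure_act_linear3 pure_act_linear4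

abbreviation act where "act \<equiv> heis_act H S"

lemmas act_bilinear = lift4_bilinear[OF pure_act_linear, folded heis_act_lift]
lemmas act_tn = lift4_tn[OF pure_act_linear, folded heis_act_lift]

lemmas linear_on_products =
  bilinear_on_left[OF X_bilinear] bilinear_on_right[OF X_bilinear]
  bilinear_on_left[OF DD_bilinear] bilinear_on_right[OF DD_bilinear]
  bilinear_on_left[OF act_bilinear] bilinear_on_right[OF act_bilinear]

declare linear_on_products [simp]

lemma bilinear_on_closed: "bilinear_on V U Z h \<Longrightarrow> a \<in> carr V \<Longrightarrow> b \<in> carr U \<Longrightarrow> h a b \<in> carr Z"
  by (auto simp: bilinear_on_def linear_on_def)

lemmas product_closed [simp] =
  bilinear_on_closed[OF X_bilinear] bilinear_on_closed[OF DD_bilinear] bilinear_on_closed[OF act_bilinear]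

text \<open>Multiplying by a pure tensor shifts the point and the form with which the arbitrary
  factor \<open>t\<close> is tested. Iterated products thus unfold one factor at a time, without
  expanding intermediate results into pure tensors.\<close>

lemma ev_X:
  assumes [simp]: "\<alpha> \<in> carr D" "a \<in> carr H" "t \<in> carr W" "x \<in> carr H"
    and f [simp]: "linear_on H ground f"
  shows "ev (mul X (tn \<alpha> a) t) x f =
    swn 1 x (\<lambda>p. swn 1 a (\<lambda>q. \<alpha> (p 0) * ev t (p 1 \<cdot> q 0) (\<lambda>b. f (q 1 \<cdot> b))))"
  by (rule W_form_eqI[OF _ _ assms(3)]) (simp_all add: X_mul_tn ev_heis_mul)

lemma ev_X':
  assumes [simp]: "s \<in> carr W" "\<beta> \<in> carr D" "b \<in> carr H" "x \<in> carr H"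
    and f [simp]: "linear_on H ground f"
  shows "ev (mul X s (tn \<beta> b)) x f =
    swn 1 x (\<lambda>p. ev s (p 0) (\<lambda>a. swn 1 a (\<lambda>q. \<beta> (p 1 \<cdot> q 0) * f (q 1 \<cdot> b))))"
  by (rule W_form_eqI[OF _ _ assms(1)]) (simp_all add: X_mul_tn ev_heis_mul)

lemma ev_DD:
  assumes [simp]: "\<mu> \<in> carr D" "m \<in> carr H" "t \<in> carr W" "x \<in> carr H"
    and f [simp]: "linear_on H ground f"
  shows "ev (mul DD (tn \<mu> m) t) x f =
    swn 1 x (\<lambda>p. swn 2 m (\<lambda>q. \<mu> (p 0) * ev t (Si (q 2) \<cdot> (p 1 \<cdot> q 0)) (\<lambda>n. f (q 1 \<cdot> n))))"
  by (rule W_form_eqI[OF _ _ assms(3)]) (simp_all add: DD_mul_tn ev_drin_mul)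

lemma ev_DD':
  assumes [simp]: "s \<in> carr W" "\<nu> \<in> carr D" "n \<in> carr H" "x \<in> carr H"
    and f [simp]: "linear_on H ground f"
  shows "ev (mul DD s (tn \<nu> n)) x f =
    swn 1 x (\<lambda>p. ev s (p 0) (\<lambda>m. swn 2 m (\<lambda>q. \<nu> (Si (q 2) \<cdot> (p 1 \<cdot> q 0)) * f (q 1 \<cdot> n))))"
  by (rule W_form_eqI[OF _ _ assms(1)]) (simp_all add: DD_mul_tn ev_drin_mul)

lemma ev_act:
  assumes [simp]: "\<mu> \<in> carr D" "m \<in> carr H" "t \<in> carr W" "x \<in> carr H"
    and f [simp]: "linear_on H ground f"
  shows "ev (act (tn \<mu> m) t) x f =
    swn 2 x (\<lambda>p. swn 2 m (\<lambda>q. ev t (p 1 \<cdot> q 0) (\<lambda>b. swn 1 (q 1 \<cdot> (b \<cdot> S (q 2)))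
      (\<lambda>r. \<mu> (Si (r 0) \<cdot> (Si (p 2) \<cdot> p 0)) * f (r 1)))))"
  by (rule W_form_eqI[OF _ _ assms(3)])
    (simp_all add: act_tn ev_pure_act mult.left_commute[of "\<mu> _"] del: swn1_mul)

section \<open>Associativity and units of the two doubles\<close>

lemma W_trilinear_eqI:
  assumes U: "lin_space U"
    and F: "\<And>t u. t \<in> carr W \<Longrightarrow> u \<in> carr W \<Longrightarrow> linear_on W U (\<lambda>s. F s t u)"
      "\<And>s u. s \<in> carr W \<Longrightarrow> u \<in> carr W \<Longrightarrow> linear_on W U (\<lambda>t. F s t u)"
      "\<And>s t. s \<in> carr W \<Longrightarrow> t \<in> carr W \<Longrightarrow> linear_on W U (\<lambda>u. F s t u)"
    and G: "\<And>t u. t \<in> carr W \<Longrightarrow> u \<in> carr W \<Longrightarrow> linear_on W U (\<lambda>s. G s t u)"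
      "\<And>s u. s \<in> carr W \<Longrightarrow> u \<in> carr W \<Longrightarrow> linear_on W U (\<lambda>t. G s t u)"
      "\<And>s t. s \<in> carr W \<Longrightarrow> t \<in> carr W \<Longrightarrow> linear_on W U (\<lambda>u. G s t u)"
    and eq: "\<And>\<alpha> a \<beta> b \<gamma> c. \<alpha> \<in> carr D \<Longrightarrow> a \<in> carr H \<Longrightarrow> \<beta> \<in> carr D \<Longrightarrow> b \<in> carr H \<Longrightarrow>
      \<gamma> \<in> carr D \<Longrightarrow> c \<in> carr H \<Longrightarrow> F (tn \<alpha> a) (tn \<beta> b) (tn \<gamma> c) = G (tn \<alpha> a) (tn \<beta> b) (tn \<gamma> c)"
    and mem: "s \<in> carr W" "t \<in> carr W" "u \<in> carr W"
  shows "F s t u = G s t u"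
proof -
  note ext = tensor_linear_ext[OF lin_space_dual U]
  have 1: "F (tn \<alpha> a) (tn \<beta> b) u = G (tn \<alpha> a) (tn \<beta> b) u"
    if "\<alpha> \<in> carr D" "a \<in> carr H" "\<beta> \<in> carr D" "b \<in> carr H" for \<alpha> a \<beta> b
    by (rule ext[OF F(3) G(3) _ mem(3)]) (simp_all add: that eq)
  have 2: "F (tn \<alpha> a) t u = G (tn \<alpha> a) t u" if "\<alpha> \<in> carr D" "a \<in> carr H" for \<alpha> a
    by (rule ext[OF F(2) G(2) _ mem(2)]) (simp_all add: that 1 mem)
  show ?thesis
    by (rule ext[OF F(1) G(1) _ mem(1)]) (simp_all add: 2 mem)
qed

lemma dual_unt_eval [simp]: "x \<in> carr H \<Longrightarrow> unt D x = \<epsilon> x"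
  by (rule dual_unt_apply)

text \<open>Both sides pair to \<alpha>(x') \<beta>(x'' a') \<gamma>(x''' a'' b') f(a''' b''
  c).\<close>

lemma X_assoc:
  assumes "s \<in> carr W" "t \<in> carr W" "u \<in> carr W"
  shows "mul X (mul X s t) u = mul X s (mul X t u)"
proof (rule W_trilinear_eqI[OF lin_space_W _ _ _ _ _ _ _ assms])
  fix \<alpha> a \<beta> b \<gamma> c
  assume [simp]: "\<alpha> \<in> carr D" "a \<in> carr H" "\<beta> \<in> carr D" "b \<in> carr H" "\<gamma> \<in> carr D" "c \<in> carr H"
  note [simp] = dual_linear_comp[of \<alpha>] dual_linear_comp[of \<beta>] dual_linear_comp[of \<gamma>]
  show "mul X (mul X (tn \<alpha> a) (tn \<beta> b)) (tn \<gamma> c) = mul X (tn \<alpha> a) (mul X (tn \<beta> b) (tn \<gamma> c))"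
  proof (rule W_eqI)
    fix x f assume [simp]: "x \<in> carr H" and f [simp]: "linear_on H ground f"
    note [simp] = linear_form_comp[OF f]
    show "ev (mul X (mul X (tn \<alpha> a) (tn \<beta> b)) (tn \<gamma> c)) x f =
        ev (mul X (tn \<alpha> a) (mul X (tn \<beta> b) (tn \<gamma> c))) x f"
      by (simp add: ev_X' ev_X swn_swn mul_assoc mult.assoc swn_swap[of a c for c])
  qed simp_all
qed simp_all

lemma X_unit:
  assumes t: "t \<in> carr W"
  shows "mul X (tn (unt D) \<one>) t = t" "mul X t (tn (unt D) \<one>) = t"
proof -
  have 1: "mul X (tn (unt D) \<one>) (tn \<beta> b) = tn \<beta> b" "mul X (tn \<beta> b) (tn (unt D) \<one>) = tn \<beta> b"
    if [simp]: "\<beta> \<in> carr D" "b \<in> carr H" for \<beta> b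
  proof -
    note [simp] = dual_linear_comp[of \<beta>] linear_form_eps
    show "mul X (tn (unt D) \<one>) (tn \<beta> b) = tn \<beta> b"
    proof (rule W_eqI)
      fix x f assume [simp]: "x \<in> carr H" and f [simp]: "linear_on H ground f"
      note [simp] = linear_form_comp[OF f]
      show "ev (mul X (tn (unt D) \<one>) (tn \<beta> b)) x f = ev (tn \<beta> b) x f"
        by (simp add: ev_X swn1_one unt_left unt_right)
    qed simp_all
    show "mul X (tn \<beta> b) (tn (unt D) \<one>) = tn \<beta> b"
    proof (rule W_eqI)
      fix x f assume [simp]: "x \<in> carr H" and f [simp]: "linear_on H ground f"
      note [simp] = linear_form_comp[OF f]
      show "ev (mul X (tn \<beta> b) (tn (unt D) \<one>)) x f = ev (tn \<beta> b) x f"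
        by (simp add: ev_X unt_left unt_right counit_mul mult.assoc mult.left_commute[of "\<beta> _" "\<epsilon> _"])
    qed simp_all
  qed
  show "mul X (tn (unt D) \<one>) t = t"
    by (rule tensor_linear_ext[OF lin_space_dual lin_space_W _ linear_on_id _ t]) (simp_all add: 1)
  show "mul X t (tn (unt D) \<one>) = t"
    by (rule tensor_linear_ext[OF lin_space_dual lin_space_W _ linear_on_id _ t]) (simp_all add: 1)
qed

text \<open>Both sides pair to \<mu>(x') \<nu>(\<open>Si\<close>(m5) x'' m1)
  \<rho>(\<open>Si\<close>(n3) \<open>Si\<close>(m4) x''' m2 n1) f(m3 n2 r), with m1 to m5 and n1 to
  n3 the components of m and n. That \<open>Si\<close> reverses products and coproducts puts m4 and
  m5 into this order.\<close>

lemma DD_assoc: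
  assumes "s \<in> carr W" "t \<in> carr W" "u \<in> carr W"
  shows "mul DD (mul DD s t) u = mul DD s (mul DD t u)"
proof (rule W_trilinear_eqI[OF lin_space_W _ _ _ _ _ _ _ assms])
  fix \<mu> m \<nu> n \<rho> r
  assume [simp]: "\<mu> \<in> carr D" "m \<in> carr H" "\<nu> \<in> carr D" "n \<in> carr H" "\<rho> \<in> carr D" "r \<in> carr H"
  note [simp] = dual_linear_comp[of \<mu>] dual_linear_comp[of \<nu>] dual_linear_comp[of \<rho>]
  show "mul DD (mul DD (tn \<mu> m) (tn \<nu> n)) (tn \<rho> r) = mul DD (tn \<mu> m) (mul DD (tn \<nu> n) (tn \<rho> r))"
  proof (rule W_eqI)
    fix x f assume [simp]: "x \<in> carr H" and f [simp]: "linear_on H ground f"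
    note [simp] = linear_form_comp[OF f]
    show "ev (mul DD (mul DD (tn \<mu> m) (tn \<nu> n)) (tn \<rho> r)) x f =
        ev (mul DD (tn \<mu> m) (mul DD (tn \<nu> n) (tn \<rho> r))) x f"
      by (simp add: ev_DD' ev_DD swn_swn mul_assoc Si_mul mult.assoc swn_swap[of m c for c])
  qed simp_all
qed simp_all

section \<open>The Hopf algebra structure of the Drinfeld double\<close>

lemma DD_unit:
  assumes t: "t \<in> carr W"
  shows "mul DD (tn (unt D) \<one>) t = t" "mul DD t (tn (unt D) \<one>) = t"
proof -
  have 1: "mul DD (tn (unt D) \<one>) (tn \<beta> b) = tn \<beta> b" "mul DD (tn \<beta> b) (tn (unt D) \<one>) = tn \<beta> b"
    if [simp]: "\<beta> \<in> carr D" "b \<in> carr H" for \<beta> b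
  proof -
    note [simp] = dual_linear_comp[of \<beta>] linear_form_eps
    show "mul DD (tn (unt D) \<one>) (tn \<beta> b) = tn \<beta> b"
    proof (rule W_eqI)
      fix x f assume [simp]: "x \<in> carr H" and f [simp]: "linear_on H ground f"
      note [simp] = linear_form_comp[OF f]
      have "swn 2 \<one> (\<lambda>q. \<beta> (Si (q 2) \<cdot> (y \<cdot> q 0)) * f (q 1 \<cdot> b)) = \<beta> y * f b" if [simp]: "y \<in> carr H" for y
      proof -
        have "swn 2 \<one> (\<lambda>q. \<beta> (Si (q 2) \<cdot> (y \<cdot> q 0)) * f (q 1 \<cdot> b)) =
            \<beta> (Si \<one> \<cdot> (y \<cdot> \<one>)) * f (\<one> \<cdot> b)"
        proof (rule swn_one)
          fix p :: "nat \<Rightarrow> 'a" and i :: nat assume [simp]: "\<And>j. p j \<in> carr H" and "i \<le> 2"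
          then consider "i = 0" | "i = Suc 0" | "i = 2" by linarith
          then show "linear_on H ground (\<lambda>a. \<beta> (Si ((p(i := a)) 2) \<cdot> (y \<cdot> (p(i := a)) 0)) * f ((p(i := a)) 1 \<cdot> b))"
            by cases simp_all
        qed simp
        then show ?thesis by (simp add: Si_one unt_left unt_right)
      qed
      then have "swn 2 \<one> (\<lambda>q. c * (\<beta> (Si (q 2) \<cdot> (y \<cdot> q 0)) * f (q 1 \<cdot> b))) = c * (\<beta> y * f b)"
        if "y \<in> carr H" for y c
        using that by (simp only: swn_mult_left one_closed)
      then show "ev (mul DD (tn (unt D) \<one>) (tn \<beta> b)) x f = ev (tn \<beta> b) x f"
        by (simp add: ev_DD)
    qed simp_all
    show "mul DD (tn \<beta> b) (tn (unt D) \<one>) = tn \<beta> b"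
    proof (rule W_eqI)
      fix x f assume [simp]: "x \<in> carr H" and f [simp]: "linear_on H ground f"
      note [simp] = linear_form_comp[OF f]
      show "ev (mul DD (tn \<beta> b) (tn (unt D) \<one>)) x f = ev (tn \<beta> b) x f"
        by (simp add: ev_DD unt_left unt_right counit_mul counit_Si mult.assoc
            mult.left_commute[of "\<beta> _" "\<epsilon> _"])
    qed simp_all
  qed
  show "mul DD (tn (unt D) \<one>) t = t"
    by (rule tensor_linear_ext[OF lin_space_dual lin_space_W _ linear_on_id _ t]) (simp_all add: 1)
  show "mul DD t (tn (unt D) \<one>) = t"
    by (rule tensor_linear_ext[OF lin_space_dual lin_space_W _ linear_on_id _ t]) (simp_all add: 1)
qed

lemma lin_space_of_W: "carr V = carr W \<Longrightarrow> scl V = fscale \<Longrightarrow> lin_space V"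
  using lin_space_W by (simp add: lin_space_def)

lemma bilinear_of_W:
  "carr V = carr W \<Longrightarrow> scl V = fscale \<Longrightarrow> bilinear_on V V V h \<longleftrightarrow> bilinear_on W W W h"
  by (simp add: bilinear_on_def linear_on_def)

lemma k_algebra_X: "k_algebra X"
  by (simp add: k_algebra_def k_algebra_axioms_def lin_space_of_W bilinear_of_W[of X] X_bilinear X_assoc X_unit)

lemma k_algebra_DD: "k_algebra DD"
  by (simp add: k_algebra_def k_algebra_axioms_def lin_space_of_W bilinear_of_W[of DD] DD_bilinear DD_assoc DD_unit)

section \<open>Coproduct and counit of the Drinfeld double\<close>

abbreviation WW where "WW \<equiv> tensor W W"

lemma WW_cong:
  assumes "carr V = carr W" "scl V = fscale" "carr V' = carr W" "scl V' = fscale"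
  shows "tensor V V' = WW" "tens V V' = tens W W" "tensor_lift V V' = tensor_lift W W"
proof -
  show "tensor V V' = WW" "tens V V' = tens W W"
    by (intro tensor_space_cong tens_space_cong; simp add: assms)+
  show "tensor_lift V V' = tensor_lift W W"
    by (intro ext tensor_lift_space_cong; simp add: assms)
qed

lemmas double_space_cong [simp] = WW_cong[of DD DD, simplified] WW_cong[of DD X, simplified]

definition pure_comul where
  "pure_comul \<mu> m = sw2 D (\<lambda>\<mu>1 \<mu>2. sw2 H (\<lambda>m1 m2. tens W W (tn \<mu>2 m1) (tn \<mu>1 m2)) m) \<mu>"

lemma comul_DD: "comul DD = tensor_lift D H pure_comul"
  by (simp add: drinfeld_def pure_comul_def[abs_def])

text \<open>The two doubles differ in their products only; their spaces, and hence the tensor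
  products formed from them, coincide.\<close>

lemma heis_coact_eq: "heis_coact H S = comul DD"
  by (simp add: comul_DD heis_coact_def pure_comul_def[abs_def])

lemma pure_comul_inner:
  assumes "\<mu>1 \<in> carr D" "\<mu>2 \<in> carr D"
  shows "bilinear_on H H WW (\<lambda>m1 m2. tens W W (tn \<mu>2 m1) (tn \<mu>1 m2))"
  using assms by (intro bilinear_onI vector_linear closed)

lemma pure_comul_outer:
  assumes m: "m \<in> carr H"
  shows "bilinear_on D D WW (\<lambda>\<mu>1 \<mu>2. sw2 H (\<lambda>m1 m2. tens W W (tn \<mu>2 m1) (tn \<mu>1 m2)) m)"
  unfolding sw2_def using m
  by (intro bilinear_onI linear_on_tensor_lift_param lin_space_dual lin_space_H lin_space_tensor
      comul_closed pure_comul_inner vector_linear closed)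

lemma pure_comul_bilinear: "bilinear_on D H WW pure_comul"
proof (rule bilinear_onI)
  show "linear_on D WW (\<lambda>\<mu>. pure_comul \<mu> m)" if "m \<in> carr H" for m
    unfolding pure_comul_def by (intro dual_sw2_linear lin_space_tensor pure_comul_outer that)
  show "linear_on H WW (pure_comul \<mu>)" if "\<mu> \<in> carr D" for \<mu>
    unfolding pure_comul_def
    by (intro linear_on_dual_sw2_param lin_space_H lin_space_tensor pure_comul_outer that sw2_linear pure_comul_inner)
qed

lemma comul_DD_linear: "linear_on W WW (comul DD)"
  unfolding comul_DD by (intro tensor_lift_linear lin_space_dual lin_space_tensor pure_comul_bilinear)

lemma comul_DD_closed [simp]: "t \<in> carr W \<Longrightarrow> comul DD t \<in> carr WW"
  by (rule linear_on_closed[OF comul_DD_linear])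

lemma comul_DD_tn:
  assumes F: "bilinear_on W W ground F" and \<mu> [simp]: "\<mu> \<in> carr D" and m [simp]: "m \<in> carr H"
  shows "tensor_lift W W F (comul DD (tn \<mu> m)) =
    dsw \<mu> (\<lambda>\<mu>1 \<mu>2. swn 1 m (\<lambda>p. F (tn \<mu>2 (p 0)) (tn \<mu>1 (p 1))))"
proof -
  have l: "linear_on WW ground (tensor_lift W W F)"
    by (intro tensor_lift_linear lin_space_W lin_space_ground F)
  let ?h = "\<lambda>\<mu>1 \<mu>2. sw2 H (\<lambda>m1 m2. tens W W (tn \<mu>2 m1) (tn \<mu>1 m2)) m"
  have b: "bilinear_on D D ground (\<lambda>\<mu>1 \<mu>2. tensor_lift W W F (?h \<mu>1 \<mu>2))"
    using pure_comul_outer[OF m] by (auto simp: bilinear_on_def intro!: linear_on_comp[OF l])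
  have "tensor_lift W W F (comul DD (tn \<mu> m)) = dsw \<mu> (\<lambda>\<mu>1 \<mu>2. tensor_lift W W F (?h \<mu>1 \<mu>2))"
    unfolding comul_DD tensor_lift_tens[OF lin_space_tensor pure_comul_bilinear \<mu> m] pure_comul_def
      dual_sw2_eval[OF lin_space_tensor pure_comul_outer[OF m] l \<mu>]
    by (rule dsw_sw2[OF b \<mu>])
  also have "\<dots> = dsw \<mu> (\<lambda>\<mu>1 \<mu>2. swn 1 m (\<lambda>p. F (tn \<mu>2 (p 0)) (tn \<mu>1 (p 1))))"
    by (simp add: swn_form[OF lin_space_tensor pure_comul_inner l] tensor_lift_tens[OF lin_space_ground F])
  finally show ?thesis .
qed

lemma linear_on_comul_lift [simp]:
  assumes "bilinear_on W W ground F" "linear_on V W g"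
  shows "linear_on V ground (\<lambda>v. tensor_lift W W F (comul DD (g v)))"
  by (rule linear_on_tensor_lift_arg[OF lin_space_W lin_space_ground assms(1)])
    (rule linear_on_comp[OF comul_DD_linear assms(2)])

lemma linear_on_WW_lift_param [simp]:
  assumes "lin_space P" "T \<in> carr WW"
    and "\<And>p. p \<in> carr P \<Longrightarrow> bilinear_on W W ground (F p)"
    and "\<And>s t. s \<in> carr W \<Longrightarrow> t \<in> carr W \<Longrightarrow> linear_on P ground (\<lambda>p. F p s t)"
  shows "linear_on P ground (\<lambda>p. tensor_lift W W (F p) T)"
  using assms by (intro linear_on_tensor_lift_param lin_space_W lin_space_ground)

definition ev2 where
  "ev2 T x f y g = tensor_lift W W (\<lambda>s t. ev s x f * ev t y g) T"

lemma bilinear_evs: "linear_on H ground f \<Longrightarrow> linear_on H ground g \<Longrightarrow>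
    bilinear_on W W ground (\<lambda>s t. ev s x f * ev t y g)"
  by (intro bilinear_on_mult ev_linear)

lemma ev2_tens [simp]:
  "linear_on H ground f \<Longrightarrow> linear_on H ground g \<Longrightarrow> s \<in> carr W \<Longrightarrow> t \<in> carr W \<Longrightarrow>
    ev2 (tens W W s t) x f y g = ev s x f * ev t y g"
  unfolding ev2_def by (rule tensor_lift_tens[OF lin_space_ground bilinear_evs])

lemma ev2_linear: "linear_on H ground f \<Longrightarrow> linear_on H ground g \<Longrightarrow>
    linear_on WW ground (\<lambda>T. ev2 T x f y g)"
  unfolding ev2_def by (intro tensor_lift_linear lin_space_W lin_space_ground bilinear_evs)

definition evs2 where
  "evs2 = {tens_form W W \<phi> \<psi> |\<phi> \<psi>. \<phi> \<in> evs \<and> \<psi> \<in> evs}"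

lemma separating_evs2: "separating WW evs2"
  unfolding evs2_def by (rule separating_tensor[OF lin_space_W lin_space_W separating_evs separating_evs])

lemma evs2E:
  assumes "\<phi> \<in> evs2"
  obtains x f y g where "x \<in> carr H" "y \<in> carr H" "linear_on H ground f" "linear_on H ground g"
    "\<phi> = (\<lambda>T. ev2 T x f y g)"
  using assms by (force simp: evs2_def evs_def ev2_def[abs_def] tens_form_def)

lemma WW_eqI:
  assumes "S' \<in> carr WW" "T \<in> carr WW"
    and "\<And>x f y g. x \<in> carr H \<Longrightarrow> linear_on H ground f \<Longrightarrow> y \<in> carr H \<Longrightarrow> linear_on H ground g \<Longrightarrow>
      ev2 S' x f y g = ev2 T x f y g"
  shows "S' = T"
  by (rule separating_eqI[OF lin_space_tensor separating_evs2 assms(1,2)]) (auto elim!: evs2E simp: assms(3))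

text \<open>In the opposite coproduct \<mu>'' meets x and \<mu>' meets y, which evaluates \<mu> at y
  x; on the algebra side the two forms are convolved. Coproducts of arbitrary elements are thereby
  expressed by the pairing of a single element.\<close>

lemma ev2_comul:
  assumes [simp]: "t \<in> carr W" "x \<in> carr H" "y \<in> carr H"
    and f: "linear_on H ground f" and g: "linear_on H ground g"
  shows "ev2 (comul DD t) x f y g = ev t (y \<cdot> x) (\<lambda>b. swn 1 b (\<lambda>p. f (p 0) * g (p 1)))"
  by (rule W_form_eqI[OF _ _ assms(1)])
    (simp_all add: ev2_def bilinear_evs[OF f g] comul_DD_tn[OF bilinear_evs[OF f g]] f g dsw_simps mult.assoc,
      simp only: mult.left_commute)

lemma counit_D: "counit D \<beta> = \<beta> \<one>"
  unfolding dual_def by simp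

lemma counit_DD: "counit DD t = ev t \<one> \<epsilon>"
  by (simp add: drinfeld_def ev_def tens_form_def counit_D)

lemma counit_DD_linear: "linear_on W ground (counit DD)"
  unfolding counit_DD[abs_def] by (rule ev_linear[OF counit_linear])

lemma linear_on_space_of_W:
  "carr V = carr W \<Longrightarrow> scl V = fscale \<Longrightarrow> linear_on V U f \<longleftrightarrow> linear_on W U f"
  by (simp add: linear_on_def)

lemma WW_form:
  assumes "lin_space U" "bilinear_on W W U F" "linear_on U ground g" "T \<in> carr WW"
  shows "g (tensor_lift W W F T) = tensor_lift W W (\<lambda>s t. g (F s t)) T"
  by (rule linear_on_tensor_lift[OF lin_space_W assms(1) lin_space_ground assms(2-4)])

lemma comul_DD_one: "comul DD (tn (unt D) \<one>) = tens W W (tn (unt D) \<one>) (tn (unt D) \<one>)"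
proof (rule WW_eqI)
  fix x f y g assume [simp]: "x \<in> carr H" "y \<in> carr H"
    and f [simp]: "linear_on H ground f" and g [simp]: "linear_on H ground g"
  show "ev2 (comul DD (tn (unt D) \<one>)) x f y g =
      ev2 (tens W W (tn (unt D) \<one>) (tn (unt D) \<one>)) x f y g"
    by (simp add: ev2_comul swn1_one counit_mul mult_ac)
qed (simp_all add: tens_in_tensor)

text \<open>\<open>A\<close> stands for either double, so that one formula serves the
  multiplicativity of the coproduct and of the coaction. The first two parts permit the reduction to
  pure tensors on which the third part computes.\<close>

lemma comul_mul_form:
  fixes x y :: 'a and f g :: "'a \<Rightarrow> 'k"
  assumes A: "k_algebra A" and [simp]: "carr A = carr W" "scl A = fscale"
    and f [simp]: "linear_on H ground f" and g [simp]: "linear_on H ground g"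
  defines "E \<equiv> \<lambda>s t. ev2 (mul (tensor_algebra DD A) (comul DD s) (comul DD t)) x f y g"
  shows "t \<in> carr W \<Longrightarrow> linear_on W ground (\<lambda>s. E s t)"
    and "s \<in> carr W \<Longrightarrow> linear_on W ground (\<lambda>t. E s t)"
    and "\<mu> \<in> carr D \<Longrightarrow> m \<in> carr H \<Longrightarrow> \<nu> \<in> carr D \<Longrightarrow> n \<in> carr H \<Longrightarrow> E (tn \<mu> m) (tn \<nu> n) =
      dsw \<mu> (\<lambda>\<mu>1 \<mu>2. swn 1 m (\<lambda>p. dsw \<nu> (\<lambda>\<nu>1 \<nu>2. swn 1 n (\<lambda>q.
        ev (mul DD (tn \<mu>2 (p 0)) (tn \<nu>2 (q 0))) x f * ev (mul A (tn \<mu>1 (p 1)) (tn \<nu>1 (q 1))) y g))))"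
proof -
  interpret A: k_algebra A by fact
  have bA: "bilinear_on W W W (mul A)"
    using A.mul_bilinear bilinear_of_W[of A] by simp
  note [simp] = bilinear_on_left[OF bA] bilinear_on_right[OF bA] bilinear_on_closed[OF bA]
  have cong: "tensor DD A = WW" "tens DD A = tens W W" "tensor_lift DD A = tensor_lift W W"
    by (intro WW_cong; simp)+
  have lin: "linear_on WW ground (\<lambda>T. ev2 T x f y g)" by (rule ev2_linear[OF f g])
  let ?h = "\<lambda>a c s t. ev2 (tens W W (mul DD a s) (mul A c t)) x f y g"
  have bil: "bilinear_on W W ground (?h a c)" if [simp]: "a \<in> carr W" "c \<in> carr W" for a c
    by (intro bilinear_onI linear_on_comp[OF lin] vector_linear linear_on_products product_closed)
      simp_all
  have bil2: "bilinear_on W W ground (\<lambda>a c. tensor_lift W W (?h a c) (comul DD t))"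
    if "t \<in> carr W" for t
    by (rule bilinear_onI; rule linear_on_WW_lift_param)
      (intro lin_space_W comul_DD_closed that bil
        linear_on_comp[OF lin] vector_linear linear_on_products product_closed | simp)+
  have E: "E s t = tensor_lift W W (\<lambda>a c. tensor_lift W W (?h a c) (comul DD t)) (comul DD s)"
    if "s \<in> carr W" "t \<in> carr W" for s t
    unfolding E_def
    using tensor_algebra_mul(1)[OF k_algebra_DD A lin_space_ground, unfolded cong, OF lin
        comul_DD_closed[OF that(1)] comul_DD_closed[OF that(2)]] .
  show "linear_on W ground (\<lambda>s. E s t)" if "t \<in> carr W"
    using that by (simp add: E lin_space_W linear_on_comul_lift[OF bil2 linear_on_id] cong: linear_on_cong)
  show "linear_on W ground (\<lambda>t. E s t)" if s: "s \<in> carr W"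
  proof (subst linear_on_cong[OF E[OF s] lin_space_W])
    show "linear_on W ground (\<lambda>t. tensor_lift W W (\<lambda>a c. tensor_lift W W (?h a c) (comul DD t)) (comul DD s))"
      by (rule linear_on_WW_lift_param)
        (intro lin_space_W comul_DD_closed s bil2 linear_on_comul_lift bil linear_on_id | assumption)+
  qed
  show "E (tn \<mu> m) (tn \<nu> n) =
      dsw \<mu> (\<lambda>\<mu>1 \<mu>2. swn 1 m (\<lambda>p. dsw \<nu> (\<lambda>\<nu>1 \<nu>2. swn 1 n (\<lambda>q.
        ev (mul DD (tn \<mu>2 (p 0)) (tn \<nu>2 (q 0))) x f * ev (mul A (tn \<mu>1 (p 1)) (tn \<nu>1 (q 1))) y g))))"
    if "\<mu> \<in> carr D" "m \<in> carr H" "\<nu> \<in> carr D" "n \<in> carr H"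
    using that by (simp add: E comul_DD_tn[OF bil] comul_DD_tn[OF bil2])
qed

lemma comul_mul_closed:
  assumes A: "k_algebra A" and "carr A = carr W" "scl A = fscale" "s \<in> carr W" "t \<in> carr W"
  shows "mul (tensor_algebra DD A) (comul DD s) (comul DD t) \<in> carr WW"
proof -
  have cong: "tensor DD A = WW"
    by (intro WW_cong; simp add: assms)
  show ?thesis
    using tensor_algebra_mul(2)[OF k_algebra_DD A lin_space_tensor linear_on_id, unfolded cong]
    by (simp add: assms)
qed

lemma W_bilinear_form_eqI:
  assumes F: "\<And>t. t \<in> carr W \<Longrightarrow> linear_on W ground (\<lambda>s. F s t)"
      "\<And>s. s \<in> carr W \<Longrightarrow> linear_on W ground (\<lambda>t. F s t)"
    and G: "\<And>t. t \<in> carr W \<Longrightarrow> linear_on W ground (\<lambda>s. G s t)"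
      "\<And>s. s \<in> carr W \<Longrightarrow> linear_on W ground (\<lambda>t. G s t)"
    and eq: "\<And>\<alpha> a \<beta> b. \<alpha> \<in> carr D \<Longrightarrow> a \<in> carr H \<Longrightarrow> \<beta> \<in> carr D \<Longrightarrow> b \<in> carr H \<Longrightarrow>
      F (tn \<alpha> a) (tn \<beta> b) = G (tn \<alpha> a) (tn \<beta> b)"
    and mem: "s \<in> carr W" "t \<in> carr W"
  shows "F s t = G s t"
proof -
  have "F (tn \<alpha> a) t = G (tn \<alpha> a) t" if "\<alpha> \<in> carr D" "a \<in> carr H" for \<alpha> a
    by (rule W_form_eqI[OF F(2) G(2) mem(2)]) (simp_all add: that eq)
  then show ?thesis by (intro W_form_eqI[OF F(1) G(1) mem(1)]) (simp_all add: mem)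
qed

lemma linear_on_ev2_comul [simp]:
  "linear_on H ground f \<Longrightarrow> linear_on H ground g \<Longrightarrow> linear_on V W h \<Longrightarrow>
    linear_on V ground (\<lambda>v. ev2 (comul DD (h v)) x f y g)"
  by (rule linear_on_comp[OF linear_on_comp[OF ev2_linear comul_DD_linear]])

lemma comul_DD_mul:
  assumes s: "s \<in> carr W" and t: "t \<in> carr W"
  shows "comul DD (mul DD s t) = mul (tensor_algebra DD DD) (comul DD s) (comul DD t)"
proof (rule WW_eqI)
  fix x f y g
  assume [simp]: "x \<in> carr H" "y \<in> carr H"
    and f [simp]: "linear_on H ground f" and g [simp]: "linear_on H ground g"
  note form = comul_mul_form[OF k_algebra_DD _ _ f g]
  note [simp] = linear_form_comp[OF f] linear_form_comp[OF g]
  show "ev2 (comul DD (mul DD s t)) x f y g =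
      ev2 (mul (tensor_algebra DD DD) (comul DD s) (comul DD t)) x f y g"
  proof (rule W_bilinear_form_eqI[OF _ _ _ _ _ s t,
        where F = "\<lambda>s t. ev2 (comul DD (mul DD s t)) x f y g"
          and G = "\<lambda>s t. ev2 (mul (tensor_algebra DD DD) (comul DD s) (comul DD t)) x f y g"])
    fix \<mu> m \<nu> n
    assume [simp]: "\<mu> \<in> carr D" "m \<in> carr H" "\<nu> \<in> carr D" "n \<in> carr H"
    note [simp] = dual_linear_comp[of \<mu>] dual_linear_comp[of \<nu>]
    \<comment> \<open>Multiplying the coproducts and recombining the two components of \<nu> yields
      the argument \<open>Si\<close>(m6) y'' m4 \<open>Si\<close>(m3) x'' m1. The pair m4
      \<open>Si\<close>(m3) has no counterpart in the coproduct of the product and cancels.\<close>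
    have contract: "swn 5 m (\<lambda>q. c * (\<nu> (Si (q 5) \<cdot> (u \<cdot> (q 3 \<cdot> (Si (q 2) \<cdot> (v \<cdot> q 0))))) *
          (f (q (Suc 0) \<cdot> r) * g (q 4 \<cdot> r')))) =
        swn 3 m (\<lambda>q. c * (\<nu> (Si (q 3) \<cdot> (u \<cdot> (v \<cdot> q 0))) * (f (q (Suc 0) \<cdot> r) * g (q 2 \<cdot> r'))))"
      if [simp]: "u \<in> carr H" "v \<in> carr H" "r \<in> carr H" "r' \<in> carr H" for c u v r r'
      using swn_contract[of m 2 4 "\<lambda>p q. c * (\<nu> (Si (p 4) \<cdot> (u \<cdot> (q 1 \<cdot> (Si (q 0) \<cdot> (v \<cdot> p 0))))) *
          (f (p 1 \<cdot> r) * g (p 3 \<cdot> r')))"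
        "\<lambda>p. c * (\<nu> (Si (p 4) \<cdot> (u \<cdot> (v \<cdot> p 0))) * (f (p 1 \<cdot> r) * g (p 3 \<cdot> r')))"]
      by (simp add: Si_right_mid[where
            f = "\<lambda>z. c * (\<nu> (Si (_ 4) \<cdot> (u \<cdot> z)) * (f (_ (Suc 0) \<cdot> r) * g (_ 3 \<cdot> r')))"])
    show "ev2 (comul DD (mul DD (tn \<mu> m) (tn \<nu> n))) x f y g =
        ev2 (mul (tensor_algebra DD DD) (comul DD (tn \<mu> m)) (comul DD (tn \<nu> n))) x f y g"
      by (simp add: form(3) ev2_comul ev_DD swn_swn mul_assoc mult.assoc dsw_simps contract
          swn_swap[of m c for c] swn_swap[of n x] swn_swap[of n y]
          mult.left_commute[of "f _" "\<mu> _"] mult.left_commute[of "f _" "\<nu> _"])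
  qed (simp_all add: form(1,2))
qed (simp_all add: s t comul_mul_closed[OF k_algebra_DD])

lemma comul_DD_form:
  assumes "lin_space U" "bilinear_on W W U F" "linear_on U ground g"
    and [simp]: "\<mu> \<in> carr D" "m \<in> carr H"
  shows "g (tensor_lift W W F (comul DD (tn \<mu> m))) =
    dsw \<mu> (\<lambda>\<mu>1 \<mu>2. swn 1 m (\<lambda>p. g (F (tn \<mu>2 (p 0)) (tn \<mu>1 (p 1)))))"
proof -
  have "bilinear_on W W ground (\<lambda>s t. g (F s t))"
    using assms(2) by (auto simp: bilinear_on_def intro!: linear_on_comp[OF assms(3)])
  then show ?thesis
    by (subst WW_form[OF assms(1-3)]) (simp_all add: comul_DD_tn)
qed

lemma linear_on_comul_lift_vec:
  assumes "lin_space U" "bilinear_on W W U F"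
  shows "linear_on W U (\<lambda>t. tensor_lift W W F (comul DD t))"
  by (intro linear_on_tensor_lift_arg lin_space_W assms comul_DD_linear)

text \<open>Tested with three pairs, each side evaluates \<mu> at z y x and the three forms at the
  threefold coproduct of m, so the claim is associativity and coassociativity in
  \<open>H\<close>.\<close>

lemma comul_DD_coassoc:
  assumes t: "t \<in> carr W"
  shows "tensor_lift W W (\<lambda>y z. tensor_lift W W (\<lambda>y1 y2. tens W WW y1 (tens W W y2 z)) (comul DD y)) (comul DD t) =
    tensor_lift W W (\<lambda>y z. tens W WW y (comul DD z)) (comul DD t)"
    (is "tensor_lift W W ?F _ = tensor_lift W W ?G _")
proof -
  let ?U = "tensor W WW"
  have in1: "bilinear_on W W ?U (\<lambda>y1 y2. tens W WW y1 (tens W W y2 z))" if "z \<in> carr W" for z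
    using that by (intro bilinear_onI linear_on_tens_left linear_on_tens_right linear_on_id tens_in_tensor)
  have F: "bilinear_on W W ?U ?F"
    by (rule bilinear_onI, rule linear_on_comul_lift_vec[OF lin_space_tensor in1], assumption,
        rule linear_on_tensor_lift_param)
      (intro lin_space_W lin_space_tensor comul_DD_closed in1 linear_on_tens_right linear_on_tens_left
        linear_on_id tens_in_tensor | assumption)+
  have G: "bilinear_on W W ?U ?G"
    by (intro bilinear_onI linear_on_tens_left linear_on_tens_right linear_on_id comul_DD_linear comul_DD_closed)
  show ?thesis
  proof (rule separating_eqI[OF lin_space_tensor separating_tensor[OF lin_space_W lin_space_tensor
          separating_evs separating_evs2]])
    fix \<phi> assume "\<phi> \<in> {tens_form W WW \<phi> \<psi> |\<phi> \<psi>. \<phi> \<in> evs \<and> \<psi> \<in> evs2}"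
    then obtain \<phi>1 \<phi>2 where \<phi>: "\<phi> = tens_form W WW \<phi>1 \<phi>2" "\<phi>1 \<in> evs" "\<phi>2 \<in> evs2" by auto
    obtain x f where x [simp]: "x \<in> carr H" and f [simp]: "linear_on H ground f" and \<phi>1: "\<phi>1 = (\<lambda>t. ev t x f)"
      using \<phi>(2) by (auto simp: evs_def)
    obtain y g z h where [simp]: "y \<in> carr H" "z \<in> carr H"
      and g [simp]: "linear_on H ground g" and h [simp]: "linear_on H ground h"
      and \<phi>2: "\<phi>2 = (\<lambda>T. ev2 T y g z h)"
      using \<phi>(3) by (rule evs2E)
    have \<phi>_tens: "\<phi> (tens W WW s T) = ev s x f * ev2 T y g z h" if "s \<in> carr W" "T \<in> carr WW" for s T
      unfolding \<phi> \<phi>1 \<phi>2 using that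
      by (intro tens_form_tens ev_linear ev2_linear f g h)
    have \<phi>lin: "linear_on ?U ground \<phi>"
      unfolding \<phi> \<phi>1 \<phi>2 by (intro tens_form_linear ev_linear ev2_linear f g h lin_space_W)
    show "\<phi> (tensor_lift W W ?F (comul DD t)) = \<phi> (tensor_lift W W ?G (comul DD t))"
    proof (rule W_form_eqI[OF _ _ t, where f = "\<lambda>t. \<phi> (tensor_lift W W ?F (comul DD t))"
          and g = "\<lambda>t. \<phi> (tensor_lift W W ?G (comul DD t))"])
      show "linear_on W ground (\<lambda>t. \<phi> (tensor_lift W W ?F (comul DD t)))"
        by (rule linear_on_comp[OF \<phi>lin linear_on_comul_lift_vec[OF lin_space_tensor F]])
      show "linear_on W ground (\<lambda>t. \<phi> (tensor_lift W W ?G (comul DD t)))"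
        by (rule linear_on_comp[OF \<phi>lin linear_on_comul_lift_vec[OF lin_space_tensor G]])
      fix \<mu> m assume \<mu> [simp]: "\<mu> \<in> carr D" and m [simp]: "m \<in> carr H"
      show "\<phi> (tensor_lift W W ?F (comul DD (tn \<mu> m))) = \<phi> (tensor_lift W W ?G (comul DD (tn \<mu> m)))"
        by (simp add: comul_DD_form[OF lin_space_tensor F \<phi>lin] comul_DD_form[OF lin_space_tensor G \<phi>lin]
            comul_DD_form[OF lin_space_tensor in1 \<phi>lin] \<phi>_tens tens_in_tensor ev2_comul swn_swn
            mul_assoc dsw_simps mult.assoc mult.left_commute[of "g _" "\<mu> _"])
    qed
  qed (rule tensor_lift_closed[OF lin_space_W lin_space_tensor F comul_DD_closed[OF t]]
      tensor_lift_closed[OF lin_space_W lin_space_tensor G comul_DD_closed[OF t]])+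
qed

lemma ev_fscale [simp]: "t \<in> carr W \<Longrightarrow> linear_on H ground f \<Longrightarrow> ev (fscale c t) x f = c * ev t x f"
  using ev_linear[of f x] by (auto simp: linear_on_def ground_def)

lemma fscale_closed [simp]: "t \<in> carr W \<Longrightarrow> fscale c t \<in> carr W"
  using lin_space.scl_closed[OF lin_space_W] by simp

lemma linear_on_W_fscale: "t \<in> carr W \<Longrightarrow> linear_on V ground g \<Longrightarrow> linear_on V W (\<lambda>v. fscale (g v) t)"
  using linear_on_scl_form[OF lin_space_W, of V g t] by simp

lemma linear_on_W_fscale_right: "linear_on W W (\<lambda>t. fscale c t)"
  using lin_space.linear_on_scl[OF lin_space_W, of c] by simp

lemma comul_DD_counit:
  assumes t: "t \<in> carr W"
  shows "tensor_lift W W (\<lambda>y z. fscale (counit DD y) z) (comul DD t) = t"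
    and "tensor_lift W W (\<lambda>y z. fscale (counit DD z) y) (comul DD t) = t"
proof -
  have b1: "bilinear_on W W W (\<lambda>y z. fscale (counit DD y) z)"
    by (intro bilinear_onI linear_on_W_fscale linear_on_W_fscale_right counit_DD_linear)
  have b2: "bilinear_on W W W (\<lambda>y z. fscale (counit DD z) y)"
    by (intro bilinear_onI linear_on_W_fscale linear_on_W_fscale_right counit_DD_linear)
  show "tensor_lift W W (\<lambda>y z. fscale (counit DD y) z) (comul DD t) = t"
  proof (rule tensor_linear_ext[OF lin_space_dual lin_space_W linear_on_comul_lift_vec[OF lin_space_W b1] linear_on_id _ t])
    fix \<mu> m assume [simp]: "\<mu> \<in> carr D" "m \<in> carr H"
    show "tensor_lift W W (\<lambda>y z. fscale (counit DD y) z) (comul DD (tn \<mu> m)) = tn \<mu> m"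
    proof (rule W_eqI)
      fix x f assume [simp]: "x \<in> carr H" and f [simp]: "linear_on H ground f"
      show "ev (tensor_lift W W (\<lambda>y z. fscale (counit DD y) z) (comul DD (tn \<mu> m))) x f = ev (tn \<mu> m) x f"
        by (subst comul_DD_form[OF lin_space_W b1 ev_linear[OF f]])
          (simp_all add: counit_DD counit_linear dsw_simps mult.assoc mult.left_commute[of "\<epsilon> _" "\<mu> _"] unt_right)
    qed (simp_all add: tensor_lift_closed[OF lin_space_W lin_space_W b1])
  qed
  show "tensor_lift W W (\<lambda>y z. fscale (counit DD z) y) (comul DD t) = t"
  proof (rule tensor_linear_ext[OF lin_space_dual lin_space_W linear_on_comul_lift_vec[OF lin_space_W b2] linear_on_id _ t])
    fix \<mu> m assume [simp]: "\<mu> \<in> carr D" "m \<in> carr H"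
    show "tensor_lift W W (\<lambda>y z. fscale (counit DD z) y) (comul DD (tn \<mu> m)) = tn \<mu> m"
    proof (rule W_eqI)
      fix x f assume [simp]: "x \<in> carr H" and f [simp]: "linear_on H ground f"
      show "ev (tensor_lift W W (\<lambda>y z. fscale (counit DD z) y) (comul DD (tn \<mu> m))) x f = ev (tn \<mu> m) x f"
        by (subst comul_DD_form[OF lin_space_W b2 ev_linear[OF f]])
          (simp_all add: counit_DD counit_linear dsw_simps mult.assoc unt_left)
    qed (simp_all add: tensor_lift_closed[OF lin_space_W lin_space_W b2])
  qed
qed

lemma counit_DD_mul:
  assumes s: "s \<in> carr W" and t: "t \<in> carr W"
  shows "counit DD (mul DD s t) = counit DD s * counit DD t"
proof (rule W_bilinear_form_eqI[OF _ _ _ _ _ s t, where F = "\<lambda>s t. counit DD (mul DD s t)"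
      and G = "\<lambda>s t. counit DD s * counit DD t"])
  fix \<mu> m \<nu> n
  assume [simp]: "\<mu> \<in> carr D" "m \<in> carr H" "\<nu> \<in> carr D" "n \<in> carr H"
  note [simp] = dual_linear_comp[of \<mu>] dual_linear_comp[of \<nu>] linear_form_eps counit_linear
  show "counit DD (mul DD (tn \<mu> m) (tn \<nu> n)) = counit DD (tn \<mu> m) * counit DD (tn \<nu> n)"
  proof -
    have "counit DD (mul DD (tn \<mu> m) (tn \<nu> n)) =
        swn 2 m (\<lambda>q. \<epsilon> (q 1) * (\<epsilon> n * (\<mu> \<one> * \<nu> (Si (q 2) \<cdot> q 0))))"
      by (simp add: counit_DD ev_DD swn1_one unt_left counit_mul mult.assoc del: swn_eps swn_eps_left,
          simp only: mult_ac)
    also have "\<dots> = swn (Suc 0) m (\<lambda>q. \<epsilon> n * (\<mu> \<one> * \<nu> (Si (q (Suc 0)) \<cdot> q 0)))"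
      by simp
    also have "\<dots> = \<epsilon> m * (\<epsilon> n * (\<mu> \<one> * \<nu> \<one>))"
      by (rule Si_left_end) simp_all
    finally show ?thesis by (simp add: counit_DD mult_ac)
  qed
qed (simp_all add: counit_DD_linear linear_on_comp[OF counit_DD_linear])

lemma bialgebra_DD: "bialgebra DD"
proof -
  have cong: "tensor DD WW = tensor W WW" "tens DD WW = tens W WW"
    by (intro tensor_space_cong tens_space_cong; simp)+
  have lin: "linear_on DD WW (comul DD)" "linear_on DD ground (counit DD)"
    using comul_DD_linear counit_DD_linear by (simp_all add: linear_on_space_of_W[of DD])
  show ?thesis
    by (intro bialgebra.intro k_algebra_DD bialgebra_axioms.intro)
      (simp_all add: sw2_def cong lin comul_DD_coassoc comul_DD_counit comul_DD_mul comul_DD_one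
        counit_DD_mul, simp add: counit_DD counit_linear counit_unt)
qed

text \<open>The antipode of the dual with opposite coproduct is the inverse of its usual antipode.
  Since \<mu> \<otimes> m is the product of \<mu> \<otimes> \<one> and \<epsilon> \<otimes> m, an
  antipode has to multiply the two images in reverse order.\<close>

definition antipode_DD where
  "antipode_DD = tensor_lift D H (\<lambda>\<mu> m. mul DD (tn (unt D) (S m)) (tn (dual_antipode_inv H S \<mu>) \<one>))"

lemma antipode_DD_bilinear:
  "bilinear_on D H W (\<lambda>\<mu> m. mul DD (tn (unt D) (S m)) (tn (dual_antipode_inv H S \<mu>) \<one>))"
  by (intro bilinear_onI linear_on_products vector_linear closed) simp_all

lemma antipode_DD_linear: "linear_on W W antipode_DD"
  unfolding antipode_DD_def by (intro tensor_lift_linear lin_space_dual lin_space_W antipode_DD_bilinear)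

lemma antipode_DD_tn: "\<mu> \<in> carr D \<Longrightarrow> m \<in> carr H \<Longrightarrow>
    antipode_DD (tn \<mu> m) = mul DD (tn (unt D) (S m)) (tn (dual_antipode_inv H S \<mu>) \<one>)"
  unfolding antipode_DD_def by (rule tensor_lift_tens[OF lin_space_W antipode_DD_bilinear])

lemma antipode_DD_closed [simp]: "t \<in> carr W \<Longrightarrow> antipode_DD t \<in> carr W"
  by (rule linear_on_closed[OF antipode_DD_linear])

lemma swn2_one:
  assumes lin: "\<And>p. (\<And>j. p j \<in> carr H) \<Longrightarrow> linear_on H ground (\<lambda>a. F (p(0 := a)))"
      "\<And>p. (\<And>j. p j \<in> carr H) \<Longrightarrow> linear_on H ground (\<lambda>a. F (p(Suc 0 := a)))"
      "\<And>p. (\<And>j. p j \<in> carr H) \<Longrightarrow> linear_on H ground (\<lambda>a. F (p(2 := a)))"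
    and dep: "\<And>p p'. (\<And>j. p j \<in> carr H) \<Longrightarrow> (\<And>j. p' j \<in> carr H) \<Longrightarrow>
      \<forall>j\<le>2. p j = p' j \<Longrightarrow> F p = F p'"
  shows "swn 2 \<one> F = F (\<lambda>_. \<one>)"
proof -
  have "swn 2 \<one> F = swn 2 \<one> (\<lambda>p. F (clamp p))"
    by (intro swn_cong one_closed) (simp add: clamp_id)
  also have "\<dots> = F (clamp (\<lambda>_. \<one>))"
  proof (rule swn_one)
    fix p :: "nat \<Rightarrow> 'a" and i :: nat assume p: "\<And>j. p j \<in> carr H" and "i \<le> 2"
    then consider "i = 0" | "i = Suc 0" | "i = 2" by linarith
    then have "linear_on H ground (\<lambda>a. F (p(i := a)))"
      by cases (use lin p in simp_all)
    then show "linear_on H ground (\<lambda>a. F (clamp (p(i := a))))"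
      by (subst linear_on_cong[OF _ lin_space_H, of _ "\<lambda>a. F (p(i := a))"]) (simp_all add: clamp_id p)
  next
    show "F (clamp p) = F (clamp p')" if "\<forall>j\<le>2. p j = p' j" for p p'
      by (rule dep) (use that in \<open>simp_all add: clamp_def\<close>)
  qed
  finally show ?thesis by (simp add: clamp_id)
qed

lemma DD_mul_left:
  assumes [simp]: "\<sigma> \<in> carr D" "\<nu> \<in> carr D" "n \<in> carr H"
  shows "mul DD (tn \<sigma> \<one>) (tn \<nu> n) = tn (mul D \<sigma> \<nu>) n"
proof (rule W_eqI)
  fix x f assume [simp]: "x \<in> carr H" and f [simp]: "linear_on H ground f"
  note [simp] = linear_form_comp[OF f] dual_linear_comp[of \<nu>]
  show "ev (mul DD (tn \<sigma> \<one>) (tn \<nu> n)) x f = ev (tn (mul D \<sigma> \<nu>) n) x f"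
    by (simp add: ev_DD swn2_one unt_left unt_right Si_one dual_mul_apply mult.assoc)
qed simp_all

lemma DD_mul_right:
  assumes [simp]: "\<sigma> \<in> carr D" "m \<in> carr H" "n \<in> carr H"
  shows "mul DD (tn \<sigma> m) (tn (unt D) n) = tn \<sigma> (m \<cdot> n)"
proof (rule W_eqI)
  fix x f assume [simp]: "x \<in> carr H" and f [simp]: "linear_on H ground f"
  note [simp] = linear_form_comp[OF f] dual_linear_comp[of \<sigma>]
  show "ev (mul DD (tn \<sigma> m) (tn (unt D) n)) x f = ev (tn \<sigma> (m \<cdot> n)) x f"
    by (simp add: ev_DD counit_mul counit_Si mult.assoc mult.left_commute[of "\<sigma> _" "\<epsilon> _"])
qed simp_all

text \<open>By associativity the functionals meet in the middle. With T the inverse antipode of the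
  dual, T(\<mu>'') \<mu>' at y is \<mu>(y'' \<open>Si\<close>(y')), which is \<epsilon>(y)
  \<mu>(\<one>); then S(m') m'' cancels.\<close>

lemma antipode_DD_left:
  assumes t: "t \<in> carr W"
  shows "tensor_lift W W (\<lambda>y z. mul DD (antipode_DD y) z) (comul DD t) = fscale (counit DD t) (tn (unt D) \<one>)"
proof -
  have bil: "bilinear_on W W W (\<lambda>y z. mul DD (antipode_DD y) z)"
    by (intro bilinear_onI linear_on_products antipode_DD_linear linear_on_id antipode_DD_closed)
  show ?thesis
  proof (rule tensor_linear_ext[OF lin_space_dual lin_space_W linear_on_comul_lift_vec[OF lin_space_W bil] _ _ t])
    show "linear_on W W (\<lambda>t. fscale (counit DD t) (tn (unt D) \<one>))"
      by (intro linear_on_W_fscale counit_DD_linear) simp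
    fix \<mu> m assume [simp]: "\<mu> \<in> carr D" "m \<in> carr H"
    note [simp] = dual_linear_comp[of \<mu>]
    have mul: "mul DD (antipode_DD (tn \<mu>2 a)) (tn \<mu>1 b) =
        mul DD (tn (unt D) (S a)) (tn (mul D (dual_antipode_inv H S \<mu>2) \<mu>1) b)"
      if "\<mu>1 \<in> carr D" "\<mu>2 \<in> carr D" "a \<in> carr H" "b \<in> carr H" for \<mu>1 \<mu>2 a b
      using that by (simp add: antipode_DD_tn DD_assoc DD_mul_left)
    show "tensor_lift W W (\<lambda>y z. mul DD (antipode_DD y) z) (comul DD (tn \<mu> m)) =
        fscale (counit DD (tn \<mu> m)) (tn (unt D) \<one>)"
    proof (rule W_eqI)
      fix x f assume [simp]: "x \<in> carr H" and f [simp]: "linear_on H ground f"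
      note [simp] = linear_form_comp[OF f] linear_form_eps counit_linear
      have key: "dsw \<mu> (\<lambda>\<mu>1 \<mu>2. ev (mul DD (tn (unt D) n) (tn (mul D (dual_antipode_inv H S \<mu>2) \<mu>1) k)) x f) =
          \<epsilon> x * (\<mu> \<one> * f (n \<cdot> k))" if [simp]: "n \<in> carr H" "k \<in> carr H" for n k
        by (simp add: ev_DD dual_mul_apply dual_antipode_inv_apply dsw_simps mult.assoc counit_mul counit_Si
            Si_right_end[of "\<lambda>u. c * (\<mu> u * d)" for c d] del: swn1_mul)
      have "ev (tensor_lift W W (\<lambda>y z. mul DD (antipode_DD y) z) (comul DD (tn \<mu> m))) x f =
          swn (Suc 0) m (\<lambda>p. \<epsilon> x * (\<mu> \<one> * f (S (p 0) \<cdot> p (Suc 0))))"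
        by (subst comul_DD_form[OF lin_space_W bil ev_linear[OF f]]) (simp_all add: mul key dsw_swn)
      also have "\<dots> = \<epsilon> m * (\<epsilon> x * (\<mu> \<one> * f \<one>))"
        by (rule antipode_left_end) simp_all
      finally show "ev (tensor_lift W W (\<lambda>y z. mul DD (antipode_DD y) z) (comul DD (tn \<mu> m))) x f =
          ev (fscale (counit DD (tn \<mu> m)) (tn (unt D) \<one>)) x f"
        by (simp add: counit_DD mult_ac)
    qed (simp_all add: tensor_lift_closed[OF lin_space_W lin_space_W bil])
  qed
qed

text \<open>Now the algebra components meet in the middle: m' S(m'') cancels first, and the
  functionals left over give \<mu>(\<open>Si\<close>(x'') x').\<close>

lemma antipode_DD_right:
  assumes t: "t \<in> carr W"
  shows "tensor_lift W W (\<lambda>y z. mul DD y (antipode_DD z)) (comul DD t) = fscale (counit DD t) (tn (unt D) \<one>)"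
proof -
  have bil: "bilinear_on W W W (\<lambda>y z. mul DD y (antipode_DD z))"
    by (intro bilinear_onI linear_on_products antipode_DD_linear linear_on_id antipode_DD_closed)
  show ?thesis
  proof (rule tensor_linear_ext[OF lin_space_dual lin_space_W linear_on_comul_lift_vec[OF lin_space_W bil] _ _ t])
    show "linear_on W W (\<lambda>t. fscale (counit DD t) (tn (unt D) \<one>))"
      by (intro linear_on_W_fscale counit_DD_linear) simp
    fix \<mu> m assume [simp]: "\<mu> \<in> carr D" "m \<in> carr H"
    note [simp] = dual_linear_comp[of \<mu>]
    have mul: "mul DD (tn \<mu>2 a) (antipode_DD (tn \<mu>1 b)) =
        mul DD (tn \<mu>2 (a \<cdot> S b)) (tn (dual_antipode_inv H S \<mu>1) \<one>)"
      if "\<mu>1 \<in> carr D" "\<mu>2 \<in> carr D" "a \<in> carr H" "b \<in> carr H" for \<mu>1 \<mu>2 a b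
      using that by (simp add: antipode_DD_tn DD_assoc[symmetric] DD_mul_right)
    show "tensor_lift W W (\<lambda>y z. mul DD y (antipode_DD z)) (comul DD (tn \<mu> m)) =
        fscale (counit DD (tn \<mu> m)) (tn (unt D) \<one>)"
    proof (rule W_eqI)
      fix x f assume [simp]: "x \<in> carr H" and f [simp]: "linear_on H ground f"
      note [simp] = linear_form_comp[OF f] linear_form_eps counit_linear
      have key: "swn (Suc 0) m (\<lambda>p. ev (mul DD (tn \<mu>2 (p 0 \<cdot> S (p (Suc 0)))) (tn \<sigma> \<one>)) x f) =
          \<epsilon> m * ev (tn (mul D \<mu>2 \<sigma>) \<one>) x f" if [simp]: "\<mu>2 \<in> carr D" "\<sigma> \<in> carr D" for \<mu>2 \<sigma>
      proof -
        have "linear_on H ground (\<lambda>z. ev (mul DD (tn \<mu>2 z) (tn \<sigma> \<one>)) x f)"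
          by (intro linear_on_ev f linear_on_products vector_linear) simp_all
        from antipode_right_end[OF this \<open>m \<in> carr H\<close>] show ?thesis by (simp add: DD_mul_left)
      qed
      have "ev (tensor_lift W W (\<lambda>y z. mul DD y (antipode_DD z)) (comul DD (tn \<mu> m))) x f =
          dsw \<mu> (\<lambda>\<mu>1 \<mu>2. \<epsilon> m * ev (tn (mul D \<mu>2 (dual_antipode_inv H S \<mu>1)) \<one>) x f)"
        by (subst comul_DD_form[OF lin_space_W bil ev_linear[OF f]]) (simp_all add: mul key)
      also have "\<dots> = swn (Suc 0) x (\<lambda>p. \<epsilon> m * (\<mu> (Si (p (Suc 0)) \<cdot> p 0) * f \<one>))"
        by (simp add: dual_mul_apply dual_antipode_inv_apply dsw_simps mult.assoc)
      also have "\<dots> = \<epsilon> x * (\<epsilon> m * (\<mu> \<one> * f \<one>))"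
        by (rule Si_left_end) simp_all
      finally show "ev (tensor_lift W W (\<lambda>y z. mul DD y (antipode_DD z)) (comul DD (tn \<mu> m))) x f =
          ev (fscale (counit DD (tn \<mu> m)) (tn (unt D) \<one>)) x f"
        by (simp add: counit_DD mult_ac)
    qed (simp_all add: tensor_lift_closed[OF lin_space_W lin_space_W bil])
  qed
qed

lemma hopf_algebra_DD: "hopf_algebra DD antipode_DD"
proof -
  have "linear_on DD DD antipode_DD"
    using antipode_DD_linear by (simp add: linear_on_def)
  then show ?thesis
    by (intro hopf_algebra.intro bialgebra_DD hopf_algebra_axioms.intro)
      (simp_all add: sw2_def antipode_DD_left antipode_DD_right)
qed

section \<open>The action and the coaction\<close>

lemma ev_act_dual:
  assumes [simp]: "\<nu> \<in> carr D" "t \<in> carr W" "x \<in> carr H" and f [simp]: "linear_on H ground f"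
  shows "ev (act (tn \<nu> \<one>) t) x f =
    swn 2 x (\<lambda>p. ev t (p 1) (\<lambda>b. swn 1 b (\<lambda>r. \<nu> (Si (r 0) \<cdot> (Si (p 2) \<cdot> p 0)) * f (r 1))))"
proof (rule W_form_eqI[OF _ _ assms(2), where f = "\<lambda>t. ev (act (tn \<nu> \<one>) t) x f"])
  fix \<beta> b assume [simp]: "\<beta> \<in> carr D" "b \<in> carr H"
  note [simp] = dual_linear_comp[of \<beta>] dual_linear_comp[of \<nu>]
  show "ev (act (tn \<nu> \<one>) (tn \<beta> b)) x f =
    swn 2 x (\<lambda>p. ev (tn \<beta> b) (p 1) (\<lambda>b. swn 1 b (\<lambda>r. \<nu> (Si (r 0) \<cdot> (Si (p 2) \<cdot> p 0)) * f (r 1))))"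
  proof -
    have "swn 2 \<one> (\<lambda>q. swn (Suc 0) (q (Suc 0) \<cdot> (b \<cdot> S (q 2))) (\<lambda>r. \<beta> (y \<cdot> q 0) * G r)) =
        swn (Suc 0) b (\<lambda>r. \<beta> y * G r)" if [simp]: "y \<in> carr H" for y G
    proof (subst swn2_one)
      fix p :: "nat \<Rightarrow> 'a" assume [simp]: "\<And>j. p j \<in> carr H"
      show "linear_on H ground (\<lambda>a. swn (Suc 0) ((p(0 := a)) (Suc 0) \<cdot> (b \<cdot> S ((p(0 := a)) 2)))
          (\<lambda>r. \<beta> (y \<cdot> (p(0 := a)) 0) * G r))"
        by simp
      show "linear_on H ground (\<lambda>a. swn (Suc 0) ((p(Suc 0 := a)) (Suc 0) \<cdot> (b \<cdot> S ((p(Suc 0 := a)) 2)))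
          (\<lambda>r. \<beta> (y \<cdot> (p(Suc 0 := a)) 0) * G r))"
        by (simp del: swn1_mul cong del: swn_cong')
      show "linear_on H ground (\<lambda>a. swn (Suc 0) ((p(2 := a)) (Suc 0) \<cdot> (b \<cdot> S ((p(2 := a)) 2)))
          (\<lambda>r. \<beta> (y \<cdot> (p(2 := a)) 0) * G r))"
        by (simp del: swn1_mul cong del: swn_cong')
    qed (simp_all add: S_one unt_left unt_right del: swn1_mul)
    then show ?thesis by (simp add: ev_act del: swn1_mul)
  qed
qed simp_all

text \<open>For the unit functional the argument of \<mu> turns into counits, as \<epsilon> is
  multiplicative and invariant under \<open>Si\<close>. They delete the outer components of x and
  the coproduct of the conjugate, and the adjoint action on b remains.\<close>

lemma ev_act_alg:
  assumes [simp]: "m \<in> carr H" "t \<in> carr W" "x \<in> carr H" and f [simp]: "linear_on H ground f"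
  shows "ev (act (tn (unt D) m) t) x f =
    swn 2 m (\<lambda>q. ev t (x \<cdot> q 0) (\<lambda>b. f (q 1 \<cdot> (b \<cdot> S (q 2)))))"
proof (rule W_form_eqI[OF _ _ assms(2), where f = "\<lambda>t. ev (act (tn (unt D) m) t) x f"])
  fix \<beta> b assume [simp]: "\<beta> \<in> carr D" "b \<in> carr H"
  note [simp] = dual_linear_comp[of \<beta>] linear_form_comp[OF f]
  show "ev (act (tn (unt D) m) (tn \<beta> b)) x f =
    swn 2 m (\<lambda>q. ev (tn \<beta> b) (x \<cdot> q 0) (\<lambda>b. f (q 1 \<cdot> (b \<cdot> S (q 2)))))"
    by (simp add: ev_act counit_mul counit_Si mult.assoc mult.left_commute[of "\<beta> _" "\<epsilon> _"]
        swn_swap[of x m] del: swn1_mul)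
qed (simp_all add: linear_form_comp[OF f])

text \<open>The pairing formula already describes a composite: m supplies the shifted point and the
  conjugate of b, and \<mu> reads the coproducts of x and of that conjugate.\<close>

lemma act_split:
  assumes [simp]: "\<mu> \<in> carr D" "m \<in> carr H" "t \<in> carr W"
  shows "act (tn \<mu> m) t = act (tn \<mu> \<one>) (act (tn (unt D) m) t)"
proof (rule W_eqI)
  fix x f assume [simp]: "x \<in> carr H" and f [simp]: "linear_on H ground f"
  note [simp] = dual_linear_comp[of \<mu>] linear_form_comp[OF f]
  have "ev (act (tn \<mu> m) t) x f = swn 2 x (\<lambda>p. swn 2 m (\<lambda>q. ev t (p 1 \<cdot> q 0) (\<lambda>b. swn 1 (q 1 \<cdot> (b \<cdot> S (q 2)))
      (\<lambda>r. \<mu> (Si (r 0) \<cdot> (Si (p 2) \<cdot> p 0)) * f (r 1)))))"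
    by (rule ev_act) simp_all
  then show "ev (act (tn \<mu> m) t) x f = ev (act (tn \<mu> \<one>) (act (tn (unt D) m) t)) x f"
    by (simp add: ev_act_dual ev_act_alg del: swn1_mul)
qed simp_all

lemma act_alg_mul:
  assumes [simp]: "m \<in> carr H" "n \<in> carr H" "t \<in> carr W"
  shows "act (tn (unt D) (m \<cdot> n)) t = act (tn (unt D) m) (act (tn (unt D) n) t)"
proof (rule tensor_linear_ext[OF lin_space_dual lin_space_W _ _ _ assms(3)])
  fix \<beta> b assume [simp]: "\<beta> \<in> carr D" "b \<in> carr H"
  show "act (tn (unt D) (m \<cdot> n)) (tn \<beta> b) = act (tn (unt D) m) (act (tn (unt D) n) (tn \<beta> b))"
  proof (rule W_eqI)
    fix x f assume [simp]: "x \<in> carr H" and f [simp]: "linear_on H ground f"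
    note [simp] = dual_linear_comp[of \<beta>] linear_form_comp[OF f]
    show "ev (act (tn (unt D) (m \<cdot> n)) (tn \<beta> b)) x f =
        ev (act (tn (unt D) m) (act (tn (unt D) n) (tn \<beta> b))) x f"
      by (simp add: ev_act_alg mul_assoc S_mul)
  qed simp_all
qed simp_all

text \<open>Splitting \<open>Si\<close>(b') \<open>Si\<close>(x''') x' hands the outer components of
  x to \<mu> and the inner ones to \<nu>, because \<open>Si\<close> reverses coproducts. This is the
  nesting produced when \<nu> acts before \<mu>.\<close>

lemma act_dual_mul:
  assumes [simp]: "\<mu> \<in> carr D" "\<nu> \<in> carr D" "t \<in> carr W"
  shows "act (tn (mul D \<mu> \<nu>) \<one>) t = act (tn \<mu> \<one>) (act (tn \<nu> \<one>) t)"
proof (rule tensor_linear_ext[OF lin_space_dual lin_space_W _ _ _ assms(3)])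
  fix \<beta> b assume [simp]: "\<beta> \<in> carr D" "b \<in> carr H"
  show "act (tn (mul D \<mu> \<nu>) \<one>) (tn \<beta> b) = act (tn \<mu> \<one>) (act (tn \<nu> \<one>) (tn \<beta> b))"
  proof (rule W_eqI)
    fix x f assume [simp]: "x \<in> carr H" and f [simp]: "linear_on H ground f"
    note [simp] = dual_linear_comp[of \<beta>] dual_linear_comp[of \<mu>] dual_linear_comp[of \<nu>] linear_form_comp[OF f]
    show "ev (act (tn (mul D \<mu> \<nu>) \<one>) (tn \<beta> b)) x f = ev (act (tn \<mu> \<one>) (act (tn \<nu> \<one>) (tn \<beta> b))) x f"
      by (simp add: ev_act_dual dual_mul_apply mul_assoc swn_swn mult_ac swn_swap[of b c for c])
  qed simp_all
qed simp_all

lemma act_alg_act_dual_trilinear: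
  assumes "\<nu> \<in> carr D" "t \<in> carr W"
  shows "\<And>m2 m3. m2 \<in> carr H \<Longrightarrow> m3 \<in> carr H \<Longrightarrow>
      linear_on H W (\<lambda>m1. act (tn (rreg H (lreg H m1 \<nu>) (Si m3)) \<one>) (act (tn (unt D) m2) t))"
    and "\<And>m1 m3. m1 \<in> carr H \<Longrightarrow> m3 \<in> carr H \<Longrightarrow>
      linear_on H W (\<lambda>m2. act (tn (rreg H (lreg H m1 \<nu>) (Si m3)) \<one>) (act (tn (unt D) m2) t))"
    and "\<And>m1 m2. m1 \<in> carr H \<Longrightarrow> m2 \<in> carr H \<Longrightarrow>
      linear_on H W (\<lambda>m3. act (tn (rreg H (lreg H m1 \<nu>) (Si m3)) \<one>) (act (tn (unt D) m2) t))"
  by ((intro linear_on_products vector_linear closed product_closed dual_unt_closed one_closed assms; assumption)+)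

text \<open>The commutation relation of the Drinfeld double, as a relation between operators on the Heisenberg double.\<close>

lemma act_alg_act_dual:
  assumes [simp]: "\<nu> \<in> carr D" "m \<in> carr H" and t [simp]: "t \<in> carr W"
  shows "act (tn (unt D) m) (act (tn \<nu> \<one>) t) =
    sw3 H (\<lambda>m1 m2 m3. act (tn (rreg H (lreg H m1 \<nu>) (Si m3)) \<one>) (act (tn (unt D) m2) t)) m"
proof (rule W_eqI)
  note tri = act_alg_act_dual_trilinear[OF assms(1,3)]
  show "sw3 H (\<lambda>m1 m2 m3. act (tn (rreg H (lreg H m1 \<nu>) (Si m3)) \<one>) (act (tn (unt D) m2) t)) m \<in> carr W"
    by (rule sw3_closed[OF lin_space_W tri]) simp_all
  fix x f assume [simp]: "x \<in> carr H" and f [simp]: "linear_on H ground f"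
  have "ev (act (tn (unt D) m) (act (tn \<nu> \<one>) t)) x f =
      swn 2 m (\<lambda>q. ev (act (tn (rreg H (lreg H (q 0) \<nu>) (Si (q 2))) \<one>) (act (tn (unt D) (q 1)) t)) x f)"
  proof (rule W_form_eqI[OF _ _ t])
    fix \<beta> b assume [simp]: "\<beta> \<in> carr D" "b \<in> carr H"
    note [simp] = dual_linear_comp[of \<beta>] dual_linear_comp[of \<nu>] linear_form_comp[OF f]
    show "ev (act (tn (unt D) m) (act (tn \<nu> \<one>) (tn \<beta> b))) x f =
      swn 2 m (\<lambda>q. ev (act (tn (rreg H (lreg H (q 0) \<nu>) (Si (q 2))) \<one>) (act (tn (unt D) (q 1)) (tn \<beta> b))) x f)"
    proof -
      \<comment> \<open>On the right-hand side \<open>Si\<close> is applied to a component of the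
        conjugate of b, which releases a component of m next to \<open>Si\<close>(m'''). After the
        pair \<open>Si\<close> of \<open>p 6\<close> and \<open>p 5\<close> has cancelled, five
        components remain, as on the other side.\<close>
      have "swn 6 m (\<lambda>p. \<beta> (u \<cdot> p (Suc 0)) * (\<nu> (Si (p 6) \<cdot> (p 5 \<cdot> (v \<cdot> (Si (p 2) \<cdot> (w \<cdot> (w' \<cdot> p 0)))))) *
            f (p 3 \<cdot> (c \<cdot> S (p 4))))) =
          swn 4 m (\<lambda>p. \<beta> (u \<cdot> p (Suc 0)) * (\<nu> (v \<cdot> (Si (p 2) \<cdot> (w \<cdot> (w' \<cdot> p 0)))) *
            f (p 3 \<cdot> (c \<cdot> S (p 4)))))"
        if [simp]: "u \<in> carr H" "v \<in> carr H" "w \<in> carr H" "w' \<in> carr H" "c \<in> carr H" for u v w w' c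
        using swn_contract[of m 5 5 "\<lambda>p q. \<beta> (u \<cdot> p (Suc 0)) * (\<nu> (Si (q 1) \<cdot> (q 0 \<cdot>
            (v \<cdot> (Si (p 2) \<cdot> (w \<cdot> (w' \<cdot> p 0)))))) * f (p 3 \<cdot> (c \<cdot> S (p 4))))"
          "\<lambda>p. \<beta> (u \<cdot> p (Suc 0)) * (\<nu> (v \<cdot> (Si (p 2) \<cdot> (w \<cdot> (w' \<cdot> p 0)))) *
            f (p 3 \<cdot> (c \<cdot> S (p 4))))"]
        by (simp add: Si_left_mid[where f = "\<lambda>z. \<beta> (u \<cdot> _) * (\<nu> z * f (_ \<cdot> (c \<cdot> S _)))"])
      then show ?thesis
        by (simp add: ev_act_dual ev_act_alg lreg_apply rreg_apply mul_assoc Si_mul swn_swn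
            swn_swap[of m c for c])
    qed
  qed simp_all
  also have "\<dots> = ev (sw3 H (\<lambda>m1 m2 m3. act (tn (rreg H (lreg H m1 \<nu>) (Si m3)) \<one>) (act (tn (unt D) m2) t)) m) x f"
    by (rule swn_form3[OF lin_space_W tri assms(2) ev_linear[OF f], symmetric])
  finally show "ev (act (tn (unt D) m) (act (tn \<nu> \<one>) t)) x f =
      ev (sw3 H (\<lambda>m1 m2 m3. act (tn (rreg H (lreg H m1 \<nu>) (Si m3)) \<one>) (act (tn (unt D) m2) t)) m) x f" .
qed simp_all

lemma act_one_left:
  assumes "t \<in> carr W"
  shows "act (tn (unt D) \<one>) t = t"
proof (rule tensor_linear_ext[OF lin_space_dual lin_space_W _ linear_on_id _ assms])
  fix \<beta> b assume [simp]: "\<beta> \<in> carr D" "b \<in> carr H"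
  show "act (tn (unt D) \<one>) (tn \<beta> b) = tn \<beta> b"
  proof (rule W_eqI)
    fix x f assume [simp]: "x \<in> carr H" and f [simp]: "linear_on H ground f"
    note [simp] = dual_linear_comp[of \<beta>] linear_form_comp[OF f]
    show "ev (act (tn (unt D) \<one>) (tn \<beta> b)) x f = ev (tn \<beta> b) x f"
      by (simp add: ev_act_alg swn2_one S_one unt_left unt_right)
  qed simp_all
qed simp_all

lemma DD_mul_form:
  assumes g: "linear_on W ground g"
    and [simp]: "\<mu> \<in> carr D" "m \<in> carr H" "\<nu> \<in> carr D" "n \<in> carr H"
  shows "g (mul DD (tn \<mu> m) (tn \<nu> n)) =
    swn 2 m (\<lambda>q. g (tn (mul D \<mu> (rreg H (lreg H (q 0) \<nu>) (Si (q 2)))) (q 1 \<cdot> n)))"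
proof -
  have "mul DD (tn \<mu> m) (tn \<nu> n) = drin_mul \<mu> m \<nu> n"
    by (simp add: DD_mul_tn)
  then show ?thesis
    unfolding drin_mul_def
    by (simp only: swn_form3[OF lin_space_W drin_mul_trilinear[OF assms(2,4,5)] assms(3) g])
qed

text \<open>Each summand of the product acts as \<mu>, then translated \<nu>, then a component of m,
  then n, read from the outside. Under the outermost \<mu> the commutation relation collapses the
  sum to m acting after \<nu>.\<close>

lemma act_mul:
  assumes "s \<in> carr W" "t \<in> carr W" "u \<in> carr W"
  shows "act (mul DD s t) u = act s (act t u)"
proof (rule W_trilinear_eqI[OF lin_space_W _ _ _ _ _ _ _ assms])
  fix \<mu> m \<nu> n \<beta> b
  assume [simp]: "\<mu> \<in> carr D" "m \<in> carr H" "\<nu> \<in> carr D" "n \<in> carr H" "\<beta> \<in> carr D" "b \<in> carr H"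
  show "act (mul DD (tn \<mu> m) (tn \<nu> n)) (tn \<beta> b) = act (tn \<mu> m) (act (tn \<nu> n) (tn \<beta> b))"
  proof (rule W_eqI)
    fix x f assume [simp]: "x \<in> carr H" and f [simp]: "linear_on H ground f"
    let ?t = "act (tn (unt D) n) (tn \<beta> b)"
    have "ev (act (mul DD (tn \<mu> m) (tn \<nu> n)) (tn \<beta> b)) x f =
        swn 2 m (\<lambda>q. ev (act (tn (mul D \<mu> (rreg H (lreg H (q 0) \<nu>) (Si (q 2)))) (q 1 \<cdot> n)) (tn \<beta> b)) x f)"
      by (rule DD_mul_form) simp_all
    also have "\<dots> = swn 2 m (\<lambda>q. ev (act (tn \<mu> \<one>)
        (act (tn (rreg H (lreg H (q 0) \<nu>) (Si (q 2))) \<one>) (act (tn (unt D) (q 1)) ?t))) x f)"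
      by (rule swn_cong)
        (simp_all add: act_split[of "mul D \<mu> _"] act_dual_mul act_alg_mul)
    also have "\<dots> = ev (act (tn \<mu> \<one>) (act (tn (unt D) m) (act (tn \<nu> \<one>) ?t))) x f"
    proof -
      have "linear_on W ground (\<lambda>u. ev (act (tn \<mu> \<one>) u) x f)" by simp
      from swn_form3[OF lin_space_W act_alg_act_dual_trilinear _ this]
      show ?thesis by (simp add: act_alg_act_dual)
    qed
    also have "\<dots> = ev (act (tn \<mu> m) (act (tn \<nu> n) (tn \<beta> b))) x f"
      by (simp add: act_split[of \<mu> m] act_split[of \<nu> n])
    finally show "ev (act (mul DD (tn \<mu> m) (tn \<nu> n)) (tn \<beta> b)) x f =
        ev (act (tn \<mu> m) (act (tn \<nu> n) (tn \<beta> b))) x f" .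
  qed simp_all
qed simp_all

text \<open>On the unit \<mu> leaves \<mu>(\<open>Si\<close>(x'') x') and m leaves m' S(m''), and
  each pair cancels to a counit.\<close>

lemma act_unit:
  assumes t: "t \<in> carr W"
  shows "act t (tn (unt D) \<one>) = fscale (counit DD t) (tn (unt D) \<one>)"
proof (rule tensor_linear_ext[OF lin_space_dual lin_space_W _ _ _ t, where f = "\<lambda>t. act t (tn (unt D) \<one>)"])
  show "linear_on W W (\<lambda>t. fscale (counit DD t) (tn (unt D) \<one>))"
    by (intro linear_on_W_fscale counit_DD_linear) simp
  fix \<mu> m assume [simp]: "\<mu> \<in> carr D" "m \<in> carr H"
  have dual: "act (tn \<mu> \<one>) (tn (unt D) \<one>) = fscale (\<mu> \<one>) (tn (unt D) \<one>)"
  proof (rule W_eqI)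
    fix x f assume [simp]: "x \<in> carr H" and f [simp]: "linear_on H ground f"
    note [simp] = dual_linear_comp[of \<mu>] linear_form_comp[OF f]
    show "ev (act (tn \<mu> \<one>) (tn (unt D) \<one>)) x f = ev (fscale (\<mu> \<one>) (tn (unt D) \<one>)) x f"
      using Si_left_end[of "\<lambda>u. f \<one> * \<mu> u" x]
      by (simp add: ev_act_dual swn1_one Si_one unt_left mult_ac)
  qed simp_all
  have alg: "act (tn (unt D) m) (tn (unt D) \<one>) = fscale (\<epsilon> m) (tn (unt D) \<one>)"
  proof (rule W_eqI)
    fix x f assume [simp]: "x \<in> carr H" and f [simp]: "linear_on H ground f"
    note [simp] = linear_form_comp[OF f]
    show "ev (act (tn (unt D) m) (tn (unt D) \<one>)) x f = ev (fscale (\<epsilon> m) (tn (unt D) \<one>)) x f"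
      using antipode_right_end[of "\<lambda>u. \<epsilon> x * f u" m]
      by (simp add: ev_act_alg unt_left counit_mul mult.assoc)
  qed simp_all
  have "act (tn \<mu> m) (tn (unt D) \<one>) = act (tn \<mu> \<one>) (fscale (\<epsilon> m) (tn (unt D) \<one>))"
    by (simp add: act_split[of \<mu> m] alg)
  also have "\<dots> = fscale (\<epsilon> m) (act (tn \<mu> \<one>) (tn (unt D) \<one>))"
    using act_bilinear by (simp add: bilinear_on_def linear_on_def)
  finally show "act (tn \<mu> m) (tn (unt D) \<one>) = fscale (counit DD (tn \<mu> m)) (tn (unt D) \<one>)"
    by (simp add: dual counit_DD counit_linear mult.commute)
qed simp_all

text \<open>The mechanism is that of the coproduct: the first tensor factor, multiplied in the
  Drinfeld double, contributes \<open>Si\<close>(a3), and the second, multiplied in the Heisenberg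
  double, contributes a4 directly before it. Since the Heisenberg product translates on one side
  only, five components of a occur instead of six.\<close>

lemma coact_prod:
  assumes s: "s \<in> carr W" and t: "t \<in> carr W"
  shows "comul DD (mul X s t) = mul (tensor_algebra DD X) (comul DD s) (comul DD t)"
proof (rule WW_eqI)
  fix x f y g
  assume [simp]: "x \<in> carr H" "y \<in> carr H"
    and f [simp]: "linear_on H ground f" and g [simp]: "linear_on H ground g"
  note form = comul_mul_form[OF k_algebra_X _ _ f g]
  note [simp] = linear_form_comp[OF f] linear_form_comp[OF g]
  show "ev2 (comul DD (mul X s t)) x f y g =
      ev2 (mul (tensor_algebra DD X) (comul DD s) (comul DD t)) x f y g"
  proof (rule W_bilinear_form_eqI[OF _ _ _ _ _ s t,
        where F = "\<lambda>s t. ev2 (comul DD (mul X s t)) x f y g"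
          and G = "\<lambda>s t. ev2 (mul (tensor_algebra DD X) (comul DD s) (comul DD t)) x f y g"])
    fix \<alpha> a \<beta> b
    assume [simp]: "\<alpha> \<in> carr D" "a \<in> carr H" "\<beta> \<in> carr D" "b \<in> carr H"
    note [simp] = dual_linear_comp[of \<alpha>] dual_linear_comp[of \<beta>]
    have contract: "swn 4 a (\<lambda>q. c * (\<beta> (u \<cdot> (q 3 \<cdot> (Si (q 2) \<cdot> (v \<cdot> q 0)))) *
          (f (q (Suc 0) \<cdot> r) * g (q 4 \<cdot> r')))) =
        swn 2 a (\<lambda>q. c * (\<beta> (u \<cdot> (v \<cdot> q 0)) * (f (q (Suc 0) \<cdot> r) * g (q 2 \<cdot> r'))))"
      if [simp]: "u \<in> carr H" "v \<in> carr H" "r \<in> carr H" "r' \<in> carr H" for c u v r r'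
      using swn_contract[of a 2 3 "\<lambda>p q. c * (\<beta> (u \<cdot> (q 1 \<cdot> (Si (q 0) \<cdot> (v \<cdot> p 0)))) *
          (f (p 1 \<cdot> r) * g (p 3 \<cdot> r')))"
        "\<lambda>p. c * (\<beta> (u \<cdot> (v \<cdot> p 0)) * (f (p 1 \<cdot> r) * g (p 3 \<cdot> r')))"]
      by (simp add: Si_right_mid[where
            f = "\<lambda>z. c * (\<beta> (u \<cdot> z) * (f (_ (Suc 0) \<cdot> r) * g (_ 3 \<cdot> r')))"])
    show "ev2 (comul DD (mul X (tn \<alpha> a) (tn \<beta> b))) x f y g =
        ev2 (mul (tensor_algebra DD X) (comul DD (tn \<alpha> a)) (comul DD (tn \<beta> b))) x f y g"
      by (simp add: form(3) ev2_comul ev_X ev_DD swn_swn mul_assoc mult.assoc dsw_simps contract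
          swn_swap[of a c for c] swn_swap[of b x] swn_swap[of b y]
          mult.left_commute[of "f _" "\<alpha> _"] mult.left_commute[of "f _" "\<beta> _"])
  qed (simp_all add: form(1,2))
qed (simp_all add: s t comul_mul_closed[OF k_algebra_X])

lemma ev_X_act_dual:
  assumes [simp]: "\<nu> \<in> carr D" "\<alpha> \<in> carr D" "a \<in> carr H" "t \<in> carr W" "x \<in> carr H"
    and f [simp]: "linear_on H ground f"
  shows "ev (mul X (act (tn \<nu> \<one>) (tn \<alpha> a)) t) x f =
    swn 3 x (\<lambda>p. swn 2 a (\<lambda>q. \<alpha> (p 1) * (\<nu> (Si (q 0) \<cdot> (Si (p 2) \<cdot> p 0)) *
      ev t (p 3 \<cdot> q 1) (\<lambda>b. f (q 2 \<cdot> b)))))"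
proof (rule W_form_eqI[OF _ _ assms(4)])
  note [simp] = dual_linear_comp[of \<nu>] dual_linear_comp[of \<alpha>] linear_form_comp[OF f]
  show "linear_on W ground (\<lambda>t. ev (mul X (act (tn \<nu> \<one>) (tn \<alpha> a)) t) x f)" by simp
  show "linear_on W ground (\<lambda>t. swn 3 x (\<lambda>p. swn 2 a (\<lambda>q. \<alpha> (p 1) *
      (\<nu> (Si (q 0) \<cdot> (Si (p 2) \<cdot> p 0)) * ev t (p 3 \<cdot> q 1) (\<lambda>b. f (q 2 \<cdot> b))))))" by simp
  fix \<beta> b assume [simp]: "\<beta> \<in> carr D" "b \<in> carr H"
  note [simp] = dual_linear_comp[of \<beta>]
  show "ev (mul X (act (tn \<nu> \<one>) (tn \<alpha> a)) (tn \<beta> b)) x f =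
    swn 3 x (\<lambda>p. swn 2 a (\<lambda>q. \<alpha> (p 1) * (\<nu> (Si (q 0) \<cdot> (Si (p 2) \<cdot> p 0)) *
      ev (tn \<beta> b) (p 3 \<cdot> q 1) (\<lambda>b. f (q 2 \<cdot> b)))))"
    by (simp add: ev_X' ev_act_dual swn_swn mul_assoc mult.assoc)
qed

lemma ev_X_act_alg:
  assumes [simp]: "m \<in> carr H" "\<alpha> \<in> carr D" "a \<in> carr H" "t \<in> carr W" "x \<in> carr H"
    and f [simp]: "linear_on H ground f"
  shows "ev (mul X (act (tn (unt D) m) (tn \<alpha> a)) t) x f =
    swn 1 x (\<lambda>p. swn 4 m (\<lambda>q. swn 1 a (\<lambda>r. \<alpha> (p 0 \<cdot> q 0) *
      ev t (p 1 \<cdot> (q 1 \<cdot> (r 0 \<cdot> S (q 4)))) (\<lambda>b. f (q 2 \<cdot> (r 1 \<cdot> (S (q 3) \<cdot> b)))))))"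
proof (rule W_form_eqI[OF _ _ assms(4)])
  note [simp] = dual_linear_comp[of \<alpha>] linear_form_comp[OF f]
  show "linear_on W ground (\<lambda>t. ev (mul X (act (tn (unt D) m) (tn \<alpha> a)) t) x f)" by simp
  show "linear_on W ground (\<lambda>t. swn 1 x (\<lambda>p. swn 4 m (\<lambda>q. swn 1 a (\<lambda>r. \<alpha> (p 0 \<cdot> q 0) *
      ev t (p 1 \<cdot> (q 1 \<cdot> (r 0 \<cdot> S (q 4)))) (\<lambda>b. f (q 2 \<cdot> (r 1 \<cdot> (S (q 3) \<cdot> b))))))))" by simp
  fix \<beta> b assume [simp]: "\<beta> \<in> carr D" "b \<in> carr H"
  note [simp] = dual_linear_comp[of \<beta>]
  show "ev (mul X (act (tn (unt D) m) (tn \<alpha> a)) (tn \<beta> b)) x f =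
    swn 1 x (\<lambda>p. swn 4 m (\<lambda>q. swn 1 a (\<lambda>r. \<alpha> (p 0 \<cdot> q 0) *
      ev (tn \<beta> b) (p 1 \<cdot> (q 1 \<cdot> (r 0 \<cdot> S (q 4)))) (\<lambda>b. f (q 2 \<cdot> (r 1 \<cdot> (S (q 3) \<cdot> b)))))))"
    by (simp add: ev_X' ev_act_alg swn_swn mul_assoc mult.assoc swn_swap[of m a])
qed

text \<open>The opposite coproduct makes \<open>\<nu>2\<close> act on the first factor. Recombining
  the two components of \<nu> brings two neighbouring components of a together, and their removal
  lets two components of x meet in turn.\<close>

lemma act_dual_prod:
  assumes \<nu> [simp]: "\<nu> \<in> carr D" and s: "s \<in> carr W" and t: "t \<in> carr W"
    and x [simp]: "x \<in> carr H" and f [simp]: "linear_on H ground f"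
  shows "ev (act (tn \<nu> \<one>) (mul X s t)) x f =
    dsw \<nu> (\<lambda>\<nu>1 \<nu>2. ev (mul X (act (tn \<nu>2 \<one>) s) (act (tn \<nu>1 \<one>) t)) x f)"
proof (rule W_bilinear_form_eqI[OF _ _ _ _ _ s t,
      where F = "\<lambda>s t. ev (act (tn \<nu> \<one>) (mul X s t)) x f"
        and G = "\<lambda>s t. dsw \<nu> (\<lambda>\<nu>1 \<nu>2. ev (mul X (act (tn \<nu>2 \<one>) s) (act (tn \<nu>1 \<one>) t)) x f)"])
  fix \<alpha> a \<beta> b
  assume [simp]: "\<alpha> \<in> carr D" "a \<in> carr H" "\<beta> \<in> carr D" "b \<in> carr H"
  note [simp] = linear_form_comp[OF f] dual_linear_comp[of \<alpha>] dual_linear_comp[of \<beta>] dual_linear_comp[of \<nu>]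
  have c1: "swn 4 a (\<lambda>q. c * (\<nu> (u \<cdot> (Si (q 3) \<cdot> (v \<cdot> (v' \<cdot> (q (Suc 0) \<cdot> (Si (q 0) \<cdot> w)))))) * (\<beta> (y \<cdot> q 2) * f (q 4 \<cdot> r)))) =
      swn 2 a (\<lambda>q. c * (\<nu> (u \<cdot> (Si (q (Suc 0)) \<cdot> (v \<cdot> (v' \<cdot> w)))) * (\<beta> (y \<cdot> q 0) * f (q 2 \<cdot> r))))"
    if [simp]: "u \<in> carr H" "v \<in> carr H" "v' \<in> carr H" "w \<in> carr H" "y \<in> carr H" "r \<in> carr H" for c u v v' w y r
    using swn_contract[of a 0 3 "\<lambda>p q. c * (\<nu> (u \<cdot> (Si (p 2) \<cdot> (v \<cdot> (v' \<cdot> (q 1 \<cdot> (Si (q 0) \<cdot> w)))))) * (\<beta> (y \<cdot> p 1) * f (p 3 \<cdot> r)))"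
      "\<lambda>p. c * (\<nu> (u \<cdot> (Si (p 2) \<cdot> (v \<cdot> (v' \<cdot> w)))) * (\<beta> (y \<cdot> p 1) * f (p 3 \<cdot> r)))"]
    by (simp add: Si_right_mid[where
          f = "\<lambda>z. c * (\<nu> (u \<cdot> (Si (_ 2) \<cdot> (v \<cdot> (v' \<cdot> z)))) * (\<beta> (y \<cdot> _ (Suc 0)) * f (_ 3 \<cdot> r)))"])
  \<comment> \<open>This pair becomes adjacent in the argument of \<nu> only after \<open>c1\<close>
    has removed the components of a between its two members.\<close>
  have c2: "swn 5 x (\<lambda>q. \<alpha> (q (Suc 0)) * (\<nu> (u \<cdot> (u' \<cdot> (Si (q 5) \<cdot> (q 3 \<cdot> (Si (q 2) \<cdot> q 0))))) * (\<beta> (q 4 \<cdot> y) * c))) =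
      swn 3 x (\<lambda>q. \<alpha> (q (Suc 0)) * (\<nu> (u \<cdot> (u' \<cdot> (Si (q 3) \<cdot> q 0))) * (\<beta> (q 2 \<cdot> y) * c)))"
    if [simp]: "u \<in> carr H" "u' \<in> carr H" "y \<in> carr H" for c u u' y
    using swn_contract[of x 2 4 "\<lambda>p q. \<alpha> (p 1) * (\<nu> (u \<cdot> (u' \<cdot> (Si (p 4) \<cdot> (q 1 \<cdot> (Si (q 0) \<cdot> p 0))))) * (\<beta> (p 3 \<cdot> y) * c))"
      "\<lambda>p. \<alpha> (p 1) * (\<nu> (u \<cdot> (u' \<cdot> (Si (p 4) \<cdot> p 0))) * (\<beta> (p 3 \<cdot> y) * c))"]
    by (simp add: Si_right_mid[where
          f = "\<lambda>z. \<alpha> (_ (Suc 0)) * (\<nu> (u \<cdot> (u' \<cdot> (Si (_ 4) \<cdot> z))) * (\<beta> (_ 3 \<cdot> y) * c))"])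
  show "ev (act (tn \<nu> \<one>) (mul X (tn \<alpha> a) (tn \<beta> b))) x f =
      dsw \<nu> (\<lambda>\<nu>1 \<nu>2. ev (mul X (act (tn \<nu>2 \<one>) (tn \<alpha> a)) (act (tn \<nu>1 \<one>) (tn \<beta> b))) x f)"
    by (simp add: ev_X_act_dual ev_X ev_act_dual swn_swn mul_assoc mult.assoc Si_mul dsw_simps
        swn_swap[of a c for c] swn_swap[of b x] mult.left_commute[of "f _" "\<nu> _"] mult.left_commute[of "\<beta> _" "\<nu> _"] c1)
      (simp add: swn_swap[of x c for c] c2)
qed simp_all

text \<open>Conjugating each factor separately inserts S(m5) m6 into the argument of \<beta> and
  S(m4) m7 into that of f. Only m5 and m6 are consecutive components at first; once they are gone,
  m4 and m7 are consecutive too.\<close>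

lemma act_alg_prod:
  assumes m [simp]: "m \<in> carr H" and s: "s \<in> carr W" and t: "t \<in> carr W"
    and x [simp]: "x \<in> carr H" and f [simp]: "linear_on H ground f"
  shows "ev (act (tn (unt D) m) (mul X s t)) x f =
    swn 1 m (\<lambda>p. ev (mul X (act (tn (unt D) (p 0)) s) (act (tn (unt D) (p 1)) t)) x f)"
proof (rule W_bilinear_form_eqI[OF _ _ _ _ _ s t,
      where F = "\<lambda>s t. ev (act (tn (unt D) m) (mul X s t)) x f"
        and G = "\<lambda>s t. swn 1 m (\<lambda>p. ev (mul X (act (tn (unt D) (p 0)) s) (act (tn (unt D) (p 1)) t)) x f)"])
  fix \<alpha> a \<beta> b
  assume [simp]: "\<alpha> \<in> carr D" "a \<in> carr H" "\<beta> \<in> carr D" "b \<in> carr H"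
  note [simp] = linear_form_comp[OF f] dual_linear_comp[of \<alpha>] dual_linear_comp[of \<beta>]
  have c1: "swn 7 m (\<lambda>p. \<alpha> (u \<cdot> p 0) * (\<beta> (y \<cdot> (p (Suc 0) \<cdot> (r \<cdot> (S (p 4) \<cdot> p 5)))) *
        f (p 2 \<cdot> (r' \<cdot> (S (p 3) \<cdot> (p 6 \<cdot> (b \<cdot> S (p 7)))))))) =
      swn 3 m (\<lambda>p. \<alpha> (u \<cdot> p 0) * (\<beta> (y \<cdot> (p (Suc 0) \<cdot> r)) * f (p 2 \<cdot> (r' \<cdot> (b \<cdot> S (p 3))))))"
    if [simp]: "u \<in> carr H" "y \<in> carr H" "r \<in> carr H" "r' \<in> carr H" for u y r r'
  proof -
    have "swn 7 m (\<lambda>p. \<alpha> (u \<cdot> p 0) * (\<beta> (y \<cdot> (p (Suc 0) \<cdot> (r \<cdot> (S (p 4) \<cdot> p 5)))) *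
        f (p 2 \<cdot> (r' \<cdot> (S (p 3) \<cdot> (p 6 \<cdot> (b \<cdot> S (p 7)))))))) =
      swn 5 m (\<lambda>p. \<alpha> (u \<cdot> p 0) * (\<beta> (y \<cdot> (p (Suc 0) \<cdot> r)) * f (p 2 \<cdot> (r' \<cdot> (S (p 3) \<cdot> (p 4 \<cdot> (b \<cdot> S (p 5))))))))"
      using swn_contract[of m 4 6 "\<lambda>p q. \<alpha> (u \<cdot> p 0) * (\<beta> (y \<cdot> (p 1 \<cdot> (r \<cdot> (S (q 0) \<cdot> q 1)))) *
          f (p 2 \<cdot> (r' \<cdot> (S (p 3) \<cdot> (p 5 \<cdot> (b \<cdot> S (p 6)))))))"
        "\<lambda>p. \<alpha> (u \<cdot> p 0) * (\<beta> (y \<cdot> (p 1 \<cdot> r)) * f (p 2 \<cdot> (r' \<cdot> (S (p 3) \<cdot> (p 5 \<cdot> (b \<cdot> S (p 6)))))))"]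
      by (simp add: unt_right antipode_left_end[where f = "\<lambda>z. \<alpha> (u \<cdot> _ 0) * (\<beta> (y \<cdot> (_ (Suc 0) \<cdot> (r \<cdot> z))) *
          f (_ 2 \<cdot> (r' \<cdot> (S (_ 3) \<cdot> (_ 5 \<cdot> (b \<cdot> S (_ 6)))))))"])
    also have "\<dots> = swn 3 m (\<lambda>p. \<alpha> (u \<cdot> p 0) * (\<beta> (y \<cdot> (p (Suc 0) \<cdot> r)) * f (p 2 \<cdot> (r' \<cdot> (b \<cdot> S (p 3))))))"
      using swn_contract[of m 3 4 "\<lambda>p q. \<alpha> (u \<cdot> p 0) * (\<beta> (y \<cdot> (p 1 \<cdot> r)) *
          f (p 2 \<cdot> (r' \<cdot> (S (q 0) \<cdot> (q 1 \<cdot> (b \<cdot> S (p 4)))))))"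
        "\<lambda>p. \<alpha> (u \<cdot> p 0) * (\<beta> (y \<cdot> (p 1 \<cdot> r)) * f (p 2 \<cdot> (r' \<cdot> (b \<cdot> S (p 4)))))"]
      by (simp add: antipode_left_mid[where f = "\<lambda>z. \<alpha> (u \<cdot> _ 0) * (\<beta> (y \<cdot> (_ (Suc 0) \<cdot> r)) * f (_ 2 \<cdot> (r' \<cdot> z)))"])
    finally show ?thesis .
  qed
  show "ev (act (tn (unt D) m) (mul X (tn \<alpha> a) (tn \<beta> b))) x f =
      swn 1 m (\<lambda>p. ev (mul X (act (tn (unt D) (p 0)) (tn \<alpha> a)) (act (tn (unt D) (p 1)) (tn \<beta> b))) x f)"
    by (simp add: ev_X_act_alg ev_X ev_act_alg swn_swn mul_assoc mult.assoc swn_swap[of m c for c])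
      (simp add: c1)
qed simp_all

text \<open>The element of \<open>H\<close> acts first and distributes over the product along its
  own coproduct; the functional then distributes over each of the resulting products.\<close>

lemma act_prod:
  assumes h: "h \<in> carr W" and [simp]: "s \<in> carr W" "t \<in> carr W"
  shows "act h (mul X s t) = tensor_lift W W (\<lambda>h1 h2. mul X (act h1 s) (act h2 t)) (comul DD h)"
proof -
  have bil: "bilinear_on W W W (\<lambda>h1 h2. mul X (act h1 s) (act h2 t))"
    by (rule bilinear_onI) simp_all
  show ?thesis
  proof (rule tensor_linear_ext[OF lin_space_dual lin_space_W _ linear_on_comul_lift_vec[OF lin_space_W bil] _ h,
        where f = "\<lambda>h. act h (mul X s t)"])
    fix \<nu> m assume [simp]: "\<nu> \<in> carr D" "m \<in> carr H"
    show "act (tn \<nu> m) (mul X s t) = tensor_lift W W (\<lambda>h1 h2. mul X (act h1 s) (act h2 t)) (comul DD (tn \<nu> m))"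
    proof (rule W_eqI)
      fix x f assume [simp]: "x \<in> carr H" and f [simp]: "linear_on H ground f"
      have bil': "bilinear_on H H W (\<lambda>m1 m2. mul X (act (tn (unt D) m1) s) (act (tn (unt D) m2) t))"
        by (intro bilinear_onI linear_on_products vector_linear product_closed closed dual_unt_closed) simp_all
      have alg: "act (tn (unt D) m) (mul X s t) =
          sw2 H (\<lambda>m1 m2. mul X (act (tn (unt D) m1) s) (act (tn (unt D) m2) t)) m"
        by (rule W_eqI) (simp_all add: act_alg_prod swn_form[OF lin_space_W bil' ev_linear] linear_on_closed[OF sw2_linear[OF lin_space_W bil']])
      have lin: "linear_on W ground (\<lambda>u. ev (act (tn \<nu> \<one>) u) x f)" by simp
      \<comment> \<open>Factoring both actions leaves sums over \<nu> that involve functionals only,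
        so the case m = \<one> applies to the factors already acted on by \<open>a\<close> and
        \<open>b\<close>.\<close>
      have pair: "dsw \<nu> (\<lambda>\<nu>1 \<nu>2. ev (mul X (act (tn \<nu>2 a) s) (act (tn \<nu>1 b) t)) x f) =
          ev (act (tn \<nu> \<one>) (mul X (act (tn (unt D) a) s) (act (tn (unt D) b) t))) x f"
        if [simp]: "a \<in> carr H" "b \<in> carr H" for a b
      proof -
        have "mul X (act (tn \<nu>2 a) s) (act (tn \<nu>1 b) t) =
            mul X (act (tn \<nu>2 \<one>) (act (tn (unt D) a) s)) (act (tn \<nu>1 \<one>) (act (tn (unt D) b) t))"
          if "\<nu>1 \<in> carr D" "\<nu>2 \<in> carr D" for \<nu>1 \<nu>2
          using that act_split[of \<nu>2 a s] act_split[of \<nu>1 b t] by simp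
        then show ?thesis
          by (subst act_dual_prod) (simp_all cong: dsw_cong)
      qed
      have "ev (act (tn \<nu> m) (mul X s t)) x f = ev (act (tn \<nu> \<one>) (act (tn (unt D) m) (mul X s t))) x f"
        by (simp add: act_split[of \<nu> m])
      also have "\<dots> = swn 1 m (\<lambda>p. ev (act (tn \<nu> \<one>) (mul X (act (tn (unt D) (p 0)) s) (act (tn (unt D) (p 1)) t))) x f)"
        unfolding alg swn_form[OF lin_space_W bil' lin \<open>m \<in> carr H\<close>] by (simp only: One_nat_def)
      also have "\<dots> = ev (tensor_lift W W (\<lambda>h1 h2. mul X (act h1 s) (act h2 t)) (comul DD (tn \<nu> m))) x f"
        by (subst comul_DD_form[OF lin_space_W bil ev_linear[OF f]])
          (simp_all add: pair dsw_swn)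
      finally show "ev (act (tn \<nu> m) (mul X s t)) x f =
          ev (tensor_lift W W (\<lambda>h1 h2. mul X (act h1 s) (act h2 t)) (comul DD (tn \<nu> m))) x f" .
    qed (simp_all add: tensor_lift_closed[OF lin_space_W lin_space_W bil])
  qed simp_all
qed

section \<open>The Yetter-Drinfeld condition\<close>

lemma swn2_S [simp]:
  assumes x [simp]: "x \<in> carr H"
    and lin: "\<And>p. (\<And>j. p j \<in> carr H) \<Longrightarrow> linear_on H ground (\<lambda>a. F (p(0 := a)))"
      "\<And>p. (\<And>j. p j \<in> carr H) \<Longrightarrow> linear_on H ground (\<lambda>a. F (p(Suc 0 := a)))"
      "\<And>p. (\<And>j. p j \<in> carr H) \<Longrightarrow> linear_on H ground (\<lambda>a. F (p(2 := a)))"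
    and dep: "\<And>p p'. \<forall>j\<le>2. p j = p' j \<Longrightarrow> F p = F p'"
  shows "swn 2 (S x) F = swn 2 x (\<lambda>p. F (\<lambda>j. S (p (2 - j))))"
proof -
  define f where "f a b c = F ((\<lambda>_. c)(0 := a, Suc 0 := b))" for a b c
  have F: "F p = f (p 0) (p 1) (p 2)" for p
    unfolding f_def
  proof (rule dep, intro allI impI)
    fix j :: nat assume "j \<le> 2"
    then consider "j = 0" | "j = Suc 0" | "j = 2" by linarith
    then show "p j = ((\<lambda>_. p 2)(0 := p 0, Suc 0 := p 1)) j" by cases simp_all
  qed
  have lin1: "linear_on H ground (\<lambda>a. f a b c)" if "b \<in> carr H" "c \<in> carr H" for b c
    using lin(1)[of "(\<lambda>_. c)(Suc 0 := b)"] that by (simp add: F)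
  have lin2: "linear_on H ground (\<lambda>b. f a b c)" if "a \<in> carr H" "c \<in> carr H" for a c
    using lin(2)[of "(\<lambda>_. c)(0 := a)"] that by (simp add: F)
  have lin3: "linear_on H ground (\<lambda>c. f a b c)" if "a \<in> carr H" "b \<in> carr H" for a b
    using lin(3)[of "(\<lambda>_. b)(0 := a)"] that by (simp add: F)
  note [simp] = linear_on_comp[OF lin1] linear_on_comp[OF lin2] linear_on_comp[OF lin3]
  have "swn 2 (S x) (\<lambda>p. f (p 0) (p 1) (p 2)) =
      swn (Suc 0) (S x) (\<lambda>p. swn (Suc 0) (p 0) (\<lambda>q. f (q 0) (q 1) (p 1)))"
    by (simp add: swn_swn del: swn1_S)
  also have "\<dots> = swn (Suc 0) x (\<lambda>p. swn (Suc 0) (S (p 1)) (\<lambda>q. f (q 0) (q 1) (S (p 0))))"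
    by (subst swn1_S(1)) (simp_all add: le_Suc_eq del: swn1_S cong del: swn_cong')
  also have "\<dots> = swn 2 x (\<lambda>p. f (S (p 2)) (S (p 1)) (S (p 0)))"
    by (simp add: swn_swn)
  finally show ?thesis by (simp add: F)
qed

lemma ev_coact_DD_mul_right:
  assumes [simp]: "t \<in> carr W" "\<nu> \<in> carr D" "n \<in> carr H" "x \<in> carr H" "y \<in> carr H"
    and f [simp]: "linear_on H ground f" and g [simp]: "linear_on H ground g"
  shows "ev2 (tensor_lift W W (\<lambda>u v. tens W W (mul DD u (tn \<nu> n)) v) (comul DD t)) x f y g =
    swn 1 x (\<lambda>p. ev t (y \<cdot> p 0) (\<lambda>b. swn 3 b (\<lambda>q. \<nu> (Si (q 2) \<cdot> (p 1 \<cdot> q 0)) * (f (q 1 \<cdot> n) * g (q 3)))))"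
proof -
  have bil: "bilinear_on W W WW (\<lambda>u v. tens W W (mul DD u (tn \<nu> n)) v)"
    by (intro bilinear_onI vector_linear linear_on_products) simp_all
  note lin = linear_on_comp[OF ev2_linear[OF f g] linear_on_comul_lift_vec[OF lin_space_tensor bil]]
  note [simp] = dual_linear_comp[of \<nu>] linear_form_comp[OF f] linear_form_comp[OF g]
  show ?thesis
  proof (rule W_form_eqI[OF lin _ assms(1)])
    fix \<gamma> c assume [simp]: "\<gamma> \<in> carr D" "c \<in> carr H"
    note [simp] = dual_linear_comp[of \<gamma>]
    show "ev2 (tensor_lift W W (\<lambda>u v. tens W W (mul DD u (tn \<nu> n)) v) (comul DD (tn \<gamma> c))) x f y g =
      swn 1 x (\<lambda>p. ev (tn \<gamma> c) (y \<cdot> p 0) (\<lambda>b. swn 3 b (\<lambda>q. \<nu> (Si (q 2) \<cdot> (p 1 \<cdot> q 0)) * (f (q 1 \<cdot> n) * g (q 3)))))"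
      by (subst comul_DD_form[OF lin_space_tensor bil ev2_linear[OF f g]])
        (simp_all add: ev_DD swn_swn mult.assoc dsw_simps swn_swap[of c x]
          mult.left_commute[of "f _" "\<gamma> _"] mult.left_commute[of "\<nu> _" "\<gamma> _"])
  qed simp
qed

text \<open>The common value with the other side of the condition is found by exhausting all
  cancellations: \<beta>(y'' x'' m1) \<nu>(m6 \<open>Si\<close>(b'') \<open>Si\<close>(m3)
  \<open>Si\<close>(y''') y' x') f(m2 b') g(m4 b''' S(m5)). Three pairs cancel here, one each in the
  conjugate of b, in x and in m.\<close>

lemma yetter_drinfeld_left:
  assumes [simp]: "\<nu> \<in> carr D" "m \<in> carr H" "\<beta> \<in> carr D" "b \<in> carr H" "x \<in> carr H" "y \<in> carr H"
    and f [simp]: "linear_on H ground f" and g [simp]: "linear_on H ground g"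
  shows "dsw \<nu> (\<lambda>\<nu>1 \<nu>2. swn 1 m (\<lambda>p. ev2 (tensor_lift W W (\<lambda>u v. tens W W (mul DD u (tn \<nu>1 (p 1))) v)
        (comul DD (act (tn \<nu>2 (p 0)) (tn \<beta> b)))) x f y g)) =
    swn 1 x (\<lambda>p. swn 2 y (\<lambda>q. swn 2 b (\<lambda>r. swn 5 m (\<lambda>k. \<beta> (q 1 \<cdot> (p 1 \<cdot> k 0)) *
      (\<nu> (k 5 \<cdot> (Si (r 1) \<cdot> (Si (k 2) \<cdot> (Si (q 2) \<cdot> (q 0 \<cdot> p 0))))) *
        (f (k 1 \<cdot> r 0) * g (k 3 \<cdot> (r 2 \<cdot> S (k 4)))))))))"
proof -
  note [simp] = linear_form_comp[OF f] linear_form_comp[OF g] dual_linear_comp[of \<beta>] dual_linear_comp[of \<nu>]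
  \<comment> \<open>\<open>w\<close> is the conjugate of b: the coaction after the action splits it
    into five components, and the second meets \<open>Si\<close> of the first.\<close>
  have c1: "swn 4 w (\<lambda>r. c * (\<nu> (Si (r 3) \<cdot> (v \<cdot> (r (Suc 0) \<cdot> (Si (r 0) \<cdot> u)))) * (f (r 2 \<cdot> n) * g (r 4)))) =
      swn 2 w (\<lambda>r. c * (\<nu> (Si (r (Suc 0)) \<cdot> (v \<cdot> u)) * (f (r 0 \<cdot> n) * g (r 2))))"
    if [simp]: "w \<in> carr H" "v \<in> carr H" "u \<in> carr H" "n \<in> carr H" for c w v u n
    using swn_contract[of w 0 3 "\<lambda>p q. c * (\<nu> (Si (p 2) \<cdot> (v \<cdot> (q 1 \<cdot> (Si (q 0) \<cdot> u)))) * (f (p 1 \<cdot> n) * g (p 3)))"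
      "\<lambda>p. c * (\<nu> (Si (p 2) \<cdot> (v \<cdot> u)) * (f (p 1 \<cdot> n) * g (p 3)))"]
    by (simp add: Si_right_mid[where
          f = "\<lambda>z. c * (\<nu> (Si (_ 2) \<cdot> (v \<cdot> z)) * (f (_ (Suc 0) \<cdot> n) * g (_ 3)))"])
  have c2: "swn 3 x (\<lambda>p. \<beta> (u \<cdot> (p (Suc 0) \<cdot> u')) *
        (\<nu> (w1 \<cdot> (w2 \<cdot> (w3 \<cdot> (p 3 \<cdot> (Si (p 2) \<cdot> (w4 \<cdot> (w5 \<cdot> p 0))))))) * c)) =
      swn 1 x (\<lambda>p. \<beta> (u \<cdot> (p 1 \<cdot> u')) * (\<nu> (w1 \<cdot> (w2 \<cdot> (w3 \<cdot> (w4 \<cdot> (w5 \<cdot> p 0))))) * c))"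
    if [simp]: "u \<in> carr H" "u' \<in> carr H" "w1 \<in> carr H" "w2 \<in> carr H" "w3 \<in> carr H" "w4 \<in> carr H" "w5 \<in> carr H"
    for u u' w1 w2 w3 w4 w5 c
    using swn_contract[of x 2 2 "\<lambda>p q. \<beta> (u \<cdot> (p 1 \<cdot> u')) *
        (\<nu> (w1 \<cdot> (w2 \<cdot> (w3 \<cdot> (q 1 \<cdot> (Si (q 0) \<cdot> (w4 \<cdot> (w5 \<cdot> p 0))))))) * c)"
      "\<lambda>p. \<beta> (u \<cdot> (p 1 \<cdot> u')) * (\<nu> (w1 \<cdot> (w2 \<cdot> (w3 \<cdot> (w4 \<cdot> (w5 \<cdot> p 0))))) * c)"]
    by (simp add: Si_right_mid[where
          f = "\<lambda>z. \<beta> (u \<cdot> (_ (Suc 0) \<cdot> u')) * (\<nu> (w1 \<cdot> (w2 \<cdot> (w3 \<cdot> z))) * c)"])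
  \<comment> \<open>The pair consists of the antipode factor of the conjugate and the second
    component of m, which multiplies from the right.\<close>
  have c3: "swn 7 m (\<lambda>k. \<beta> (u \<cdot> (u' \<cdot> k 0)) * (\<nu> (k 5 \<cdot> (v \<cdot> (Si (k 2) \<cdot> w))) *
        (f (k (Suc 0) \<cdot> (r \<cdot> (S (k 6) \<cdot> k 7))) * g (k 3 \<cdot> (r' \<cdot> S (k 4)))))) =
      swn 5 m (\<lambda>k. \<beta> (u \<cdot> (u' \<cdot> k 0)) * (\<nu> (k 5 \<cdot> (v \<cdot> (Si (k 2) \<cdot> w))) *
        (f (k (Suc 0) \<cdot> r) * g (k 3 \<cdot> (r' \<cdot> S (k 4))))))"
    if [simp]: "u \<in> carr H" "u' \<in> carr H" "v \<in> carr H" "w \<in> carr H" "r \<in> carr H" "r' \<in> carr H"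
    for u u' v w r r'
    using swn_contract[of m 6 6 "\<lambda>k q. \<beta> (u \<cdot> (u' \<cdot> k 0)) * (\<nu> (k 5 \<cdot> (v \<cdot> (Si (k 2) \<cdot> w))) *
        (f (k 1 \<cdot> (r \<cdot> (S (q 0) \<cdot> q 1))) * g (k 3 \<cdot> (r' \<cdot> S (k 4)))))"
      "\<lambda>k. \<beta> (u \<cdot> (u' \<cdot> k 0)) * (\<nu> (k 5 \<cdot> (v \<cdot> (Si (k 2) \<cdot> w))) *
        (f (k 1 \<cdot> r) * g (k 3 \<cdot> (r' \<cdot> S (k 4)))))"]
    by (simp add: unt_right antipode_left_end[where f = "\<lambda>z. \<beta> (u \<cdot> (u' \<cdot> _ 0)) *
        (\<nu> (_ 5 \<cdot> (v \<cdot> (Si (_ 2) \<cdot> w))) * (f (_ (Suc 0) \<cdot> (r \<cdot> z)) * g (_ 3 \<cdot> (r' \<cdot> S (_ 4)))))"])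
  show ?thesis
    \<comment> \<open>The conjugate stays a single element until \<open>c1\<close> has cancelled
      inside its coproduct; it is expanded into components of m and b afterwards.\<close>
    by (simp add: ev_coact_DD_mul_right ev_act swn_swn mult.assoc dsw_simps mul_assoc c1
        mult.left_commute[of "\<nu> _" "\<beta> _"] del: swn1_mul swn2_mul)
      (simp add: swn_swn mul_assoc Si_mul swn_swap[of b c for c] swn_swap[of m x] swn_swap[of m y],
        simp add: swn_swn swn_swap[of x c for c] c2,
        simp add: swn_swap[of m c for c] swn_swap[of b x] swn_swap[of b y] swn_swap[of y x] c3)
qed

text \<open>The product in the double evaluates a component of \<beta> at \<open>Si\<close>(m3) x''
  m1 and the action evaluates the other at y'' m4. Recombined, \<beta> sees m4
  \<open>Si\<close>(m3), the single pair to cancel on this side.\<close>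

lemma yetter_drinfeld_right:
  assumes [simp]: "\<nu> \<in> carr D" "m \<in> carr H" "\<beta> \<in> carr D" "b \<in> carr H" "x \<in> carr H" "y \<in> carr H"
    and f [simp]: "linear_on H ground f" and g [simp]: "linear_on H ground g"
  shows "dsw \<nu> (\<lambda>\<nu>1 \<nu>2. swn 1 m (\<lambda>p. dsw \<beta> (\<lambda>\<beta>1 \<beta>2. swn 1 b (\<lambda>r.
      ev (mul DD (tn \<nu>2 (p 0)) (tn \<beta>2 (r 0))) x f * ev (act (tn \<nu>1 (p 1)) (tn \<beta>1 (r 1))) y g)))) =
    swn 1 x (\<lambda>p. swn 2 y (\<lambda>q. swn 2 b (\<lambda>r. swn 5 m (\<lambda>k. \<beta> (q 1 \<cdot> (p 1 \<cdot> k 0)) *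
      (\<nu> (k 5 \<cdot> (Si (r 1) \<cdot> (Si (k 2) \<cdot> (Si (q 2) \<cdot> (q 0 \<cdot> p 0))))) *
        (f (k 1 \<cdot> r 0) * g (k 3 \<cdot> (r 2 \<cdot> S (k 4)))))))))"
proof -
  note [simp] = linear_form_comp[OF f] linear_form_comp[OF g] dual_linear_comp[of \<beta>] dual_linear_comp[of \<nu>]
  have c1: "swn 7 m (\<lambda>k. \<beta> (y \<cdot> (k 3 \<cdot> (Si (k 2) \<cdot> (x \<cdot> k 0)))) *
      (\<nu> (k 7 \<cdot> (u \<cdot> (Si (k 4) \<cdot> v))) * (f (k (Suc 0) \<cdot> r) * g (k 5 \<cdot> (r' \<cdot> S (k 6)))))) =
    swn 5 m (\<lambda>k. \<beta> (y \<cdot> (x \<cdot> k 0)) *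
      (\<nu> (k 5 \<cdot> (u \<cdot> (Si (k 2) \<cdot> v))) * (f (k (Suc 0) \<cdot> r) * g (k 3 \<cdot> (r' \<cdot> S (k 4))))))"
    if [simp]: "y \<in> carr H" "x \<in> carr H" "u \<in> carr H" "v \<in> carr H" "r \<in> carr H" "r' \<in> carr H" for y x u v r r'
    using swn_contract[of m 2 6 "\<lambda>k q. \<beta> (y \<cdot> (q 1 \<cdot> (Si (q 0) \<cdot> (x \<cdot> k 0)))) *
      (\<nu> (k 6 \<cdot> (u \<cdot> (Si (k 3) \<cdot> v))) * (f (k 1 \<cdot> r) * g (k 4 \<cdot> (r' \<cdot> S (k 5)))))"
      "\<lambda>k. \<beta> (y \<cdot> (x \<cdot> k 0)) *
      (\<nu> (k 6 \<cdot> (u \<cdot> (Si (k 3) \<cdot> v))) * (f (k 1 \<cdot> r) * g (k 4 \<cdot> (r' \<cdot> S (k 5)))))"]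
    by (simp add: Si_right_mid[where f = "\<lambda>z. \<beta> (y \<cdot> z) *
      (\<nu> (_ 6 \<cdot> (u \<cdot> (Si (_ 3) \<cdot> v))) * (f (_ (Suc 0) \<cdot> r) * g (_ 4 \<cdot> (r' \<cdot> S (_ 5)))))"])
  show ?thesis
    by (simp add: ev_DD ev_act swn_swn mult.assoc dsw_simps mul_assoc Si_mul
        mult.left_commute[of "\<nu> _" "\<beta> _"] mult.left_commute[of "f _" "\<beta> _"] mult.left_commute[of "f _" "\<nu> _"]
        swn_swap[of m c for c] swn_swap[of b x] swn_swap[of b y] swn_swap[of y x] c1)
qed

text \<open>Both sides are bilinear in \<open>h\<close> and \<open>x\<close>, which takes most of
  the work; on pure tensors they equal the common value computed in the two preceding
  lemmas.\<close>

lemma yetter_drinfeld_double: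
  assumes h: "h \<in> carr W" and x: "x \<in> carr W"
  shows "tensor_lift W W (\<lambda>h1 h2. tensor_lift W W (\<lambda>u v. tens W W (mul DD u h2) v) (comul DD (act h1 x))) (comul DD h) =
    tensor_lift W W (\<lambda>h1 h2. tensor_lift W W (\<lambda>u v. tens W W (mul DD h1 u) (act h2 v)) (comul DD x)) (comul DD h)"
proof -
  let ?L = "\<lambda>h x. tensor_lift W W (\<lambda>h1 h2. tensor_lift W W (\<lambda>u v. tens W W (mul DD u h2) v) (comul DD (act h1 x))) (comul DD h)"
  let ?R = "\<lambda>h x. tensor_lift W W (\<lambda>h1 h2. tensor_lift W W (\<lambda>u v. tens W W (mul DD h1 u) (act h2 v)) (comul DD x)) (comul DD h)"
  have inL: "bilinear_on W W WW (\<lambda>u v. tens W W (mul DD u h2) v)" if "h2 \<in> carr W" for h2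
    using that by (intro bilinear_onI vector_linear linear_on_products) simp_all
  have inR: "bilinear_on W W WW (\<lambda>u v. tens W W (mul DD h1 u) (act h2 v))"
    if "h1 \<in> carr W" "h2 \<in> carr W" for h1 h2
    using that by (intro bilinear_onI vector_linear linear_on_products) simp_all
  have FL: "bilinear_on W W WW (\<lambda>h1 h2. tensor_lift W W (\<lambda>u v. tens W W (mul DD u h2) v) (comul DD (act h1 x)))"
    if x: "x \<in> carr W" for x
  proof (rule bilinear_onI)
    show "linear_on W WW (\<lambda>h1. tensor_lift W W (\<lambda>u v. tens W W (mul DD u h2) v) (comul DD (act h1 x)))"
      if "h2 \<in> carr W" for h2
      by (rule linear_on_comp[OF linear_on_comul_lift_vec[OF lin_space_tensor inL[OF that]]]) (simp add: x)
    show "linear_on W WW (\<lambda>h2. tensor_lift W W (\<lambda>u v. tens W W (mul DD u h2) v) (comul DD (act h1 x)))"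
      if "h1 \<in> carr W" for h1
      by (rule linear_on_tensor_lift_param)
        (intro lin_space_W lin_space_tensor comul_DD_closed product_closed that x inL
          vector_linear linear_on_products linear_on_id | assumption)+
  qed
  have FR: "bilinear_on W W WW (\<lambda>h1 h2. tensor_lift W W (\<lambda>u v. tens W W (mul DD h1 u) (act h2 v)) (comul DD x))"
    if x: "x \<in> carr W" for x
    by (rule bilinear_onI; rule linear_on_tensor_lift_param)
      (intro lin_space_W lin_space_tensor comul_DD_closed product_closed x inR
        vector_linear linear_on_products linear_on_id | assumption)+
  show ?thesis
  proof (rule WW_eqI)
    show "?L h x \<in> carr WW" "?R h x \<in> carr WW"
      by (rule tensor_lift_closed[OF lin_space_W lin_space_tensor FL[OF x] comul_DD_closed[OF h]]
          tensor_lift_closed[OF lin_space_W lin_space_tensor FR[OF x] comul_DD_closed[OF h]])+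
    fix a f b g
    assume [simp]: "a \<in> carr H" "b \<in> carr H"
      and f [simp]: "linear_on H ground f" and g [simp]: "linear_on H ground g"
    note ev2 = linear_on_comp[OF ev2_linear[OF f g]]
    show "ev2 (?L h x) a f b g = ev2 (?R h x) a f b g"
    proof (rule W_bilinear_form_eqI[OF _ _ _ _ _ h x,
          where F = "\<lambda>h x. ev2 (?L h x) a f b g" and G = "\<lambda>h x. ev2 (?R h x) a f b g"])
      show "linear_on W ground (\<lambda>h. ev2 (?L h x) a f b g)" if "x \<in> carr W" for x
        by (rule ev2[OF linear_on_comul_lift_vec[OF lin_space_tensor FL[OF that]]])
      show "linear_on W ground (\<lambda>h. ev2 (?R h x) a f b g)" if "x \<in> carr W" for x
        by (rule ev2[OF linear_on_comul_lift_vec[OF lin_space_tensor FR[OF that]]])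
      show "linear_on W ground (\<lambda>x. ev2 (?L h x) a f b g)" if "h \<in> carr W" for h
      proof (rule ev2, rule linear_on_tensor_lift_param)
        show "linear_on W WW (\<lambda>x. tensor_lift W W (\<lambda>u v. tens W W (mul DD u h2) v) (comul DD (act h1 x)))"
          if "h1 \<in> carr W" "h2 \<in> carr W" for h1 h2
          by (rule linear_on_comp[OF linear_on_comul_lift_vec[OF lin_space_tensor inL[OF that(2)]]]) (simp add: that)
      qed (intro lin_space_W lin_space_tensor comul_DD_closed that FL | assumption)+
      show "linear_on W ground (\<lambda>x. ev2 (?R h x) a f b g)" if "h \<in> carr W" for h
      proof (rule ev2, rule linear_on_tensor_lift_param)
        show "linear_on W WW (\<lambda>x. tensor_lift W W (\<lambda>u v. tens W W (mul DD h1 u) (act h2 v)) (comul DD x))"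
          if "h1 \<in> carr W" "h2 \<in> carr W" for h1 h2
          by (rule linear_on_comul_lift_vec[OF lin_space_tensor inR[OF that]])
      qed (intro lin_space_W lin_space_tensor comul_DD_closed that FR | assumption)+
      fix \<nu> m \<beta> c
      assume [simp]: "\<nu> \<in> carr D" "m \<in> carr H" "\<beta> \<in> carr D" "c \<in> carr H"
      have "ev2 (?L (tn \<nu> m) (tn \<beta> c)) a f b g =
          dsw \<nu> (\<lambda>\<nu>1 \<nu>2. swn 1 m (\<lambda>p. ev2 (tensor_lift W W (\<lambda>u v. tens W W (mul DD u (tn \<nu>1 (p 1))) v)
            (comul DD (act (tn \<nu>2 (p 0)) (tn \<beta> c)))) a f b g))"
        by (rule comul_DD_form[OF lin_space_tensor FL ev2_linear[OF f g]]) simp_all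
      moreover have "ev2 (?R (tn \<nu> m) (tn \<beta> c)) a f b g =
          dsw \<nu> (\<lambda>\<nu>1 \<nu>2. swn 1 m (\<lambda>p. ev2 (tensor_lift W W
            (\<lambda>u v. tens W W (mul DD (tn \<nu>2 (p 0)) u) (act (tn \<nu>1 (p 1)) v)) (comul DD (tn \<beta> c))) a f b g))"
        by (rule comul_DD_form[OF lin_space_tensor FR ev2_linear[OF f g]]) simp_all
      moreover have "\<dots> = dsw \<nu> (\<lambda>\<nu>1 \<nu>2. swn 1 m (\<lambda>p. dsw \<beta> (\<lambda>\<beta>1 \<beta>2. swn 1 c (\<lambda>r.
          ev (mul DD (tn \<nu>2 (p 0)) (tn \<beta>2 (r 0))) a f * ev (act (tn \<nu>1 (p 1)) (tn \<beta>1 (r 1))) b g))))"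
        by (intro dsw_cong swn_cong refl; simp)
          (subst comul_DD_form[OF lin_space_tensor inR ev2_linear[OF f g]], simp_all)
      ultimately show "ev2 (?L (tn \<nu> m) (tn \<beta> c)) a f b g = ev2 (?R (tn \<nu> m) (tn \<beta> c)) a f b g"
        using yetter_drinfeld_left[of \<nu> m \<beta> c a b f g] yetter_drinfeld_right[of \<nu> m \<beta> c a b f g] by simp
    qed
  qed
qed

lemma yd_module_algebra_heisenberg: "yd_module_algebra DD X act (comul DD)"
proof -
  have cong: "tensor DD WW = tensor W WW" "tens DD WW = tens W WW"
    by (intro tensor_space_cong tens_space_cong; simp)+
  have bil: "bilinear_on DD X X act"
    using act_bilinear by (simp add: bilinear_on_def linear_on_def)
  have lin: "linear_on X WW (comul DD)"
    using comul_DD_linear by (simp add: linear_on_space_of_W[of X])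
  show ?thesis
  proof (intro yd_module_algebra.intro k_algebra_X yd_module_algebra_axioms.intro)
    show "\<exists>T. hopf_algebra DD T" using hopf_algebra_DD by blast
  qed (simp_all add: bil lin cong sw2_def act_mul act_one_left act_prod act_unit comul_DD_coassoc
      comul_DD_counit coact_prod comul_DD_one yetter_drinfeld_double)
qed

end

theorem theorem1p1:
  fixes B :: "('k::field, 'b::ab_group_add) bialgebra_data"
    and S :: "'b \<Rightarrow> 'b"
  assumes "hopf_algebra B S"
    and "bij_betw S (carr B) (carr B)"
  shows "yd_module_algebra (drinfeld B S) (heisenberg B) (heis_act B S) (heis_coact B S)"
proof -
  interpret bij_hopf_algebra B S
    using assms by (simp add: bij_hopf_algebra_def bij_hopf_algebra_axioms_def)
  show ?thesis
    unfolding heis_coact_eq by (rule yd_module_algebra_heisenberg)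
qed

end
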